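(* Let $G$ be a finite group such that $\alpha(\Gamma(G))\leq 51$, where $\Gamma(G)$ is the comaximal subgroup graph of $G$ and $\alpha$ denotes the independence number. Then $G$ is solvable.
   Context: For a group $G$, the comaximal subgroup graph $\Gamma(G)$ is the simple undirected graph whose vertices are the non-trivial proper subgroups of $G$ (all subgroups $H$ with $H\neq\{e\}$ and $H\neq G$), where two distinct vertices $H$ and $K$ are adjacent if and only if $HK=G$, with $HK=\{hk: h\in H, k\in K\}$. The independence number $\alpha(\Gamma)$ of a finite graph $\Gamma$ is the maximum cardinality of a set of pairwise non-adjacent vertices (it is $0$ if the graph has no vertices). *)

theory Defs
  imports "HOL-Algebra.Solvable_Groups" "Graph_Theory.Pair_Digraph"
begin

text \<open>A simple undirected graph is a loop-free symmetric digraph, as in \<^locale>\<open>pair_graph\<close>.\<close>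

definition comaximal_subgroup_graph ::
    "('a, 'b) monoid_scheme \<Rightarrow> 'a set pair_pre_digraph" where
  "comaximal_subgroup_graph G =
     (let V = {H. subgroup H G \<and> H \<noteq> {\<one>\<^bsub>G\<^esub>} \<and> H \<noteq> carrier G}
      in \<lparr> pverts = V,
           parcs = {(H, K). H \<in> V \<and> K \<in> V \<and> H \<noteq> K \<and> H <#>\<^bsub>G\<^esub> K = carrier G} \<rparr>)"

definition independent_set :: "('a, 'b) pre_digraph \<Rightarrow> 'a set \<Rightarrow> bool" where
  "independent_set \<Gamma> S \<longleftrightarrow>
     S \<subseteq> verts \<Gamma> \<and> (\<forall>u\<in>S. \<forall>v\<in>S. u \<noteq> v \<longrightarrow> \<not> u \<rightarrow>\<^bsub>\<Gamma>\<^esub> v)"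

text \<open>Meaningful for finite graphs only. The empty set is always independent, so the maximum is
  taken over a nonempty set, and it is 0 for the null graph.\<close>

definition independence_number :: "('a, 'b) pre_digraph \<Rightarrow> nat" where
  "independence_number \<Gamma> = Max {card S | S. independent_set \<Gamma> S}"

lemma (in group) pair_graph_comaximal_subgroup_graph:
  assumes "finite (carrier G)"
  shows "pair_graph (comaximal_subgroup_graph G)"
proof -
  let ?\<Gamma> = "comaximal_subgroup_graph G"
  have V: "finite (pverts ?\<Gamma>)"
    by (rule finite_subset[of _ "Pow (carrier G)"])
      (use assms subgroup.subset in \<open>auto simp: comaximal_subgroup_graph_def Let_def\<close>)
  have A: "parcs ?\<Gamma> \<subseteq> pverts ?\<Gamma> \<times> pverts ?\<Gamma>"
    by (auto simp: comaximal_subgroup_graph_def Let_def)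
  have comm: "K <#> H = carrier G"
    if H: "subgroup H G" and K: "subgroup K G" and HK: "H <#> K = carrier G" for H K
  proof
    show "K <#> H \<subseteq> carrier G"
      using H K by (intro set_mult_closed subgroup.subset)
    show "carrier G \<subseteq> K <#> H"
    proof
      fix x assume x: "x \<in> carrier G"
      then have "inv x \<in> H <#> K" using HK by simp
      then obtain h k where hk: "h \<in> H" "k \<in> K" "inv x = h \<otimes> k"
        unfolding set_mult_def by blast
      then have "x = inv (h \<otimes> k)" using x by (metis inv_inv)
      then have "x = inv k \<otimes> inv h"
        using hk H K by (simp add: inv_mult_group subgroup.mem_carrier)
      then show "x \<in> K <#> H"
        using hk H K unfolding set_mult_def by (blast intro: subgroup.m_inv_closed)
    qed
  qed
  have S: "symmetric ?\<Gamma>"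
    using comm by (auto simp: symmetric_def sym_def comaximal_subgroup_graph_def Let_def)
  have L: "fst e \<noteq> snd e" if "e \<in> parcs ?\<Gamma>" for e
    using that by (auto simp: comaximal_subgroup_graph_def Let_def)
  have F: "finite (parcs ?\<Gamma>)"
    by (rule finite_subset[OF A finite_cartesian_product[OF V V]])
  show ?thesis
  proof
    show "fst e \<in> pverts ?\<Gamma>" "snd e \<in> pverts ?\<Gamma>" if "e \<in> parcs ?\<Gamma>" for e
      using subsetD[OF A that] by (simp_all add: mem_Times_iff)
  qed (fact V F S L)+
qed

end

theory Submission
  imports Defs "HOL-Algebra.Sym_Groups" "HOL-Algebra.Sylow" "HOL-Algebra.Multiplicative_Group"
    "HOL-Algebra.Zassenhaus" "HOL-Number_Theory.Cong"
begin

text \<open>A nonsolvable finite group has a finite nonabelian simple section: take a subgroup minimal among the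
nonsolvable ones and divide it by a maximal proper normal subgroup.  Preimages of pairwise
non-comaximal subgroups of the section are pairwise non-comaximal in the whole group.  So it is
enough to find, in every finite nonabelian simple group, 52 proper nontrivial subgroups no
two of which have the whole group as their product.

Independent families come from orders.  If \<open>H K = G\<close> then \<open>|G|\<close> divides
\<open>|H| |K|\<close>, so for a set \<open>S\<close> of numbers greater than 1 with no product \<open>a b\<close> (\<open>a\<close>,
\<open>b\<close> in \<open>S\<close>) divisible by \<open>|G|\<close>, all subgroups whose order lies in
\<open>S\<close> form an independent family (\<open>sum_list_num_subgroups_le\<close>).  Sets of prime
powers are usually of this kind.  Each number of subgroups is bounded below by simplicity: \<open>G\<close>
acts faithfully, and by even permutations, on the \<open>x\<close> conjugates of a proper nontrivial
subgroup, so \<open>2 |G|\<close> divides \<open>x!\<close> (\<open>order_dvd_fact_conjugates\<close>).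

Let \<open>p\<close> be the largest prime divisor of \<open>|G|\<close>.  Then every such \<open>x\<close> is at
least \<open>p\<close>.  For \<open>p \<ge> 5\<close> the number of Sylow \<open>p\<close>-subgroups is composite and not
the square of a prime, and this gives two further prime powers whose subgroups can be
counted; since three or four classes must not contain more than 51 subgroups, \<open>p \<le> 13\<close> and only a
few Sylow numbers \<open>1 + p j\<close> are left (\<open>largest_prime_sum\<close>).  For each of them the order
of \<open>G\<close> is bounded: if \<open>p\<close> divides \<open>|G|\<close> exactly once, the centralizer of a
Sylow subgroup \<open>P\<close> permutes the \<open>j\<close> nontrivial orbits of \<open>P\<close> on the Sylow
subgroups, the elements fixing all these orbits are those of \<open>P\<close>, and therefore \<open>|G|\<close>
divides \<open>(1 + p j) p (p - 1) j!\<close> (\<open>order_dvd_of_card_sylows\<close>).  The finitely many orders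
that remain are excluded one at a time by Sylow's theorem and a suitable family.  For \<open>p = 3\<close> the
order is \<open>2\<^sup>a 3\<^sup>b\<close>, there turn out to be 16 Sylow 3-subgroups, and families of orders again
suffice.

The tight case is \<open>|G| = 60\<close>, that is, the alternating group of degree 5.  There the family
consists of the 52 subgroups of order 2, 3, 4, 5, 6 and 10.  Orders 6 and 10 multiply to 60, and
comaximality is excluded by the fact that all involutions are conjugate (\<open>order_not_60\<close>).\<close>

section \<open>Arithmetic\<close>

lemma not_dvd_Suc_multiplicity:
  fixes p n :: nat
  assumes "prime p" "n \<noteq> 0"
  shows "\<not> p ^ multiplicity p n * p dvd n"
proof
  assume "p ^ multiplicity p n * p dvd n"
  then have "p ^ Suc (multiplicity p n) dvd n" by (simp add: mult.commute)
  then have "Suc (multiplicity p n) \<le> multiplicity p n"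
    using assms by (intro multiplicity_geI) (auto simp: not_prime_unit)
  then show False by simp
qed

text \<open>A number without prime divisors other than \<open>p\<close> is a power of \<open>p\<close>.\<close>

lemma dvd_prime_if_only_prime_divisor:
  fixes k p :: nat
  assumes "k \<noteq> 0" "\<And>q. prime q \<Longrightarrow> q dvd k \<Longrightarrow> q = p" "\<not> p\<^sup>2 dvd k"
  shows "k dvd p"
proof (cases "k = 1")
  case False
  then obtain m where m: "k = p * m" using assms(2) prime_factor_nat[of k] by (metis dvdE)
  have "m = 1"
  proof (rule ccontr)
    assume "m \<noteq> 1"
    then obtain q where q: "prime q" "q dvd m" using prime_factor_nat by blast
    then have "q = p" using assms(2)[of q] m by simp
    then show False using q(2) m assms(3) by (simp add: power2_eq_square mult_dvd_mono)
  qed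
  then show ?thesis using m by simp
qed simp

text \<open>Sylow numbers will play the role of \<open>n\<close>.  Such an \<open>n\<close> is bigger than \<open>p\<close> while
its prime divisors are smaller, so it is composite.  It is not the square of a prime \<open>q\<close> either: \<open>p\<close> would divide
\<open>(q - 1) (q + 1)\<close> with \<open>q < p\<close>, so that \<open>q = p - 1\<close> and the two primes are 2 and 3.\<close>

lemma cong_1_factors:
  fixes p n :: nat
  assumes p: "prime p" "5 \<le> p" and n: "n mod p = 1" "1 < n"
    and small: "\<And>q. prime q \<Longrightarrow> q dvd n \<Longrightarrow> q < p"
  shows "(\<exists>q r. prime q \<and> prime r \<and> q \<noteq> r \<and> q * r dvd n) \<or> (\<exists>q. prime q \<and> q ^ 3 dvd n)"
proof -
  have np: "p < n" using n p(2) by (metis One_nat_def mod_less less_irrefl linorder_neqE_nat mod_self nat_less_le zero_neq_one)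
  obtain q where q: "prime q" "q dvd n" using n(2) prime_factor_nat[of n] by auto
  then obtain s where s: "n = q * s" by blast
  have "s \<noteq> 1" using s small[OF q] np by auto
  then obtain r where r: "prime r" "r dvd s" using prime_factor_nat by blast
  then obtain t where t: "n = q * r * t" using s by (auto simp: mult.assoc elim!: dvdE)
  show ?thesis
  proof (cases "q = r")
    case False
    then show ?thesis using q r t by (metis dvd_triv_left)
  next
    case True
    have "t \<noteq> 1"
    proof
      assume "t = 1"
      then have qq: "q * q mod p = 1" using t n True by simp
      have q2: "2 \<le> q" "q < p" using q small prime_ge_2_nat by auto
      have "p dvd q * q - 1" using qq by (metis dvd_minus_mod)
      also have "q * q - 1 = (q - 1) * (q + 1)" by (simp add: algebra_simps)
      finally have "p dvd q - 1 \<or> p dvd q + 1" using p(1) prime_dvd_mult_iff by blast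
      then have "q + 1 = p" using q2 by (auto dest: dvd_imp_le)
      moreover have "odd p" using p prime_odd_nat by auto
      ultimately have "even q" by auto
      then have "q = 2" using q(1) by (auto simp: prime_nat_iff)
      then show False using \<open>q + 1 = p\<close> p(2) by simp
    qed
    then obtain u where u: "prime u" "u dvd t" using prime_factor_nat by blast
    show ?thesis
    proof (cases "u = q")
      case False
      have "q * u dvd n" using t u by (simp add: mult.assoc mult_dvd_mono)
      then show ?thesis using False q u by blast
    next
      case True
      have "q ^ 3 dvd n" using t u True \<open>q = r\<close> by (simp add: power3_eq_cube mult_dvd_mono)
      then show ?thesis using q by blast
    qed
  qed
qed

text \<open>Each member of \<open>{p, p\<^sup>2, q, r}\<close> is divisible by only one of the three primes.\<close>

lemma not_dvd_product_three_primes: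
  fixes p q r :: nat
  assumes "prime p" "prime q" "prime r" "p \<noteq> q" "p \<noteq> r" "q \<noteq> r" "p * q * r dvd g"
    and x: "x \<in> {p, p\<^sup>2, q, r}" and y: "y \<in> {p, p\<^sup>2, q, r}"
  shows "\<not> g dvd x * y"
proof
  assume "g dvd x * y"
  then have d: "p * q * r dvd x * y" using assms(7) dvd_trans by blast
  have "p dvd x \<or> p dvd y" "q dvd x \<or> q dvd y" "r dvd x \<or> r dvd y"
    using d assms(1-3) by (metis dvd_trans dvd_triv_left dvd_triv_right mult.assoc prime_dvd_mult_iff)+
  moreover have "\<not> p dvd q" "\<not> p dvd r" "\<not> q dvd p" "\<not> q dvd r" "\<not> r dvd p" "\<not> r dvd q"
    using assms(1-6) primes_dvd_imp_eq by blast+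
  moreover from this have "\<not> q dvd p\<^sup>2" "\<not> r dvd p\<^sup>2"
    using assms(1-3) prime_dvd_power_nat by blast+
  ultimately show False using x y by auto
qed

text \<open>The factor \<open>p\<close> forces one of \<open>x\<close>, \<open>y\<close> to be a power of \<open>p\<close>, and the
other one is at most \<open>q\<^sup>2\<close> in its \<open>q\<close>-part.\<close>

lemma not_dvd_product_prime_cube:
  fixes p q :: nat
  assumes "prime p" "prime q" "p \<noteq> q" "p * q ^ 3 dvd g"
    and x: "x \<in> {p, p\<^sup>2, q, q\<^sup>2}" and y: "y \<in> {p, p\<^sup>2, q, q\<^sup>2}"
  shows "\<not> g dvd x * y"
proof -
  have cop: "coprime q p" using assms(1-3) primes_coprime by metis
  have *: "\<not> q ^ 3 dvd u * v" if u: "u \<in> {p, p\<^sup>2}" and v: "v \<in> {p, p\<^sup>2, q, q\<^sup>2}" for u v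
  proof
    assume d: "q ^ 3 dvd u * v"
    have "coprime (q ^ 3) u" using u cop by (auto intro!: coprime_power_left_iff[THEN iffD2] coprime_power_right_iff[THEN iffD2])
    then have v3: "q ^ 3 dvd v" using d by (simp add: coprime_dvd_mult_right_iff)
    have q1: "1 < q" using assms(2) prime_gt_1_nat by blast
    consider "v \<in> {p, p\<^sup>2}" | "v = q ^ 1" | "v = q\<^sup>2" using v by auto
    then show False
    proof cases
      case 1
      then have "coprime (q ^ 3) v" using cop by auto
      then have "q ^ 3 = 1" using v3 by (metis coprime_absorb_left nat_dvd_1_iff_1)
      then show False using q1 by simp
    next
      case 2
      then show False using v3 q1 power_dvd_imp_le[of q 3 1] by simp
    next
      case 3
      then show False using v3 q1 power_dvd_imp_le[of q 3 2] by simp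
    qed
  qed
  show ?thesis
  proof
    assume "g dvd x * y"
    then have d: "p * q ^ 3 dvd x * y" using assms(4) dvd_trans by blast
    then have q3: "q ^ 3 dvd x * y" "p dvd x * y" using dvd_mult_left dvd_mult_right by blast+
    have "\<not> p dvd q" using assms(1-3) primes_dvd_imp_eq by blast
    then have "\<not> p dvd q" "\<not> p dvd q\<^sup>2" using assms(1) prime_dvd_power_nat by blast+
    then have "x \<in> {p, p\<^sup>2} \<or> y \<in> {p, p\<^sup>2}" using q3(2) x y assms(1) prime_dvd_mult_iff[of p x y] by auto
    then show False using *[of x y] *[of y x] q3(1) x y by (auto simp: mult.commute)
  qed
qed

text \<open>This lemma, \<open>prime_in_list\<close>, \<open>residue_in_list\<close> and \<open>divisor_residue_in_list\<close> reduce a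
finite search to the evaluation of \<^const>\<open>filter\<close> on a list of numerals.\<close>

lemma divisor_in_list:
  fixes k n :: nat
  assumes "k dvd n" "0 < n" "filter (\<lambda>d. d dvd n) [2..<Suc n] = xs"
  shows "k = 1 \<or> k \<in> set xs"
proof -
  have "0 < k" "k \<le> n" using assms(1,2) dvd_imp_le by (auto intro!: Nat.gr0I)
  then show ?thesis using assms(1) unfolding assms(3)[symmetric] by auto
qed

lemma prime_in_list:
  fixes p :: nat
  assumes "prime p" "l \<le> p" "p < u" "filter prime [l..<u] = xs"
  shows "p \<in> set xs"
  using assms(1-3) unfolding assms(4)[symmetric] by simp

lemma dvd_cofactor:
  fixes q n g d :: nat
  assumes "n * q dvd g" "g dvd d * q" "0 < q" shows "n dvd d"
  using dvd_trans[OF assms(1,2)] assms(3) by simp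

lemma residue_in_list:
  fixes n p :: nat
  assumes "n mod p = 1" "l \<le> n" "n < u" "filter (\<lambda>n. n mod p = 1) [l..<u] = xs"
  shows "n \<in> set xs"
  using assms(1-3) unfolding assms(4)[symmetric] by simp

lemma divisor_residue_in_list:
  fixes n p d :: nat
  assumes "n mod p = 1" "n dvd d" "l \<le> n" "n < u" "filter (\<lambda>n. n mod p = 1 \<and> n dvd d) [l..<u] = xs"
  shows "n \<in> set xs"
  using assms(1-4) unfolding assms(5)[symmetric] by simp

section \<open>Actions of subgroups\<close>

locale finite_group = group G for G (structure) +
  assumes fin [simp]: "finite (carrier G)"
begin

text \<open>The subgroup \<open>K\<close> and the finite set \<open>E\<close> are parameters and \<open>f\<close> is an
unrestricted map, so that the same \<open>f\<close> serves for all subgroups and all invariant subsets.\<close>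

definition acts :: "'a set \<Rightarrow> 'x set \<Rightarrow> ('a \<Rightarrow> 'x \<Rightarrow> 'x) \<Rightarrow> bool" where
  "acts K E f \<longleftrightarrow> subgroup K G \<and> finite E \<and> (\<forall>x\<in>E. f \<one> x = x) \<and> (\<forall>g\<in>K. \<forall>x\<in>E. f g x \<in> E)
     \<and> (\<forall>g\<in>K. \<forall>h\<in>K. \<forall>x\<in>E. f (g \<otimes> h) x = f g (f h x))"

lemma actsI:
  assumes "subgroup K G" "finite E" "\<And>x. x \<in> E \<Longrightarrow> f \<one> x = x"
    and "\<And>g x. g \<in> K \<Longrightarrow> x \<in> E \<Longrightarrow> f g x \<in> E"
    and "\<And>g h x. g \<in> K \<Longrightarrow> h \<in> K \<Longrightarrow> x \<in> E \<Longrightarrow> f (g \<otimes> h) x = f g (f h x)"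
  shows "acts K E f"
  using assms unfolding acts_def by blast

lemma actsD:
  assumes "acts K E f"
  shows "subgroup K G" "finite E" "x \<in> E \<Longrightarrow> f \<one> x = x" "g \<in> K \<Longrightarrow> x \<in> E \<Longrightarrow> f g x \<in> E"
    "g \<in> K \<Longrightarrow> h \<in> K \<Longrightarrow> x \<in> E \<Longrightarrow> f (g \<otimes> h) x = f g (f h x)"
  using assms unfolding acts_def by blast+

lemma acts_inv:
  assumes "acts K E f" "g \<in> K" "x \<in> E"
  shows "f (inv g) (f g x) = x" "f g (f (inv g) x) = x"
proof -
  have K: "subgroup K G" using assms by (simp add: acts_def)
  have g: "g \<in> carrier G" "inv g \<in> K"
    using K assms(2) by (auto intro: subgroup.mem_carrier subgroup.m_inv_closed)
  have "f (inv g) (f g x) = f (inv g \<otimes> g) x" "f g (f (inv g) x) = f (g \<otimes> inv g) x"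
    using actsD(5)[OF assms(1), of "inv g" g x] actsD(5)[OF assms(1), of g "inv g" x] assms(2,3) g by simp_all
  then show "f (inv g) (f g x) = x" "f g (f (inv g) x) = x"
    using actsD(3)[OF assms(1)] assms g by auto
qed

lemma stabilizer_is_subgroup:
  assumes "acts K E f" "X \<subseteq> E"
  shows "subgroup {g\<in>K. \<forall>x\<in>X. f g x = x} G"
proof -
  have K: "subgroup K G" using assms by (simp add: acts_def)
  interpret K: subgroup K G by fact
  show ?thesis
  proof (rule subgroupI)
    have "\<one> \<in> {g\<in>K. \<forall>x\<in>X. f g x = x}"
      using actsD(3)[OF assms(1)] assms(2) K.one_closed by blast
    then show "{g\<in>K. \<forall>x\<in>X. f g x = x} \<noteq> {}" by blast
    show "inv a \<in> {g\<in>K. \<forall>x\<in>X. f g x = x}" if "a \<in> {g\<in>K. \<forall>x\<in>X. f g x = x}" for a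
      using acts_inv(1)[OF assms(1), of a] that assms(2) by force
    show "a \<otimes> b \<in> {g\<in>K. \<forall>x\<in>X. f g x = x}"
      if "a \<in> {g\<in>K. \<forall>x\<in>X. f g x = x}" "b \<in> {g\<in>K. \<forall>x\<in>X. f g x = x}" for a b
    proof -
      have "f (a \<otimes> b) x = f a (f b x)" if "x \<in> X" for x
        using actsD(5)[OF assms(1), of a b x] that assms(2) \<open>a \<in> _\<close> \<open>b \<in> _\<close> by blast
      then show ?thesis using that by auto
    qed
  qed (use K.subset in auto)
qed

text \<open>The fibres of \<open>g \<mapsto> f g x\<close> are the left cosets of the stabilizer.\<close>

lemma orbit_stabilizer:
  assumes "acts K E f" "x \<in> E"
  shows "card ((\<lambda>g. f g x) ` K) * card {g\<in>K. f g x = x} = card K"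
proof -
  have K: "subgroup K G" using assms by (simp add: acts_def)
  interpret K: subgroup K G by fact
  have finK: "finite K" using K.subset fin finite_subset by blast
  have fib: "card {g\<in>K. f g x = y} = card {g\<in>K. f g x = x}" if y: "y \<in> (\<lambda>g. f g x) ` K" for y
  proof -
    obtain h where h: "h \<in> K" "y = f h x" using y by blast
    have "bij_betw (\<lambda>s. h \<otimes> s) {g\<in>K. f g x = x} {g\<in>K. f g x = y}"
    proof (rule bij_betwI[where g = "\<lambda>g. inv h \<otimes> g"])
      show "(\<lambda>s. h \<otimes> s) \<in> {g\<in>K. f g x = x} \<rightarrow> {g\<in>K. f g x = y}"
        using h assms actsD(5)[OF assms(1)] by auto
      show "(\<lambda>g. inv h \<otimes> g) \<in> {g\<in>K. f g x = y} \<rightarrow> {g\<in>K. f g x = x}"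
      proof
        fix g assume "g \<in> {g\<in>K. f g x = y}"
        then have g: "g \<in> K" "f g x = f h x" using h by auto
        have "f (inv h \<otimes> g) x = f (inv h) (f g x)"
          using g h assms K.m_inv_closed actsD(5)[OF assms(1)] by blast
        also have "\<dots> = x" using acts_inv(1)[OF assms(1) h(1) assms(2)] g by simp
        finally show "inv h \<otimes> g \<in> {g\<in>K. f g x = x}" using g h by auto
      qed
    qed (use h K.subset in \<open>auto simp: m_assoc[symmetric] subset_eq\<close>)
    then show ?thesis by (simp add: bij_betw_same_card)
  qed
  have "card K = (\<Sum>y\<in>(\<lambda>g. f g x) ` K. card {g\<in>K. f g x = y})"
    using sum.image_gen[OF finK, of "\<lambda>_. 1::nat" "\<lambda>g. f g x"] by simp
  also have "\<dots> = (\<Sum>y\<in>(\<lambda>g. f g x) ` K. card {g\<in>K. f g x = x})"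
    using fib by (intro sum.cong) auto
  finally show ?thesis by simp
qed

lemma orbits_disjoint_or_equal:
  assumes "acts K E f" "x \<in> E" "y \<in> E" "(\<lambda>g. f g x) ` K \<inter> (\<lambda>g. f g y) ` K \<noteq> {}"
  shows "(\<lambda>g. f g x) ` K = (\<lambda>g. f g y) ` K"
proof -
  have K: "subgroup K G" using assms by (simp add: acts_def)
  interpret K: subgroup K G by fact
  have *: "(\<lambda>g. f g a) ` K \<subseteq> (\<lambda>g. f g b) ` K"
    if "a \<in> E" "b \<in> E" "g \<in> K" "h \<in> K" "f g a = f h b" for a b g h
  proof
    fix z assume "z \<in> (\<lambda>g. f g a) ` K"
    then obtain k where k: "k \<in> K" "z = f k a" by blast
    have "a = f (inv g) (f h b)" using acts_inv(1)[OF assms(1) that(3,1)] that by simp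
    also have "\<dots> = f (inv g \<otimes> h) b" using actsD(5)[OF assms(1)] that K.m_inv_closed by simp
    finally have a: "a = f (inv g \<otimes> h) b" .
    have mem: "inv g \<otimes> h \<in> K" using that by auto
    have "z = f (k \<otimes> (inv g \<otimes> h)) b"
      using actsD(5)[OF assms(1), of k "inv g \<otimes> h" b] k mem that(2) a by simp
    then show "z \<in> (\<lambda>g. f g b) ` K" using k mem by blast
  qed
  obtain g h where "g \<in> K" "h \<in> K" "f g x = f h y" using assms(4) by blast
  then show ?thesis using *[of x y g h] *[of y x h g] assms by auto
qed

lemma dvd_card_of_orbits:
  assumes "acts K E f" "X \<subseteq> E" "\<And>g x. g \<in> K \<Longrightarrow> x \<in> X \<Longrightarrow> f g x \<in> X"
    and "\<And>x. x \<in> X \<Longrightarrow> k dvd card ((\<lambda>g. f g x) ` K)"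
  shows "k dvd card X"
proof -
  have K: "subgroup K G" "finite E" using assms by (auto simp: acts_def)
  interpret K: subgroup K G by fact
  let ?C = "(\<lambda>x. (\<lambda>g. f g x) ` K) ` X"
  have "x \<in> (\<lambda>g. f g x) ` K" if "x \<in> X" for x
  proof (rule image_eqI[of _ _ "\<one>"])
    show "x = f \<one> x" using actsD(3)[OF assms(1), of x] assms(2) that by auto
  qed (rule K.one_closed)
  then have U: "\<Union>?C = X" using assms(3) by blast
  have finX: "finite X" using K assms(2) finite_subset by blast
  have "k dvd card (\<Union>?C)"
  proof (rule dvd_partition)
    show "\<forall>c1\<in>?C. \<forall>c2\<in>?C. c1 \<noteq> c2 \<longrightarrow> c1 \<inter> c2 = {}"
      using orbits_disjoint_or_equal[OF assms(1)] assms(2) by blast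
  qed (use U finX assms(4) in auto)
  then show ?thesis using U by simp
qed

text \<open>The orbits of length greater than 1 have a positive power of \<open>p\<close> as their length.\<close>

lemma p_group_fixed_points:
  assumes "acts K E f" "card K = p ^ a" "prime (p::nat)"
  shows "[card E = card {x\<in>E. \<forall>g\<in>K. f g x = x}] (mod p)"
proof -
  have K: "subgroup K G" and finE: "finite E" using assms by (auto simp: acts_def)
  interpret K: subgroup K G by fact
  let ?F = "{x\<in>E. \<forall>g\<in>K. f g x = x}"
  have "p dvd card (E - ?F)"
  proof (rule dvd_card_of_orbits[OF assms(1)])
    fix g x assume gx: "g \<in> K" "x \<in> E - ?F"
    then obtain h where h: "h \<in> K" "f h x \<noteq> x" by blast
    have "f g x \<notin> ?F"
    proof
      assume "f g x \<in> ?F"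
      then have "f (inv g) (f g x) = f g x" using gx by auto
      then have "f g x = x" using acts_inv(1)[OF assms(1)] gx by auto
      then show False using \<open>f g x \<in> ?F\<close> h by auto
    qed
    then show "f g x \<in> E - ?F" using gx assms(1) unfolding acts_def by blast
  next
    fix x assume x: "x \<in> E - ?F"
    have os: "card ((\<lambda>g. f g x) ` K) * card {g\<in>K. f g x = x} = p ^ a"
      using orbit_stabilizer[OF assms(1)] x assms(2) by simp
    then have "card ((\<lambda>g. f g x) ` K) dvd p ^ a" by (metis dvd_triv_left)
    then obtain i where i: "card ((\<lambda>g. f g x) ` K) = p ^ i"
      using divides_primepow_nat[OF assms(3)] by blast
    have "card ((\<lambda>g. f g x) ` K) \<noteq> 1"
    proof
      assume "card ((\<lambda>g. f g x) ` K) = 1"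
      then obtain y where y: "(\<lambda>g. f g x) ` K = {y}" using card_1_singletonE by blast
      have "f \<one> x = x" using x assms(1) unfolding acts_def by blast
      then have "y = x" using y K.one_closed by (metis image_eqI singletonD)
      then show False using x y by auto
    qed
    then have "i \<noteq> 0" using i by auto
    then show "p dvd card ((\<lambda>g. f g x) ` K)" using i by (simp add: dvd_power)
  qed auto
  moreover have "card E = card (E - ?F) + card ?F"
    using finE by (metis (no_types, lifting) card_Diff_subset card_mono le_add_diff_inverse2 finite_subset mem_Collect_eq subsetI)
  ultimately show ?thesis by (auto simp: cong_def elim!: dvdE)
qed

end

section \<open>Cosets\<close>

context finite_group
begin

lemma acts_left_cosets:
  assumes "subgroup K G"
  shows "acts K (Pow (carrier G)) (\<lambda>g X. (\<lambda>x. g \<otimes> x) ` X)"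
proof -
  interpret K: subgroup K G by fact
  show ?thesis
  proof (rule actsI)
    fix x assume "x \<in> Pow (carrier G)"
    then show "(\<otimes>) \<one> ` x = x" by (auto simp: subset_eq image_iff)
  next
    fix g x assume "g \<in> K" "x \<in> Pow (carrier G)"
    then show "(\<otimes>) g ` x \<in> Pow (carrier G)" using K.subset by auto
  next
    fix g h x assume *: "g \<in> K" "h \<in> K" "x \<in> Pow (carrier G)"
    then show "(\<otimes>) (g \<otimes> h) ` x = (\<otimes>) g ` (\<otimes>) h ` x"
      unfolding image_image using K.subset by (intro image_cong refl m_assoc) auto
  qed (use assms in auto)
qed

lemma card_left_cosets:
  assumes "subgroup H G" "subgroup K G"
  shows "card ((\<lambda>g. (\<lambda>x. g \<otimes> x) ` H) ` K) * card (K \<inter> H) = card K"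
proof -
  interpret H: subgroup H G by fact
  interpret K: subgroup K G by fact
  have "{g \<in> K. (\<lambda>x. g \<otimes> x) ` H = H} = K \<inter> H"
  proof (intro equalityI subsetI)
    fix g assume g: "g \<in> {g \<in> K. (\<lambda>x. g \<otimes> x) ` H = H}"
    then have "g \<otimes> \<one> \<in> H" using H.one_closed by blast
    then show "g \<in> K \<inter> H" using g K.subset by auto
  next
    fix g assume g: "g \<in> K \<inter> H"
    have "h \<in> (\<lambda>x. g \<otimes> x) ` H" if "h \<in> H" for h
    proof -
      have "h = g \<otimes> (inv g \<otimes> h)" using that g H.subset by (simp add: m_assoc[symmetric] subset_eq)
      moreover have "inv g \<otimes> h \<in> H" using g that by auto
      ultimately show ?thesis by blast
    qed
    then show "g \<in> {g \<in> K. (\<lambda>x. g \<otimes> x) ` H = H}" using g by auto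
  qed
  then show ?thesis using orbit_stabilizer[OF acts_left_cosets[OF assms(2)], of H] H.subset by simp
qed

lemma card_subgroup_dvd:
  assumes "subgroup H G" "subgroup K G" "H \<subseteq> K" shows "card H dvd card K"
  using card_left_cosets[OF assms(1,2)] assms(3) by (metis dvd_triv_right inf.absorb_iff2)

lemma card_dvd_order: assumes "subgroup H G" shows "card H dvd order G"
  unfolding order_def by (rule card_subgroup_dvd[OF assms subgroup_self]) (use assms subgroup.subset in auto)

text \<open>If \<open>H K = G\<close> then \<open>H\<close> is transitive on the left cosets of \<open>K\<close>, and the
stabilizer of \<open>K\<close> is \<open>H \<inter> K\<close>.\<close>

lemma comaximal_card:
  assumes "subgroup H G" "subgroup K G" "H <#> K = carrier G"
  shows "card H * card K = order G * card (H \<inter> K)"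
proof -
  interpret H: subgroup H G by fact
  interpret K: subgroup K G by fact
  let ?O = "\<lambda>L. (\<lambda>g. (\<lambda>x. g \<otimes> x) ` K) ` L"
  have "?O (carrier G) \<subseteq> ?O H"
  proof
    fix X assume "X \<in> ?O (carrier G)"
    then obtain g where g: "g \<in> carrier G" "X = (\<lambda>x. g \<otimes> x) ` K" by blast
    then obtain h k where hk: "h \<in> H" "k \<in> K" "g = h \<otimes> k" using assms(3) unfolding set_mult_def by blast
    have kK: "(\<lambda>x. k \<otimes> x) ` K = K"
    proof (intro equalityI subsetI)
      fix y assume "y \<in> K"
      moreover have "y = k \<otimes> (inv k \<otimes> y)" using hk \<open>y \<in> K\<close> by (simp add: m_assoc[symmetric])
      ultimately show "y \<in> (\<lambda>x. k \<otimes> x) ` K" using hk by blast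
    qed (use hk in auto)
    have "X = (\<lambda>x. h \<otimes> x) ` (\<lambda>x. k \<otimes> x) ` K"
      unfolding g(2) image_image hk(3) using hk by (intro image_cong refl m_assoc) auto
    then show "X \<in> ?O H" using kK hk by auto
  qed
  then have eq: "?O (carrier G) = ?O H" using H.subset by auto
  have 1: "card (?O H) * card (H \<inter> K) = card H" by (rule card_left_cosets) fact+
  have 2: "card (?O (carrier G)) * card K = order G"
    using card_left_cosets[OF assms(2) subgroup_self] K.subset by (simp add: order_def inf.absorb2)
  show ?thesis unfolding 1[symmetric] 2[symmetric] eq by (simp only: ac_simps)
qed

end

section \<open>Conjugates and normalizers\<close>

context finite_group
begin

definition conjugate :: "'a \<Rightarrow> 'a set \<Rightarrow> 'a set" where
  "conjugate g H = (\<lambda>h. g \<otimes> h \<otimes> inv g) ` H"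

definition conjugates :: "'a set \<Rightarrow> 'a set set" where
  "conjugates H = (\<lambda>g. conjugate g H) ` carrier G"

definition normalizer_of :: "'a set \<Rightarrow> 'a set" where
  "normalizer_of H = {g \<in> carrier G. conjugate g H = H}"

definition Subgroups :: "'a set set" where
  "Subgroups = {H. subgroup H G}"

lemma finite_Subgroups [simp]: "finite Subgroups"
  by (rule finite_subset[of _ "Pow (carrier G)"]) (auto simp: Subgroups_def dest: subgroup.subset)

lemma finite_subgroup: "subgroup H G \<Longrightarrow> finite H"
  using finite_subset[OF subgroup.subset fin] .

lemma conjugate_closed: "g \<in> carrier G \<Longrightarrow> H \<subseteq> carrier G \<Longrightarrow> conjugate g H \<subseteq> carrier G"
  unfolding conjugate_def by auto

lemma conjugate_one: "H \<subseteq> carrier G \<Longrightarrow> conjugate \<one> H = H"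
  unfolding conjugate_def by (auto simp: subset_eq image_iff)

lemma conjugate_mult:
  assumes "g \<in> carrier G" "h \<in> carrier G" "H \<subseteq> carrier G"
  shows "conjugate (g \<otimes> h) H = conjugate g (conjugate h H)"
  unfolding conjugate_def image_image
  using assms by (intro image_cong refl) (auto simp: m_assoc inv_mult_group subset_eq)

lemma card_conjugate:
  assumes "g \<in> carrier G" "H \<subseteq> carrier G" shows "card (conjugate g H) = card H"
  unfolding conjugate_def
  by (rule card_image, rule inj_onI) (use assms in \<open>auto simp: subset_eq\<close>)

lemma subgroup_conjugate:
  assumes "g \<in> carrier G" "subgroup H G" shows "subgroup (conjugate g H) G"
proof -
  interpret H: subgroup H G by fact
  show ?thesis
  proof (rule subgroupI)
    show "conjugate g H \<subseteq> carrier G" using assms H.subset by (intro conjugate_closed)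
    show "conjugate g H \<noteq> {}" using H.one_closed unfolding conjugate_def by blast
  next
    fix a assume "a \<in> conjugate g H"
    then obtain h where h: "h \<in> H" "a = g \<otimes> h \<otimes> inv g" unfolding conjugate_def by blast
    then have "inv a = g \<otimes> inv h \<otimes> inv g" using assms by (simp add: inv_mult_group m_assoc)
    then show "inv a \<in> conjugate g H" unfolding conjugate_def using h by auto
  next
    fix a b assume "a \<in> conjugate g H" "b \<in> conjugate g H"
    then obtain h k where h: "h \<in> H" "a = g \<otimes> h \<otimes> inv g" "k \<in> H" "b = g \<otimes> k \<otimes> inv g"
      unfolding conjugate_def by blast
    then have "a \<otimes> b = g \<otimes> (h \<otimes> k) \<otimes> inv g" using assms
      by (simp add: m_assoc) (simp add: m_assoc[symmetric])
    then show "a \<otimes> b \<in> conjugate g H" unfolding conjugate_def using h by auto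
  qed
qed

lemma acts_conjugate:
  assumes "subgroup K G" shows "acts K Subgroups conjugate"
proof (rule actsI)
  interpret K: subgroup K G by fact
  show "conjugate g x \<in> Subgroups" if "g \<in> K" "x \<in> Subgroups" for g x
    using that subgroup_conjugate K.subset unfolding Subgroups_def by auto
  show "conjugate (g \<otimes> h) x = conjugate g (conjugate h x)" if "g \<in> K" "h \<in> K" "x \<in> Subgroups" for g h x
    using that K.subset unfolding Subgroups_def by (intro conjugate_mult) (auto dest: subgroup.subset)
qed (use assms finite_Subgroups in \<open>simp_all add: Subgroups_def conjugate_one subgroup.subset\<close>)

lemma subgroup_normalizer:
  assumes "subgroup H G" shows "subgroup (normalizer_of H) G"
  using stabilizer_is_subgroup[OF acts_conjugate[OF subgroup_self], of "{H}"] assms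
  unfolding normalizer_of_def Subgroups_def by simp

lemma card_conjugates:
  assumes "subgroup H G" shows "card (conjugates H) * card (normalizer_of H) = order G"
  using orbit_stabilizer[OF acts_conjugate[OF subgroup_self], of H] assms
  unfolding normalizer_of_def Subgroups_def conjugates_def order_def by simp

lemma conjugate_by_member:
  assumes "subgroup H G" "h \<in> H" shows "conjugate h H = H"
proof (rule card_subset_eq)
  interpret H: subgroup H G by fact
  show "finite H" by (rule finite_subgroup) fact
  show "conjugate h H \<subseteq> H" unfolding conjugate_def using assms by auto
  show "card (conjugate h H) = card H" using assms H.subset by (intro card_conjugate) auto
qed

lemma subset_normalizer: "subgroup H G \<Longrightarrow> H \<subseteq> normalizer_of H"
  unfolding normalizer_of_def using conjugate_by_member subgroup.mem_carrier by fastforce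

lemma normal_if_normalizer_is_carrier:
  assumes "subgroup H G" "normalizer_of H = carrier G" shows "H \<lhd> G"
  using assms unfolding normal_inv_iff normalizer_of_def conjugate_def by blast

lemma conjugates_props:
  assumes "subgroup H G" "K \<in> conjugates H"
  shows "subgroup K G" "card K = card H"
  using assms subgroup_conjugate card_conjugate subgroup.subset unfolding conjugates_def by blast+

end

section \<open>Sylow subgroups\<close>

context finite_group
begin

lemma order_pos: "order G > 0"
  by (simp add: order_def card_gt_0_iff) (use one_closed in blast)

lemma acts_subset:
  assumes "acts K E f" "F \<subseteq> E" "\<And>g x. g \<in> K \<Longrightarrow> x \<in> F \<Longrightarrow> f g x \<in> F" shows "acts K F f"
  by (rule actsI) (use assms finite_subset actsD[OF assms(1)] in \<open>auto simp: subset_eq\<close>)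

lemma finite_group_restrict:
  assumes "subgroup K G" shows "finite_group (G\<lparr>carrier := K\<rparr>)"
  using subgroup.subgroup_is_group[OF assms] finite_subgroup[OF assms] is_group
  by (simp add: finite_group_def finite_group_axioms_def)

text \<open>\<open>Q\<close> acts on the \<open>k\<close> left cosets of \<open>P\<close> in \<open>M\<close>.  As \<open>p\<close> does not
divide \<open>k\<close>, some coset \<open>m P\<close> is fixed, which means that \<open>Q\<close> lies in the conjugate of
\<open>P\<close> by \<open>m\<close>.  With \<open>M = G\<close> this yields the conjugacy of Sylow subgroups, and with
the normalizer of \<open>P\<close> as \<open>M\<close> it shows that \<open>P\<close> contains every
\<open>p\<close>-subgroup that normalizes it.\<close>

lemma subgroup_le_conjugate:
  assumes P: "subgroup P G" and Q: "subgroup Q G" and M: "subgroup M G" and PM: "P \<subseteq> M" and QM: "Q \<subseteq> M"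
    and p: "prime (p::nat)" and cQ: "card Q = p ^ a" and cM: "card M = k * card P" and k: "\<not> p dvd k"
  shows "\<exists>m\<in>M. Q \<subseteq> conjugate m P"
proof -
  interpret P: subgroup P G by fact
  interpret Q: subgroup Q G by fact
  interpret M: subgroup M G by fact
  let ?E = "(\<lambda>g. (\<lambda>x. g \<otimes> x) ` P) ` M"
  let ?f = "\<lambda>g X. (\<lambda>x. g \<otimes> x) ` X"
  have act: "acts Q ?E ?f"
  proof (rule acts_subset[OF acts_left_cosets[OF Q]])
    show "?E \<subseteq> Pow (carrier G)" using P.subset M.subset by auto
    fix q X assume "q \<in> Q" "X \<in> ?E"
    then obtain m where m: "m \<in> M" "X = (\<lambda>x. m \<otimes> x) ` P" by blast
    have "?f q X = (\<lambda>x. (q \<otimes> m) \<otimes> x) ` P"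
      unfolding m(2) image_image using \<open>q \<in> Q\<close> m(1) P.subset M.subset Q.subset
      by (intro image_cong refl) (auto simp: m_assoc subset_eq)
    moreover have "q \<otimes> m \<in> M" using \<open>q \<in> Q\<close> m(1) QM by auto
    ultimately show "?f q X \<in> ?E" by blast
  qed
  have "card P > 0" using P.one_closed finite_subgroup[OF P] card_gt_0_iff by blast
  moreover have "card ?E * card P = k * card P"
    using card_left_cosets[OF P M] PM cM by (simp add: inf.absorb2)
  ultimately have "card ?E = k" by simp
  then have "\<not> p dvd card {X\<in>?E. \<forall>g\<in>Q. ?f g X = X}"
    using p_group_fixed_points[OF act cQ p] k cong_dvd_iff by blast
  then have "{X\<in>?E. \<forall>g\<in>Q. ?f g X = X} \<noteq> {}" by (metis card.empty dvd_0_right)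
  then obtain m where m: "m \<in> M" "\<forall>g\<in>Q. ?f g (?f m P) = ?f m P" by blast
  have "q \<in> conjugate m P" if q: "q \<in> Q" for q
  proof -
    have "q \<otimes> (m \<otimes> \<one>) \<in> ?f q (?f m P)" by (intro imageI P.one_closed)
    then have "q \<otimes> (m \<otimes> \<one>) \<in> ?f m P" using m(2) q by blast
    then obtain u where u: "u \<in> P" "q \<otimes> m = m \<otimes> u" using m(1) M.subset by auto
    have "q = q \<otimes> m \<otimes> inv m" using q m(1) Q.subset M.subset by (simp add: m_assoc subset_eq)
    then show ?thesis unfolding conjugate_def using u by auto
  qed
  then show ?thesis using m(1) by blast
qed

text \<open>If \<open>p\<close> does not divide the order, the trivial subgroup is the only member.\<close>

definition sylows :: "nat \<Rightarrow> 'a set set" where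
  "sylows p = {P. subgroup P G \<and> card P = p ^ multiplicity p (order G)}"

lemma exists_subgroup_of_prime_power_order:
  assumes "prime p" "p ^ i dvd order G"
  shows "\<exists>H. subgroup H G \<and> card H = p ^ i"
proof -
  obtain m where "order G = p ^ i * m" using assms(2) by blast
  then show ?thesis using sylow_thm[OF assms(1) is_group _ fin] by blast
qed

lemma sylows_nonempty: assumes "prime p" shows "sylows p \<noteq> {}"
  using exists_subgroup_of_prime_power_order[OF assms multiplicity_dvd] unfolding sylows_def by blast

lemma sylow_index:
  assumes "prime p" "P \<in> sylows p" "subgroup M G" "P \<subseteq> M"
  obtains k where "card M = k * card P" "\<not> p dvd k"
proof -
  have P: "subgroup P G" "card P = p ^ multiplicity p (order G)" using assms(2) by (auto simp: sylows_def)
  obtain k where k: "card M = k * card P"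
    using card_subgroup_dvd[OF P(1) assms(3,4)] by (metis dvd_def mult.commute)
  have "\<not> p dvd k"
  proof
    assume "p dvd k"
    then have "p * card P dvd card M" using k by (simp add: mult_dvd_mono)
    then have "p ^ multiplicity p (order G) * p dvd order G"
      using card_dvd_order[OF assms(3)] P(2) dvd_trans by (simp add: mult.commute)
    then show False using not_dvd_Suc_multiplicity[OF assms(1)] order_pos by simp
  qed
  then show ?thesis using k that by blast
qed

lemma sylow_unique_in_normalizer:
  assumes "prime p" "P \<in> sylows p" "subgroup Q G" "card Q = p ^ a" "Q \<subseteq> normalizer_of P"
  shows "Q \<subseteq> P"
proof -
  have P: "subgroup P G" using assms(2) by (auto simp: sylows_def)
  obtain k where k: "card (normalizer_of P) = k * card P" "\<not> p dvd k"
    using sylow_index[OF assms(1,2) subgroup_normalizer[OF P] subset_normalizer[OF P]] .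
  obtain m where "m \<in> normalizer_of P" "Q \<subseteq> conjugate m P"
    using subgroup_le_conjugate[OF P assms(3) subgroup_normalizer[OF P] subset_normalizer[OF P] assms(5,1,4) k] by blast
  then show ?thesis unfolding normalizer_of_def by auto
qed

lemma sylows_eq_conjugates:
  assumes "prime p" "P \<in> sylows p" shows "sylows p = conjugates P"
proof (intro equalityI subsetI)
  have P: "subgroup P G" "card P = p ^ multiplicity p (order G)" using assms(2) by (auto simp: sylows_def)
  show "Q \<in> sylows p" if "Q \<in> conjugates P" for Q
    using conjugates_props[OF P(1) that] P(2) unfolding sylows_def by simp
  show "Q \<in> conjugates P" if Q: "Q \<in> sylows p" for Q
  proof -
    have Q: "subgroup Q G" "card Q = p ^ multiplicity p (order G)" using Q by (auto simp: sylows_def)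
    obtain k where k: "card (carrier G) = k * card P" "\<not> p dvd k"
      using sylow_index[OF assms subgroup_self subgroup.subset[OF P(1)]] .
    obtain m where m: "m \<in> carrier G" "Q \<subseteq> conjugate m P"
      using subgroup_le_conjugate[OF P(1) Q(1) subgroup_self subgroup.subset[OF P(1)] subgroup.subset[OF Q(1)]
          assms(1) Q(2) k] by blast
    have "Q = conjugate m P"
      using m Q P by (intro card_subset_eq finite_subgroup subgroup_conjugate)
        (auto simp: card_conjugate subgroup.subset)
    then show ?thesis using m unfolding conjugates_def by blast
  qed
qed

lemma card_sylows:
  assumes "prime p" "P \<in> sylows p" shows "card (sylows p) * card (normalizer_of P) = order G"
  using card_conjugates sylows_eq_conjugates[OF assms] assms(2) unfolding sylows_def by auto

lemma card_sylows_dvd: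
  assumes "prime p" shows "card (sylows p) * p ^ multiplicity p (order G) dvd order G"
proof -
  obtain P where P: "P \<in> sylows p" using sylows_nonempty[OF assms] by blast
  then have sP: "subgroup P G" "card P = p ^ multiplicity p (order G)" by (auto simp: sylows_def)
  have "card P dvd card (normalizer_of P)"
    using card_subgroup_dvd[OF sP(1) subgroup_normalizer[OF sP(1)] subset_normalizer[OF sP(1)]] .
  then show ?thesis using card_sylows[OF assms P] sP(2) by (metis dvd_refl mult_dvd_mono)
qed

lemma acts_sylows:
  assumes "prime p" "subgroup K G" shows "acts K (sylows p) conjugate"
proof (rule acts_subset[OF acts_conjugate[OF assms(2)]])
  show "sylows p \<subseteq> Subgroups" unfolding sylows_def Subgroups_def by auto
  fix g P assume "g \<in> K" "P \<in> sylows p"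
  then have "g \<in> carrier G" using subgroup.mem_carrier[OF assms(2)] by blast
  then show "conjugate g P \<in> sylows p"
    using \<open>P \<in> sylows p\<close> by (auto simp: sylows_def subgroup_conjugate card_conjugate subgroup.subset)
qed

lemma sylow_eqI:
  assumes "P \<in> sylows p" "Q \<in> sylows p" "P \<subseteq> Q" shows "P = Q"
  using assms card_subset_eq[OF finite_subgroup] unfolding sylows_def by auto

text \<open>Let \<open>P\<close> act by conjugation.  A fixed Sylow subgroup is normalized by \<open>P\<close>, hence equal to
\<open>P\<close>.\<close>

lemma card_sylows_cong_1:
  assumes "prime p" shows "[card (sylows p) = 1] (mod p)"
proof -
  obtain P where P: "P \<in> sylows p" using sylows_nonempty[OF assms] by blast
  then have sP: "subgroup P G" "card P = p ^ multiplicity p (order G)" by (auto simp: sylows_def)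
  have "{Q \<in> sylows p. \<forall>g\<in>P. conjugate g Q = Q} = {P}"
  proof (intro equalityI subsetI)
    fix Q assume Q: "Q \<in> {Q \<in> sylows p. \<forall>g\<in>P. conjugate g Q = Q}"
    then have "P \<subseteq> normalizer_of Q" unfolding normalizer_of_def using subgroup.mem_carrier[OF sP(1)] by blast
    then have "P \<subseteq> Q" using sylow_unique_in_normalizer[OF assms _ sP] Q by blast
    then show "Q \<in> {P}" using sylow_eqI[of P p Q] P Q by blast
  qed (use P conjugate_by_member[OF sP(1)] in auto)
  then show ?thesis using p_group_fixed_points[OF acts_sylows[OF assms sP(1)] sP(2) assms] by simp
qed

end

section \<open>Permutation representations\<close>

context finite_group
begin

lemma finite_group_sym: "finite_group (sym_group n)"
  unfolding finite_group_def finite_group_axioms_def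
  using sym_group_is_group finite_permutations[of "{1..n}"] by (simp add: sym_group_def)

text \<open>The set \<open>E\<close> is numbered in order to reach the symmetric groups of the library, which
consist of permutations of \<open>{1..n}\<close>.\<close>

lemma permutation_representation:
  assumes act: "acts K E f" and n: "card E = n"
  obtains \<phi> where "\<phi> \<in> hom (G\<lparr>carrier := K\<rparr>) (sym_group n)"
    "\<forall>k\<in>K. \<phi> k = id \<longleftrightarrow> (\<forall>x\<in>E. f k x = x)"
proof -
  note D = actsD[OF act]
  obtain b where b: "bij_betw b {1..n} E" using ex_bij_betw_nat_finite_1[OF D(2)] n by blast
  define c where "c = inv_into {1..n} b"
  have c: "bij_betw c E {1..n}" unfolding c_def by (rule bij_betw_inv_into[OF b])
  have cb: "c (b i) = i" if "i \<in> {1..n}" for i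
    unfolding c_def using b that by (simp add: bij_betw_inv_into_left)
  have bc: "b (c x) = x" if "x \<in> E" for x
    unfolding c_def using b that by (simp add: bij_betw_inv_into_right)
  have bE: "b i \<in> E" if "i \<in> {1..n}" for i using b that by (rule bij_betwE[THEN bspec])
  have cE: "c x \<in> {1..n}" if "x \<in> E" for x using c that by (rule bij_betwE[THEN bspec])
  define \<phi> where "\<phi> k = (\<lambda>i. if i \<in> {1..n} then c (f k (b i)) else i)" for k
  have mult: "\<phi> (g \<otimes> h) = \<phi> g \<circ> \<phi> h" if "g \<in> K" "h \<in> K" for g h
  proof
    fix i show "\<phi> (g \<otimes> h) i = (\<phi> g \<circ> \<phi> h) i"
    proof (cases "i \<in> {1..n}")
      case True
      have "\<phi> (g \<otimes> h) i = c (f g (f h (b i)))" using True D(5) that bE unfolding \<phi>_def by simp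
      also have "\<dots> = \<phi> g (\<phi> h i)"
        using True D(4) that bE cE bc unfolding \<phi>_def by (simp del: atLeastAtMost_iff)
      finally show ?thesis by simp
    qed (auto simp: \<phi>_def)
  qed
  have one: "\<phi> k = id \<longleftrightarrow> (\<forall>x\<in>E. f k x = x)" if k: "k \<in> K" for k
  proof
    assume id: "\<phi> k = id"
    show "\<forall>x\<in>E. f k x = x"
    proof
      fix x assume x: "x \<in> E"
      have "c (f k (b (c x))) = c x" using fun_cong[OF id, of "c x"] cE[OF x] unfolding \<phi>_def by simp
      then have "c (f k x) = c x" using bc x by simp
      then show "f k x = x" using bc D(4) k x by metis
    qed
  next
    assume "\<forall>x\<in>E. f k x = x"
    then show "\<phi> k = id" unfolding \<phi>_def using bE cb by auto
  qed
  have perm: "\<phi> k permutes {1..n}" if k: "k \<in> K" for k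
  proof (rule bij_imp_permutes)
    have k': "inv k \<in> K" using k D(1) by (simp add: subgroup.m_inv_closed)
    show "bij_betw (\<phi> k) {1..n} {1..n}"
    proof (rule bij_betwI[where g = "\<phi> (inv k)"])
      show "\<phi> k \<in> {1..n} \<rightarrow> {1..n}" "\<phi> (inv k) \<in> {1..n} \<rightarrow> {1..n}"
        unfolding \<phi>_def using D(4) k k' bE cE by (auto simp del: atLeastAtMost_iff)
      have kc: "k \<in> carrier G" using k D(1) subgroup.mem_carrier by metis
      have o: "\<phi> \<one> = id" using one[OF subgroup.one_closed[OF D(1)]] D(3) by simp
      show "\<phi> (inv k) (\<phi> k x) = x" for x
        using fun_cong[OF mult[OF k' k], of x] kc o by simp
      show "\<phi> k (\<phi> (inv k) x) = x" for x
        using fun_cong[OF mult[OF k k'], of x] kc o by simp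
    qed
  qed (auto simp: \<phi>_def)
  show ?thesis
  proof
    show "\<phi> \<in> hom (G\<lparr>carrier := K\<rparr>) (sym_group n)"
      by (rule homI) (use perm mult in \<open>auto simp: sym_group_carrier sym_group_mult\<close>)
  qed (use one in blast)
qed

text \<open>The second equation is the orbit-stabilizer theorem for the action of \<open>K\<close> by left
multiplication on the symmetric group, applied to the identity.\<close>

lemma card_permutation_image:
  assumes K: "subgroup K G" and \<phi>: "\<phi> \<in> hom (G\<lparr>carrier := K\<rparr>) (sym_group n)"
  shows "subgroup (\<phi> ` K) (sym_group n)"
    "card (\<phi> ` K) * card {k\<in>K. \<phi> k = id} = card K"
proof -
  interpret S: finite_group "sym_group n" by (rule finite_group_sym)
  interpret K: finite_group "G\<lparr>carrier := K\<rparr>" by (rule finite_group_restrict[OF K])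
  interpret h: group_hom "G\<lparr>carrier := K\<rparr>" "sym_group n" \<phi>
    using \<phi> by unfold_locales
  show "subgroup (\<phi> ` K) (sym_group n)" using h.img_is_subgroup by simp
  have "acts K (carrier (sym_group n)) (\<lambda>k s. \<phi> k \<circ> s)"
  proof (rule actsI[OF K S.fin])
    show "\<phi> \<one> \<circ> s = s" for s using h.hom_one by (simp add: sym_group_one)
    show "\<phi> g \<circ> s \<in> carrier (sym_group n)" if "g \<in> K" "s \<in> carrier (sym_group n)" for g s
      using S.m_closed[OF _ that(2), of "\<phi> g"] h.hom_closed[of g] that(1) by (simp add: sym_group_mult)
    show "\<phi> (g \<otimes> h) \<circ> s = \<phi> g \<circ> (\<phi> h \<circ> s)" if "g \<in> K" "h \<in> K" for g h s
      using h.hom_mult[of g h] that by (simp add: sym_group_mult comp_assoc)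
  qed
  from orbit_stabilizer[OF this, of id]
  show "card (\<phi> ` K) * card {k\<in>K. \<phi> k = id} = card K"
    by (simp add: sym_group_carrier permutes_id)
qed

lemma card_dvd_kernel_mult_fact:
  assumes "acts K E f" "card E = n"
  shows "card K dvd card {k\<in>K. \<forall>x\<in>E. f k x = x} * fact n"
proof -
  interpret S: finite_group "sym_group n" by (rule finite_group_sym)
  obtain \<phi> where \<phi>: "\<phi> \<in> hom (G\<lparr>carrier := K\<rparr>) (sym_group n)"
    "\<forall>k\<in>K. \<phi> k = id \<longleftrightarrow> (\<forall>x\<in>E. f k x = x)"
    using permutation_representation[OF assms] .
  note * = card_permutation_image[OF actsD(1)[OF assms(1)] \<phi>(1)]
  have dvd_im: "card (\<phi> ` K) dvd fact n"
    using S.card_dvd_order[OF *(1)] by (simp add: order_def sym_group_card_carrier)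
  have "{k\<in>K. \<phi> k = id} = {k\<in>K. \<forall>x\<in>E. f k x = x}"
    using \<phi>(2) by (intro Collect_cong) (simp cong: conj_cong)
  then have "card K = card (\<phi> ` K) * card {k\<in>K. \<forall>x\<in>E. f k x = x}" using *(2) by simp
  then show ?thesis using dvd_im by (simp add: mult.commute mult_dvd_mono)
qed

lemma kernel_of_action_normal:
  assumes "acts (carrier G) E f"
  shows "{g\<in>carrier G. \<forall>x\<in>E. f g x = x} \<lhd> G"
  unfolding normal_inv_iff
proof (intro conjI ballI)
  show "subgroup {g\<in>carrier G. \<forall>x\<in>E. f g x = x} G"
    by (rule stabilizer_is_subgroup[OF assms]) simp
  fix g h assume gh: "g \<in> carrier G" "h \<in> {g\<in>carrier G. \<forall>x\<in>E. f g x = x}"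
  note D = actsD[OF assms]
  have "f (g \<otimes> h \<otimes> inv g) x = x" if x: "x \<in> E" for x
  proof -
    have "f (g \<otimes> h \<otimes> inv g) x = f g (f h (f (inv g) x))"
      using D(4,5) gh x by simp
    also have "\<dots> = f g (f (inv g) x)" using D(4) gh x by simp
    also have "\<dots> = x" using acts_inv(2)[OF assms] gh x by simp
    finally show ?thesis .
  qed
  then show "g \<otimes> h \<otimes> inv g \<in> {g\<in>carrier G. \<forall>x\<in>E. f g x = x}" using gh by simp
qed

end

section \<open>Centralizers, normalizers and intersections\<close>

context finite_group
begin

definition centralizer_of :: "'a set \<Rightarrow> 'a set" where
  "centralizer_of P = {g \<in> carrier G. \<forall>u\<in>P. g \<otimes> u \<otimes> inv g = u}"

lemma acts_conjugation:
  assumes "subgroup K G" shows "acts K (carrier G) (\<lambda>g x. g \<otimes> x \<otimes> inv g)"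
proof (rule actsI)
  interpret K: subgroup K G by fact
  show "g \<otimes> h \<otimes> x \<otimes> inv (g \<otimes> h) = g \<otimes> (h \<otimes> x \<otimes> inv h) \<otimes> inv g"
    if "g \<in> K" "h \<in> K" "x \<in> carrier G" for g h x
    using that K.subset by (simp add: m_assoc inv_mult_group subset_eq)
  show "g \<otimes> x \<otimes> inv g \<in> carrier G" if "g \<in> K" "x \<in> carrier G" for g x
    using that K.subset by (simp add: subset_eq)
qed (use assms in auto)

lemma subgroup_centralizer: assumes "P \<subseteq> carrier G" shows "subgroup (centralizer_of P) G"
  unfolding centralizer_of_def by (rule stabilizer_is_subgroup[OF acts_conjugation[OF subgroup_self] assms])

lemma conjugation_fixes_iff_commute:
  assumes "a \<in> carrier G" "b \<in> carrier G"
  shows "a \<otimes> b \<otimes> inv a = b \<longleftrightarrow> a \<otimes> b = b \<otimes> a"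
  using assms inv_solve_right'[of b "a \<otimes> b" a] by auto

lemma centralizer_subset_normalizer: "centralizer_of P \<subseteq> normalizer_of P"
proof
  fix g assume g: "g \<in> centralizer_of P"
  then have "conjugate g P = (\<lambda>u. u) ` P" unfolding conjugate_def centralizer_of_def by (intro image_cong) auto
  then show "g \<in> normalizer_of P" using g unfolding normalizer_of_def centralizer_of_def by auto
qed

text \<open>The elements of \<open>P\<close> that commute with \<open>g\<close> form a subgroup, and \<open>P\<close> has no
subgroups besides itself and the trivial one.\<close>

lemma mem_centralizer_prime_order:
  assumes P: "subgroup P G" "card P = p" and p: "prime (p::nat)"
    and u: "u \<in> P" "u \<noteq> \<one>" and g: "g \<in> carrier G" and fix_u: "g \<otimes> u \<otimes> inv g = u"
  shows "g \<in> centralizer_of P"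
proof -
  let ?D = "{v\<in>P. \<forall>x\<in>{g}. v \<otimes> x \<otimes> inv v = x}"
  have D: "subgroup ?D G" by (rule stabilizer_is_subgroup[OF acts_conjugation[OF P(1)]]) (use g in simp)
  have uc: "u \<in> carrier G" using u P subgroup.mem_carrier by metis
  have "u \<in> ?D" using u fix_u g uc by (simp add: conjugation_fixes_iff_commute)
  then have "{\<one>, u} \<subseteq> ?D" using subgroup.one_closed[OF D] by auto
  then have "card {\<one>, u} \<le> card ?D" by (rule card_mono[OF finite_subgroup[OF D]])
  moreover have "card ?D dvd p" using card_subgroup_dvd[OF D P(1)] P(2) by auto
  ultimately have "card ?D = p" using p u(2) by (auto simp: prime_nat_iff)
  then have "?D = P" using P(2) by (intro card_subset_eq finite_subgroup[OF P(1)]) auto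
  then have "v \<otimes> g \<otimes> inv v = g" if "v \<in> P" for v using that by blast
  then show ?thesis
    unfolding centralizer_of_def using g subgroup.mem_carrier[OF P(1)]
    by (auto simp: conjugation_fixes_iff_commute)
qed

text \<open>The normalizer acts on the \<open>p - 1\<close> nontrivial elements of \<open>P\<close> by conjugation.  All
stabilizers are equal to the centralizer, so all orbits have the same length.\<close>

lemma card_normalizer_dvd:
  assumes P: "subgroup P G" "card P = p" and p: "prime (p::nat)"
  shows "card (normalizer_of P) dvd card (centralizer_of P) * (p - 1)"
proof -
  let ?f = "\<lambda>g x. g \<otimes> x \<otimes> inv g"
  have N: "subgroup (normalizer_of P) G" by (rule subgroup_normalizer[OF P(1)])
  have C: "subgroup (centralizer_of P) G" by (rule subgroup_centralizer[OF subgroup.subset[OF P(1)]])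
  interpret P: subgroup P G by (rule P)
  have act: "acts (normalizer_of P) (carrier G) ?f" by (rule acts_conjugation[OF N])
  have "card (normalizer_of P) div card (centralizer_of P) dvd card (P - {\<one>})"
  proof (rule dvd_card_of_orbits[OF act])
    show "P - {\<one>} \<subseteq> carrier G" using P.subset by auto
    fix g x assume g: "g \<in> normalizer_of P" and x: "x \<in> P - {\<one>}"
    have gc: "g \<in> carrier G" "conjugate g P = P" using g by (auto simp: normalizer_of_def)
    have "?f g x \<in> P" using gc(2) x unfolding conjugate_def by blast
    moreover have "?f g x \<noteq> \<one>"
    proof
      assume "?f g x = \<one>"
      then have "g \<otimes> x = g" using gc x P.subset inv_solve_right'[of \<one> "g \<otimes> x" g] by auto
      then show False using gc x P.subset by auto
    qed
    ultimately show "?f g x \<in> P - {\<one>}" by blast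
  next
    fix x assume x: "x \<in> P - {\<one>}"
    have "{g\<in>normalizer_of P. ?f g x = x} = centralizer_of P"
      using mem_centralizer_prime_order[OF P p, of x] x centralizer_subset_normalizer unfolding normalizer_of_def centralizer_of_def by blast
    then have "card ((\<lambda>g. ?f g x) ` normalizer_of P) * card (centralizer_of P) = card (normalizer_of P)"
      using orbit_stabilizer[OF act, of x] x P.subset by auto
    moreover have "card (centralizer_of P) > 0"
      using subgroup.one_closed[OF C] finite_subgroup[OF C] card_gt_0_iff by blast
    ultimately show "card (normalizer_of P) div card (centralizer_of P) dvd card ((\<lambda>g. ?f g x) ` normalizer_of P)"
      by (metis div_mult_self_is_m dvd_refl)
  qed
  moreover have "card (P - {\<one>}) = p - 1" using P finite_subgroup[OF P(1)] by simp
  moreover have "card (normalizer_of P) = card (centralizer_of P) * (card (normalizer_of P) div card (centralizer_of P))"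
    using card_subgroup_dvd[OF C N centralizer_subset_normalizer] by simp
  ultimately show ?thesis by (metis dvd_refl mult_dvd_mono)
qed

lemma pow_card_subgroup:
  assumes "subgroup H G" "x \<in> H" shows "x [^] card H = \<one>"
proof -
  interpret H: finite_group "G\<lparr>carrier := H\<rparr>" by (rule finite_group_restrict[OF assms(1)])
  have "x [^]\<^bsub>G\<lparr>carrier := H\<rparr>\<^esub> card H = \<one>" using H.pow_order_eq_1[of x] assms(2) by (simp add: order_def)
  then show ?thesis by (simp add: nat_pow_def)
qed

lemma eq_one_if_coprime_powers:
  assumes "x \<in> carrier G" "x [^] (m::nat) = \<one>" "x [^] (n::nat) = \<one>" "coprime m n"
  shows "x = \<one>"
proof -
  have "ord x dvd m" "ord x dvd n" using assms pow_eq_id by blast+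
  then have "ord x = 1" using assms(4) by (metis coprime_common_divisor_nat nat_dvd_1_iff_1)
  then show ?thesis using assms(1) ord_eq_1 by blast
qed

lemma Cauchy_in_subgroup:
  assumes "subgroup K G" "prime q" "q dvd card K"
  shows "\<exists>R. subgroup R G \<and> R \<subseteq> K \<and> card R = q"
proof -
  interpret K: finite_group "G\<lparr>carrier := K\<rparr>" by (rule finite_group_restrict[OF assms(1)])
  obtain R where R: "subgroup R (G\<lparr>carrier := K\<rparr>)" "card R = q"
    using K.exists_subgroup_of_prime_power_order[OF assms(2), of 1] assms(3) by (auto simp: order_def)
  then show ?thesis using incl_subgroup[OF assms(1) R(1)] subgroup.subset[OF R(1)] by auto
qed

lemma subgroup_nontrivial_element:
  assumes "subgroup R G" "card R > 1" obtains r where "r \<in> R" "r \<noteq> \<one>"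
proof -
  have "\<not> R \<subseteq> {\<one>}" using assms(2) card_mono[of "{\<one>}" R] by auto
  then show ?thesis using that by blast
qed

lemma coprime_subgroups_trivial_Int:
  assumes "subgroup H G" "subgroup K G" "coprime (card H) (card K)" shows "H \<inter> K = {\<one>}"
proof (intro equalityI subsetI)
  fix x assume "x \<in> H \<inter> K"
  then have x: "x \<in> H" "x \<in> K" by auto
  have "x = \<one>"
    by (rule eq_one_if_coprime_powers[OF subgroup.mem_carrier[OF assms(1) x(1)]
        pow_card_subgroup[OF assms(1) x(1)] pow_card_subgroup[OF assms(2) x(2)] assms(3)])
  then show "x \<in> {\<one>}" by simp
qed (use assms subgroup.one_closed in blast)

lemma prime_order_subgroups_trivial_Int:
  assumes "subgroup H G" "subgroup K G" "card H = p" "card K = p" "prime p" "H \<noteq> K"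
  shows "H \<inter> K = {\<one>}"
proof -
  have I: "subgroup (H \<inter> K) G" using assms by (simp add: subgroups_Inter_pair)
  have "card (H \<inter> K) dvd p" using card_subgroup_dvd[OF I assms(1)] assms(3) by auto
  moreover have "card (H \<inter> K) \<noteq> p"
  proof
    assume "card (H \<inter> K) = p"
    then have "H \<inter> K = H" "H \<inter> K = K"
      using assms(3,4) by (intro card_subset_eq finite_subgroup assms(1,2); simp)+
    then show False using assms(6) by simp
  qed
  ultimately have "card (H \<inter> K) = 1" using assms(5) by (auto simp: prime_nat_iff)
  then show ?thesis using subgroup.one_closed[OF I] card_1_singletonE by (metis singletonD)
qed

text \<open>\<open>S\<close> is the disjoint union of \<open>R\<close> and \<open>x R\<close> for \<open>x\<close> outside
\<open>R\<close>, and a conjugate of \<open>R\<close> under \<open>x\<close> cannot meet \<open>x R\<close>.\<close>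

lemma index_2_subset_normalizer:
  assumes R: "subgroup R G" and S: "subgroup S G" and RS: "R \<subseteq> S" "card S = 2 * card R"
  shows "S \<subseteq> normalizer_of R"
proof
  interpret R: subgroup R G by fact
  interpret S: subgroup S G by fact
  fix x assume x: "x \<in> S"
  then have xc: "x \<in> carrier G" using S.subset by blast
  have fR: "finite R" "finite S" using R S finite_subgroup by auto
  have "conjugate x R \<subseteq> R"
  proof (cases "x \<in> R")
    case True
    then show ?thesis using conjugate_by_member[OF R] by simp
  next
    case False
    let ?xR = "(\<lambda>r. x \<otimes> r) ` R"
    have dis: "R \<inter> ?xR = {}"
    proof (rule ccontr)
      assume "R \<inter> ?xR \<noteq> {}"
      then obtain r where r: "r \<in> R" "x \<otimes> r \<in> R" by blast
      have "x = (x \<otimes> r) \<otimes> inv r" using r xc R.subset by (simp add: m_assoc subset_eq)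
      moreover have "(x \<otimes> r) \<otimes> inv r \<in> R" by (rule R.m_closed[OF r(2) R.m_inv_closed[OF r(1)]])
      ultimately show False using False by simp
    qed
    have "inj_on (\<lambda>r. x \<otimes> r) R" using xc R.subset by (intro inj_onI) (auto simp: subset_eq)
    then have "card (R \<union> ?xR) = card S" using dis fR RS(2) by (simp add: card_Un_disjoint card_image)
    moreover have "R \<union> ?xR \<subseteq> S" using RS(1) x by auto
    ultimately have eq: "R \<union> ?xR = S" using fR by (simp add: card_subset_eq)
    show ?thesis
    proof
      fix y assume "y \<in> conjugate x R"
      then obtain r where r: "r \<in> R" "y = x \<otimes> r \<otimes> inv x" unfolding conjugate_def by blast
      have "r \<in> S" using r(1) RS(1) by blast
      then have "y \<in> S" unfolding r(2) using x by (intro S.m_closed S.m_inv_closed)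
      then have yS: "y \<in> R \<union> ?xR" unfolding eq .
      have "y \<notin> ?xR"
      proof
        assume "y \<in> ?xR"
        then obtain r' where r': "r' \<in> R" "y = x \<otimes> r'" by (elim imageE)
        have rc: "r \<in> carrier G" "r' \<in> carrier G" using r r' R.subset by auto
        have "r \<otimes> inv x = r'" using r'(2) r(2) rc xc by (simp add: m_assoc)
        then have "inv x = inv r \<otimes> r'" using rc xc inv_solve_left[of "inv x" r r'] by simp
        then have "inv x \<in> R" using R.m_closed[OF R.m_inv_closed[OF r(1)] r'(1)] by simp
        then have "inv (inv x) \<in> R" by (rule R.m_inv_closed)
        then show False using False xc by simp
      qed
      then show "y \<in> R" using yS by blast
    qed
  qed
  then have "conjugate x R = R" using fR xc R.subset by (intro card_subset_eq) (auto simp: card_conjugate)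
  then show "x \<in> normalizer_of R" using xc by (simp add: normalizer_of_def)
qed

text \<open>The orbits of \<open>P\<close> on \<open>H\<close> have length 1 or \<open>p\<close>, and there is no room for
\<open>p\<close> elements.\<close>

lemma small_subgroup_centralized:
  assumes P: "subgroup P G" "card P = p" "prime p" and H: "subgroup H G" "card H < p" and PN: "P \<subseteq> normalizer_of H"
  shows "H \<subseteq> centralizer_of P"
proof
  interpret P: subgroup P G by fact
  fix h assume h: "h \<in> H"
  let ?f = "\<lambda>g x. g \<otimes> x \<otimes> inv g"
  have hc: "h \<in> carrier G" using h H(1) subgroup.mem_carrier by metis
  let ?O = "(\<lambda>g. ?f g h) ` P"
  have "?O \<subseteq> H"
  proof
    fix y assume "y \<in> ?O"
    then obtain g where g: "g \<in> P" "y = ?f g h" by blast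
    then have "conjugate g H = H" using PN by (auto simp: normalizer_of_def)
    then show "y \<in> H" using g h unfolding conjugate_def by blast
  qed
  then have le: "card ?O < p" using card_mono[OF finite_subgroup[OF H(1)]] H(2) le_less_trans by blast
  have "card ?O dvd p"
    using orbit_stabilizer[OF acts_conjugation[OF P(1)] hc] P(2) by (metis dvd_triv_left)
  then have "card ?O = 1" using le P(3) by (auto simp: prime_nat_iff)
  then obtain y where y: "?O = {y}" using card_1_singletonE by blast
  have "?f \<one> h \<in> ?O" using P.one_closed by blast
  then have "h \<in> ?O" using hc by simp
  then have O: "?O = {h}" using y by simp
  have "h \<otimes> u \<otimes> inv h = u" if u: "u \<in> P" for u
  proof -
    have uc: "u \<in> carrier G" using u P.subset by blast
    have "?f u h \<in> ?O" using u by blast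
    then have "?f u h = h" using O by blast
    then show ?thesis using conjugation_fixes_iff_commute[OF uc hc] conjugation_fixes_iff_commute[OF hc uc] by simp
  qed
  then show "h \<in> centralizer_of P" using hc by (simp add: centralizer_of_def)
qed

lemma card_product_with_normalizer:
  assumes H: "subgroup H G" and R: "subgroup R G" and N: "R \<subseteq> normalizer_of H" and cop: "coprime (card H) (card R)"
  shows "\<exists>K. subgroup K G \<and> card K = card H * card R"
proof -
  have sN: "subgroup (normalizer_of H) G" by (rule subgroup_normalizer[OF H])
  interpret M: finite_group "G\<lparr>carrier := normalizer_of H\<rparr>" by (rule finite_group_restrict[OF sN])
  have HM: "subgroup H (G\<lparr>carrier := normalizer_of H\<rparr>)" using subgroup_incl[OF H sN subset_normalizer[OF H]] .
  have RM: "subgroup R (G\<lparr>carrier := normalizer_of H\<rparr>)" using subgroup_incl[OF R sN N] .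
  have "H \<lhd> (G\<lparr>carrier := normalizer_of H\<rparr>)"
    unfolding M.normal_inv_iff
  proof (intro conjI ballI)
    fix x h assume xh: "x \<in> carrier (G\<lparr>carrier := normalizer_of H\<rparr>)" "h \<in> H"
    then have "conjugate x H = H" by (simp add: normalizer_of_def)
    then have "x \<otimes> h \<otimes> inv x \<in> H" using xh unfolding conjugate_def by blast
    then show "x \<otimes>\<^bsub>G\<lparr>carrier := normalizer_of H\<rparr>\<^esub> h \<otimes>\<^bsub>G\<lparr>carrier := normalizer_of H\<rparr>\<^esub> inv\<^bsub>G\<lparr>carrier := normalizer_of H\<rparr>\<^esub> x \<in> H"
      using xh m_inv_consistent[OF sN] by simp
  qed (rule HM)
  then have "subgroup (H <#>\<^bsub>G\<lparr>carrier := normalizer_of H\<rparr>\<^esub> R) (G\<lparr>carrier := normalizer_of H\<rparr>)"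
    using M.mult_norm_subgroup RM by blast
  then have K: "subgroup (H <#> R) G"
    using incl_subgroup[OF sN] by (simp add: set_mult_def)
  interpret K: finite_group "G\<lparr>carrier := H <#> R\<rparr>" by (rule finite_group_restrict[OF K])
  have sub: "H \<subseteq> H <#> R" "R \<subseteq> H <#> R"
    using subgroup.one_closed[OF H] subgroup.one_closed[OF R] subgroup.mem_carrier[OF H] subgroup.mem_carrier[OF R]
    unfolding set_mult_def by force+
  have "card H * card R = order (G\<lparr>carrier := H <#> R\<rparr>) * card (H \<inter> R)"
    by (rule K.comaximal_card[OF subgroup_incl[OF H K sub(1)] subgroup_incl[OF R K sub(2)]])
      (simp add: set_mult_def)
  moreover have "H \<inter> R = {\<one>}" by (rule coprime_subgroups_trivial_Int[OF H R cop])
  ultimately show ?thesis using K by (auto simp: order_def)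
qed

end

section \<open>Numbers of subgroups and of elements\<close>

context finite_group
begin

definition num_subgroups :: "nat \<Rightarrow> nat" where
  "num_subgroups n = card {H. subgroup H G \<and> card H = n}"

lemma finite_num_subgroups [simp]: "finite {H. subgroup H G \<and> card H = n}"
  by (rule finite_subset[OF _ finite_Subgroups]) (auto simp: Subgroups_def)

lemma card_sylows_eq_num_subgroups:
  assumes "prime p" "p ^ a dvd order G" "\<not> p ^ Suc a dvd order G"
  shows "card (sylows p) = num_subgroups (p ^ a)"
proof -
  have "multiplicity p (order G) = a" using assms by (intro multiplicity_eqI) auto
  then show ?thesis unfolding sylows_def num_subgroups_def by simp
qed

text \<open>For a prime \<open>p\<close> these are the elements of order \<open>p\<close>.\<close>

definition prime_elements :: "nat \<Rightarrow> 'a set" where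
  "prime_elements p = (\<Union>P\<in>{H. subgroup H G \<and> card H = p}. P - {\<one>})"

lemma card_prime_elements:
  assumes "prime p" shows "card (prime_elements p) = num_subgroups p * (p - 1)"
proof -
  have "card (prime_elements p) = (\<Sum>P\<in>{H. subgroup H G \<and> card H = p}. card (P - {\<one>}))"
    unfolding prime_elements_def
    by (rule card_UN_disjoint) (use prime_order_subgroups_trivial_Int[OF _ _ _ _ assms] finite_subgroup in auto)
  also have "\<dots> = (\<Sum>P\<in>{H. subgroup H G \<and> card H = p}. p - 1)"
    by (intro sum.cong refl) (auto simp: card_Diff_singleton subgroup.one_closed)
  finally show ?thesis by (simp add: num_subgroups_def)
qed

lemma prime_elements_subset: "prime_elements p \<subseteq> carrier G - {\<one>}"
  unfolding prime_elements_def using subgroup.subset by blast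

lemma prime_elements_disjoint_subgroup:
  assumes "subgroup H G" "coprime p (card H)" shows "prime_elements p \<inter> H = {}"
  unfolding prime_elements_def using coprime_subgroups_trivial_Int[OF _ assms(1)] assms(2) by blast

lemma prime_elements_disjoint:
  assumes "prime p" "prime q" "p \<noteq> q" shows "prime_elements p \<inter> prime_elements q = {}"
  using prime_elements_disjoint_subgroup[of _ p] primes_coprime[OF assms] unfolding prime_elements_def[of q] by blast

end

section \<open>Finite nonabelian simple groups\<close>

text \<open>Finite simple groups of prime power order are cyclic, because a nontrivial group of prime power order
has a nontrivial centre.  The condition on the order is the form in which being nonabelian is used.\<close>

locale nonabelian_simple = finite_group +
  assumes simple: "\<And>N. N \<lhd> G \<Longrightarrow> N = {\<one>} \<or> N = carrier G"
    and order_not_prime_power: "\<And>p a. prime (p::nat) \<Longrightarrow> order G \<noteq> p ^ a"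
begin

lemma order_gt_2: "order G > 2"
proof -
  have "order G \<noteq> 2 ^ 0" "order G \<noteq> 2 ^ 1" using order_not_prime_power two_is_prime_nat by blast+
  then show ?thesis using order_pos by auto
qed

lemma faithful:
  assumes act: "acts (carrier G) E f" and moved: "g \<in> carrier G" "x \<in> E" "f g x \<noteq> x"
  shows "{g\<in>carrier G. \<forall>x\<in>E. f g x = x} = {\<one>}"
  using simple[OF kernel_of_action_normal[OF act]] moved by blast

text \<open>The action is faithful.  Composing it with the sign gives a homomorphism to a group of two elements,
whose kernel cannot be trivial; so the image consists of even permutations.  The factor 2 gained in
this way decides several of the cases below.\<close>

lemma order_dvd_fact:
  assumes act: "acts (carrier G) E f" and moved: "g \<in> carrier G" "x \<in> E" "f g x \<noteq> x"
  shows "2 * order G dvd fact (card E)"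
proof -
  define n where "n = card E"
  interpret S: finite_group "sym_group n" by (rule finite_group_sym)
  obtain \<phi> where \<phi>: "\<phi> \<in> hom (G\<lparr>carrier := carrier G\<rparr>) (sym_group n)"
    "\<forall>k\<in>carrier G. \<phi> k = id \<longleftrightarrow> (\<forall>x\<in>E. f k x = x)"
    using permutation_representation[OF act n_def[symmetric]] .
  have hom: "\<phi> \<in> hom G (sym_group n)" using \<phi>(1) by simp
  note im = card_permutation_image[OF subgroup_self \<phi>(1)]
  have "{k\<in>carrier G. \<phi> k = id} = {k\<in>carrier G. \<forall>x\<in>E. f k x = x}"
    using \<phi>(2) by (intro Collect_cong) (simp cong: conj_cong)
  then have "{k\<in>carrier G. \<phi> k = id} = {\<one>}" using faithful[OF assms] by simp
  then have card_im: "card (\<phi> ` carrier G) = order G" using im(2) by (simp add: order_def)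
  have n2: "n \<ge> 2"
  proof -
    have "{x, f g x} \<subseteq> E" using actsD(4)[OF act] moved by simp
    then have "card {x, f g x} \<le> n" unfolding n_def using actsD(2)[OF act] by (intro card_mono)
    then show ?thesis using moved(3) by simp
  qed
  interpret sg: group_hom G sign_img "sign \<circ> \<phi>"
    using hom sign_is_hom[of n] sign_img_is_group is_group
    by (intro group_hom.intro group_hom_axioms.intro) (auto simp: hom_def Pi_iff)
  have "kernel G sign_img (sign \<circ> \<phi>) = carrier G"
  proof (rule ccontr)
    assume "kernel G sign_img (sign \<circ> \<phi>) \<noteq> carrier G"
    then have k: "kernel G sign_img (sign \<circ> \<phi>) = {\<one>}" using simple[OF sg.normal_kernel] by blast
    then have "inj_on (sign \<circ> \<phi>) (carrier G)" using sg.inj_iff_trivial_ker by blast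
    then have "card (carrier G) \<le> card (carrier sign_img)"
      by (rule card_inj_on_le) (use sg.hom_closed in \<open>auto simp: sign_img_def\<close>)
    then show False using order_gt_2 by (simp add: order_def sign_img_def)
  qed
  then have "\<phi> ` carrier G \<subseteq> carrier (alt_group n)"
    using hom unfolding alt_group_is_sign_kernel kernel_def by (auto simp: hom_def)
  then have "card (\<phi> ` carrier G) dvd card (carrier (alt_group n))"
    using S.card_subgroup_dvd[OF im(1) alt_group_is_subgroup] by blast
  then have "2 * order G dvd 2 * card (carrier (alt_group n))" using card_im by simp
  then have "2 * order G dvd fact n" unfolding alt_group_card_carrier[OF n2] .
  then show ?thesis unfolding n_def .
qed

lemma conjugation_moves:
  assumes "subgroup H G" "H \<noteq> {\<one>}" "H \<noteq> carrier G"
  shows "\<exists>g\<in>carrier G. conjugate g H \<noteq> H"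
proof (rule ccontr)
  assume "\<not> ?thesis"
  then have "normalizer_of H = carrier G" unfolding normalizer_of_def by blast
  then show False using simple[OF normal_if_normalizer_is_carrier[OF assms(1)]] assms by blast
qed

lemma acts_conjugates:
  assumes "subgroup H G" shows "acts (carrier G) (conjugates H) conjugate"
proof (rule acts_subset[OF acts_conjugate[OF subgroup_self]])
  show "conjugates H \<subseteq> Subgroups" using conjugates_props(1)[OF assms] unfolding Subgroups_def by blast
  fix g K assume gK: "g \<in> carrier G" "K \<in> conjugates H"
  then obtain h where "h \<in> carrier G" "K = conjugate h H" unfolding conjugates_def by blast
  then have "conjugate g K = conjugate (g \<otimes> h) H" "g \<otimes> h \<in> carrier G"
    using gK subgroup.subset[OF assms] by (simp_all add: conjugate_mult)
  then show "conjugate g K \<in> conjugates H" unfolding conjugates_def by blast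
qed

lemma self_in_conjugates: "subgroup H G \<Longrightarrow> H \<in> conjugates H"
  unfolding conjugates_def using conjugate_one[OF subgroup.subset] by (metis image_eqI one_closed)

lemma order_dvd_fact_conjugates:
  assumes "subgroup H G" "H \<noteq> {\<one>}" "H \<noteq> carrier G"
  shows "2 * order G dvd fact (card (conjugates H))"
proof -
  obtain g where "g \<in> carrier G" "conjugate g H \<noteq> H" using conjugation_moves[OF assms] by blast
  then show ?thesis
    using order_dvd_fact[OF acts_conjugates[OF assms(1)] _ self_in_conjugates[OF assms(1)]] by blast
qed

lemma sylow_nontrivial:
  assumes "prime p" "p dvd order G" "P \<in> sylows p"
  shows "subgroup P G" "P \<noteq> {\<one>}" "P \<noteq> carrier G"
proof -
  show P: "subgroup P G" using assms by (simp add: sylows_def)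
  have c: "card P = p ^ multiplicity p (order G)" using assms by (simp add: sylows_def)
  have "multiplicity p (order G) > 0"
    using assms order_pos by (simp add: prime_multiplicity_gt_zero_iff)
  then have "card P \<noteq> 1" using c prime_gt_1_nat[OF assms(1)] by simp
  then show "P \<noteq> {\<one>}" by auto
  show "P \<noteq> carrier G" using c order_not_prime_power[OF assms(1)] by (auto simp: order_def)
qed

text \<open>In particular a Sylow number is never 1, since \<open>fact 1\<close> is too small.\<close>

lemma order_dvd_fact_sylows:
  assumes "prime p" "p dvd order G"
  shows "2 * order G dvd fact (card (sylows p))"
proof -
  obtain P where P: "P \<in> sylows p" using sylows_nonempty[OF assms(1)] by blast
  show ?thesis using order_dvd_fact_conjugates[OF sylow_nontrivial[OF assms P]] sylows_eq_conjugates[OF assms(1) P] by simp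
qed

lemma normalizes_all_sylows_imp_one:
  assumes "prime p" "p dvd order G" "g \<in> carrier G" "\<And>Q. Q \<in> sylows p \<Longrightarrow> conjugate g Q = Q"
  shows "g = \<one>"
proof -
  obtain P where P: "P \<in> sylows p" using sylows_nonempty[OF assms(1)] by blast
  obtain h where h: "h \<in> carrier G" "conjugate h P \<noteq> P"
    using conjugation_moves[OF sylow_nontrivial[OF assms(1,2) P]] by blast
  show ?thesis using faithful[OF acts_sylows[OF assms(1) subgroup_self] h(1) P h(2)] assms(3,4) by blast
qed

lemma multiplicity_eq_1:
  assumes "prime p" "p dvd order G" "\<not> p\<^sup>2 dvd order G"
  shows "multiplicity p (order G) = 1"
  using assms order_pos by (intro multiplicity_eqI) (auto simp: numeral_2_eq_2)

text \<open>\<open>P\<close> has \<open>j\<close> orbits, each of length \<open>p\<close>, on the other Sylow subgroups, and its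
centralizer permutes these orbits.  It has to be shown that the order of the kernel \<open>K\<close> of this
permutation action divides \<open>p\<close>.  Let \<open>r\<close> in \<open>K\<close> have prime order \<open>q\<close>
different from \<open>p\<close>.  For each \<open>Q\<close> there is \<open>z\<close> in \<open>P\<close> with the same
effect on \<open>Q\<close> as \<open>r\<close>; since \<open>r\<close> and \<open>z\<close> commute, the same holds for
their \<open>q\<close>-th powers.  So \<open>z\<^sup>q\<close> fixes \<open>Q\<close>, which makes it trivial, and hence
\<open>z\<close> is trivial.  Thus \<open>r\<close> normalizes all Sylow subgroups, which is impossible.\<close>

lemma card_centralizer_dvd:
  assumes p: "prime p" "p dvd order G" "\<not> p\<^sup>2 dvd order G" and PS: "P \<in> sylows p"
    and j: "card (sylows p) = 1 + p * j"
  shows "card (centralizer_of P) dvd p * fact j"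
proof -
  have P: "subgroup P G" "card P = p" using PS multiplicity_eq_1[OF p] by (auto simp: sylows_def)
  interpret P: subgroup P G by (rule P)
  have C: "subgroup (centralizer_of P) G" by (rule subgroup_centralizer[OF P.subset])
  interpret C: subgroup "centralizer_of P" G by (rule C)
  define X where "X = sylows p - {P}"
  define orb where "orb Q = (\<lambda>u. conjugate u Q) ` P" for Q
  have XD: "subgroup Q G" "Q \<in> sylows p" "Q \<noteq> P" "Q \<subseteq> carrier G" if "Q \<in> X" for Q
    using that subgroup.subset by (auto simp: X_def sylows_def)
  have conjX: "conjugate c Q \<in> X" if "c \<in> normalizer_of P" "Q \<in> X" for c Q
  proof -
    have cc: "c \<in> carrier G" "conjugate c P = P" using that(1) by (auto simp: normalizer_of_def)
    have "conjugate c Q \<in> sylows p" using actsD(4)[OF acts_sylows[OF p(1) subgroup_self]] cc XD(2)[OF that(2)] by blast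
    moreover have "conjugate c Q \<noteq> P"
    proof
      assume "conjugate c Q = P"
      then have "conjugate (inv c) (conjugate c Q) = conjugate (inv c) (conjugate c P)" using cc by simp
      then show False
        using acts_inv(1)[OF acts_sylows[OF p(1) subgroup_self] cc(1)] XD(2,3)[OF that(2)] PS by simp
    qed
    ultimately show ?thesis by (simp add: X_def)
  qed
  have PN: "P \<subseteq> normalizer_of P" by (rule subset_normalizer[OF P(1)])
  have finX: "finite X" "card X = p * j"
    using actsD(2)[OF acts_sylows[OF p(1) subgroup_self]] j PS by (auto simp: X_def)
  have actP: "acts P X conjugate"
    by (rule acts_subset[OF acts_sylows[OF p(1) P(1)]]) (use conjX PN in \<open>auto simp: X_def\<close>)
  have stab: "{u\<in>P. conjugate u Q = Q} = {\<one>}" if Q: "Q \<in> X" for Q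
  proof -
    let ?S = "{u\<in>P. \<forall>x\<in>{Q}. conjugate u x = x}"
    have S: "subgroup ?S G" by (rule stabilizer_is_subgroup[OF actP]) (use Q in simp)
    have "?S \<noteq> P"
    proof
      assume "?S = P"
      then have "P \<subseteq> normalizer_of Q" unfolding normalizer_of_def using P.subset by blast
      then have "P \<subseteq> Q"
        using sylow_unique_in_normalizer[OF p(1) XD(2)[OF Q] P(1), of 1] P(2) by simp
      then show False using sylow_eqI[OF PS XD(2)[OF Q]] XD(3)[OF Q] by blast
    qed
    then have "card ?S \<noteq> p" using card_subset_eq[OF finite_subgroup[OF P(1)], of ?S] P(2) by auto
    moreover have "card ?S dvd p" using card_subgroup_dvd[OF S P(1)] P(2) by auto
    ultimately have "card ?S = 1" using p(1) by (auto simp: prime_nat_iff)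
    then obtain s where "?S = {s}" using card_1_singletonE by blast
    then have "?S = {\<one>}" using subgroup.one_closed[OF S] by auto
    then show ?thesis by simp
  qed
  have card_orb: "card (orb Q) = p" if "Q \<in> X" for Q
    using orbit_stabilizer[OF actP that] stab[OF that] P(2) by (simp add: orb_def)
  have self_orb: "Q \<in> orb Q" if "Q \<in> X" for Q
    unfolding orb_def by (rule image_eqI[of _ _ "\<one>"]) (simp_all add: conjugate_one[OF XD(4)[OF that]])
  have "p * card (orb ` X) = card (\<Union>(orb ` X))"
  proof (rule card_partition)
    show "finite (\<Union>(orb ` X))" using finX by (auto simp: orb_def finite_subgroup[OF P(1)])
    show "c1 \<inter> c2 = {}" if c12: "c1 \<in> orb ` X" "c2 \<in> orb ` X" "c1 \<noteq> c2" for c1 c2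
    proof -
      obtain Q1 Q2 where "Q1 \<in> X" "Q2 \<in> X" "c1 = orb Q1" "c2 = orb Q2" using c12 by blast
      then show ?thesis using orbits_disjoint_or_equal[OF actP, of Q1 Q2, folded orb_def] c12(3) by blast
    qed
  qed (use finX card_orb in auto)
  moreover have "orb Q \<subseteq> X" if "Q \<in> X" for Q
    unfolding orb_def using conjX that PN by (intro image_subsetI) blast
  then have "\<Union>(orb ` X) = X" using self_orb by blast
  ultimately have cardO: "card (orb ` X) = j" using finX prime_gt_0_nat[OF p(1)] by simp
  have F_orb: "conjugate c ` orb Q = orb (conjugate c Q)" if c: "c \<in> centralizer_of P" and Q: "Q \<in> X" for c Q
    unfolding orb_def image_image
  proof (rule image_cong[OF refl])
    fix u assume u: "u \<in> P"
    have cu: "c \<in> carrier G" "u \<in> carrier G" using c u P.subset C.subset by blast+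
    have "c \<otimes> u \<otimes> inv c = u" using c u unfolding centralizer_of_def by blast
    then have "c \<otimes> u = u \<otimes> c" using conjugation_fixes_iff_commute[OF cu] by blast
    then show "conjugate c (conjugate u Q) = conjugate u (conjugate c Q)"
      using conjugate_mult[OF cu XD(4)[OF Q]] conjugate_mult[OF cu(2,1) XD(4)[OF Q]] by simp
  qed
  have CN: "centralizer_of P \<subseteq> normalizer_of P" by (rule centralizer_subset_normalizer)
  have actC: "acts (centralizer_of P) (orb ` X) (\<lambda>c o'. conjugate c ` o')"
  proof (rule actsI[OF C])
    show "conjugate \<one> ` o' = o'" if "o' \<in> orb ` X" for o'
    proof -
      obtain Q where Q: "Q \<in> X" "o' = orb Q" using \<open>o' \<in> orb ` X\<close> by blast
      show ?thesis using F_orb[OF C.one_closed Q(1)] conjugate_one[OF XD(4)[OF Q(1)]] Q(2) by simp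
    qed
    show "conjugate c ` o' \<in> orb ` X" if "c \<in> centralizer_of P" "o' \<in> orb ` X" for c o'
      using that F_orb conjX CN by auto
    show "conjugate (c \<otimes> d) ` o' = conjugate c ` conjugate d ` o'"
      if cd: "c \<in> centralizer_of P" "d \<in> centralizer_of P" and o': "o' \<in> orb ` X" for c d o'
    proof -
      obtain Q where Q: "Q \<in> X" "o' = orb Q" using o' by blast
      have "conjugate d Q \<in> X" using conjX CN cd Q by blast
      then show ?thesis
        using F_orb cd Q C.m_closed[OF cd] conjugate_mult[of c d Q] XD(4)[OF Q(1)] C.subset
        by (simp add: subset_eq)
    qed
  qed (use finX in simp)
  let ?K = "{c\<in>centralizer_of P. \<forall>o'\<in>orb ` X. conjugate c ` o' = o'}"
  have K: "subgroup ?K G" by (rule stabilizer_is_subgroup[OF actC]) simp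
  have only_p: "q = p" if q: "prime q" "q dvd card ?K" for q
  proof (rule ccontr)
    assume "q \<noteq> p"
    then have cop: "coprime q p" using q p(1) primes_coprime by blast
    obtain R where R: "subgroup R G" "R \<subseteq> ?K" "card R = q" using Cauchy_in_subgroup[OF K q] by blast
    obtain r where r: "r \<in> R" "r \<noteq> \<one>"
      using subgroup_nontrivial_element[OF R(1)] R(3) prime_gt_1_nat[OF q(1)] by auto
    have rc: "r \<in> carrier G" "r \<in> centralizer_of P" using r R(2) C.subset by auto
    have rq: "r [^] q = \<one>" using pow_card_subgroup[OF R(1) r(1)] R(3) by simp
    have "conjugate r Q = Q" if Q: "Q \<in> X" for Q
    proof -
      have "conjugate r ` orb Q = orb Q" using r R(2) Q by blast
      then have "conjugate r Q \<in> orb Q" using self_orb[OF Q] by blast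
      then obtain z where z: "z \<in> P" "conjugate r Q = conjugate z Q" unfolding orb_def by blast
      have zc: "z \<in> carrier G" using z P.subset by blast
      have "r \<otimes> z \<otimes> inv r = z" using rc(2) z(1) unfolding centralizer_of_def by blast
      then have rz: "r \<otimes> z = z \<otimes> r" using conjugation_fixes_iff_commute[OF rc(1) zc] by blast
      have "conjugate (r [^] n) Q = conjugate (z [^] n) Q" for n :: nat
      proof (induction n)
        case 0 show ?case by simp
      next
        case (Suc n)
        have comm: "r [^] n \<otimes> z = z \<otimes> r [^] n" by (rule group_commutes_pow[OF rz rc(1) zc])
        have "conjugate (r [^] Suc n) Q = conjugate (r [^] n) (conjugate z Q)"
          using z(2) rc XD(4)[OF Q] by (simp add: conjugate_mult)
        also have "\<dots> = conjugate z (conjugate (r [^] n) Q)"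
          using comm rc zc XD(4)[OF Q] by (simp flip: conjugate_mult)
        also have "\<dots> = conjugate z (conjugate (z [^] n) Q)" using Suc by simp
        also have "\<dots> = conjugate (z [^] Suc n) Q"
          using zc XD(4)[OF Q] nat_pow_Suc2[OF zc, of n] by (simp flip: conjugate_mult)
        finally show ?case .
      qed
      from this[of q] have "conjugate (z [^] q) Q = Q" using rq conjugate_one[OF XD(4)[OF Q]] by simp
      moreover have "z [^] q \<in> P" by (induction q) (simp_all add: z(1))
      ultimately have "z [^] q = \<one>" using stab[OF Q] by blast
      moreover have "z [^] p = \<one>" using pow_card_subgroup[OF P(1) z(1)] P(2) by simp
      ultimately have "z = \<one>" using eq_one_if_coprime_powers[OF zc _ _ cop] by blast
      then show ?thesis using z(2) conjugate_one[OF XD(4)[OF Q]] by simp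
    qed
    moreover have "conjugate r P = P" using rc CN by (auto simp: normalizer_of_def)
    ultimately have "conjugate r Q = Q" if "Q \<in> sylows p" for Q using that by (cases "Q = P") (auto simp: X_def)
    then show False using normalizes_all_sylows_imp_one[OF p(1,2) rc(1)] r(2) by blast
  qed
  have "card ?K dvd p"
  proof -
    have "card ?K \<noteq> 0" using subgroup.one_closed[OF K] finite_subgroup[OF K] card_0_eq by blast
    moreover have "\<not> p\<^sup>2 dvd card ?K" using card_dvd_order[OF K] p(3) dvd_trans by blast
    ultimately show ?thesis using only_p by (intro dvd_prime_if_only_prime_divisor)
  qed
  moreover have "card (centralizer_of P) dvd card ?K * fact j" using card_dvd_kernel_mult_fact[OF actC cardO] .
  ultimately show ?thesis by (meson dvd_refl dvd_trans mult_dvd_mono)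
qed

lemma order_dvd_of_card_sylows:
  assumes p: "prime p" "p dvd order G" "\<not> p\<^sup>2 dvd order G" and j: "card (sylows p) = 1 + p * j"
  shows "order G dvd (1 + p * j) * (p * fact j * (p - 1))"
proof -
  obtain P where PS: "P \<in> sylows p" using sylows_nonempty[OF p(1)] by blast
  then have P: "subgroup P G" "card P = p" using multiplicity_eq_1[OF p] by (auto simp: sylows_def)
  have "card (normalizer_of P) dvd p * fact j * (p - 1)"
    using card_normalizer_dvd[OF P p(1)] card_centralizer_dvd[OF p PS j] by (meson dvd_refl dvd_trans mult_dvd_mono)
  then show ?thesis using card_sylows[OF p(1) PS] j by (metis dvd_refl mult_dvd_mono)
qed

text \<open>A subgroup with at most \<open>m\<close> conjugates would give \<open>2 |G|\<close> as a divisor of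
\<open>m!\<close>.\<close>

lemma num_subgroups_gt:
  assumes "subgroup H G" "card H = n" "1 < n" "n < order G" "\<not> 2 * order G dvd fact m"
  shows "m < num_subgroups n"
proof (rule ccontr)
  assume "\<not> m < num_subgroups n"
  moreover have "card (conjugates H) \<le> num_subgroups n"
    unfolding num_subgroups_def using conjugates_props[OF assms(1)] assms(2) by (intro card_mono) auto
  ultimately have "(fact (card (conjugates H)) :: nat) dvd fact m" by (intro fact_dvd) simp
  moreover have "2 * order G dvd fact (card (conjugates H))"
    by (rule order_dvd_fact_conjugates[OF assms(1)]) (use assms in \<open>auto simp: order_def\<close>)
  ultimately show False using assms(5) dvd_trans by blast
qed

text \<open>A divisor \<open>d\<close> of the order is enough for the estimate, so the order need not be known.\<close>

lemma num_subgroups_prime_power_gt: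
  assumes "prime p" "q = p ^ i" "0 < i" "q dvd order G" "d dvd order G" "\<not> 2 * d dvd fact m"
  shows "m < num_subgroups q"
proof -
  obtain H where H: "subgroup H G" "card H = q"
    using exists_subgroup_of_prime_power_order assms by blast
  have "1 < q" using one_less_power[OF prime_gt_1_nat[OF assms(1)] assms(3)] assms(2) by simp
  moreover have "q < order G"
    using dvd_imp_le[OF assms(4) order_pos] order_not_prime_power[OF assms(1), of i] assms(2) by auto
  moreover have "\<not> 2 * order G dvd fact m"
    using assms(5,6) by (meson dvd_refl dvd_trans mult_dvd_mono)
  ultimately show ?thesis using num_subgroups_gt[OF H] by blast
qed

lemma num_subgroups_sylow:
  assumes "prime p" "q = p ^ a" "0 < a" "q dvd order G" "\<not> q * p dvd order G"
  shows "num_subgroups q mod p = 1" "num_subgroups q * q dvd order G" "2 * order G dvd fact (num_subgroups q)" "2 < num_subgroups q"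
proof -
  have a: "p ^ a dvd order G" "\<not> p ^ Suc a dvd order G" using assms by (auto simp: mult.commute)
  have m: "multiplicity p (order G) = a" using assms(1) a by (intro multiplicity_eqI) auto
  have n: "card (sylows p) = num_subgroups q" using card_sylows_eq_num_subgroups[OF assms(1) a] assms(2) by simp
  show "num_subgroups q mod p = 1"
    using card_sylows_cong_1[OF assms(1)] prime_gt_1_nat[OF assms(1)] n by (simp add: cong_def)
  show "num_subgroups q * q dvd order G" using card_sylows_dvd[OF assms(1)] m n assms(2) by simp
  have pg: "p dvd order G" using assms(2-4) dvd_power[of a p] dvd_trans by blast
  show f: "2 * order G dvd fact (num_subgroups q)"
    using order_dvd_fact_sylows[OF assms(1) pg] n by simp
  show "2 < num_subgroups q"
  proof (rule ccontr)
    assume "\<not> 2 < num_subgroups q"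
    then have "(fact (num_subgroups q) :: nat) dvd fact 2" by (intro fact_dvd) simp
    then have "2 * order G dvd 2" using f dvd_trans by (fastforce simp: fact_numeral)
    then show False using order_gt_2 by (auto dest!: dvd_imp_le)
  qed
qed

lemma order_dvd_num_subgroups_prime:
  assumes "prime p" "p dvd order G" "\<not> p * p dvd order G" "num_subgroups p = 1 + p * j"
  shows "order G dvd (1 + p * j) * (p * fact j * (p - 1))"
  using order_dvd_of_card_sylows[OF assms(1,2)] card_sylows_eq_num_subgroups[OF assms(1), of 1] assms
  by (simp add: power2_eq_square)

text \<open>A Sylow subgroup can be recovered from its normalizer, so distinct Sylow subgroups have distinct
normalizers.\<close>

lemma num_subgroups_normalizers_ge:
  assumes "prime p" "q = p ^ a" "0 < a" "q dvd order G" "\<not> q * p dvd order G" "num_subgroups q * c = order G"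
  shows "num_subgroups q \<le> num_subgroups c"
proof -
  have a: "p ^ a dvd order G" "\<not> p ^ Suc a dvd order G" using assms by (auto simp: mult.commute)
  have n: "card (sylows p) = num_subgroups q" using card_sylows_eq_num_subgroups[OF assms(1) a] assms(2) by simp
  have S: "subgroup P G" "card P = p ^ multiplicity p (order G)" if "P \<in> sylows p" for P
    using that by (auto simp: sylows_def)
  have "inj_on normalizer_of (sylows p)"
  proof (rule inj_onI)
    fix P Q assume PQ: "P \<in> sylows p" "Q \<in> sylows p" "normalizer_of P = normalizer_of Q"
    then have "P \<subseteq> normalizer_of Q" using subset_normalizer[OF S(1)[OF PQ(1)]] by simp
    then have "P \<subseteq> Q" using sylow_unique_in_normalizer[OF assms(1) PQ(2) S[OF PQ(1)]] by blast
    then show "P = Q" using sylow_eqI PQ by blast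
  qed
  then have "card (normalizer_of ` sylows p) = num_subgroups q" using n by (simp add: card_image)
  moreover have "normalizer_of ` sylows p \<subseteq> {H. subgroup H G \<and> card H = c}"
  proof
    fix N assume "N \<in> normalizer_of ` sylows p"
    then obtain P where P: "P \<in> sylows p" "N = normalizer_of P" by blast
    have "num_subgroups q * card N = num_subgroups q * c" using card_sylows[OF assms(1) P(1)] n P(2) assms(6) by simp
    moreover have "num_subgroups q > 0" using num_subgroups_sylow(4)[OF assms(1-5)] by simp
    ultimately show "N \<in> {H. subgroup H G \<and> card H = c}" using subgroup_normalizer[OF S(1)[OF P(1)]] P(2) by simp
  qed
  ultimately show ?thesis unfolding num_subgroups_def[of c] by (metis card_mono finite_num_subgroups)
qed

text \<open>The Sylow number divides the cofactor \<open>m\<close>.\<close>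

lemma order_dvd_fact_cofactor:
  assumes "prime p" "order G = p ^ a * m" "0 < a" "\<not> p dvd m"
  shows "2 * order G dvd fact m"
proof -
  have m0: "m \<noteq> 0" using assms(2) order_pos by auto
  have "\<not> p ^ a * p dvd order G" using assms m0 by (auto simp: prime_gt_0_nat)
  note n = num_subgroups_sylow[OF assms(1) refl assms(3) _ this]
  have "num_subgroups (p ^ a) dvd m" using n(2) assms(1,2) by (auto simp: mult.commute prime_gt_0_nat)
  then have "(fact (num_subgroups (p ^ a)) :: nat) dvd fact m" using m0 by (intro fact_dvd dvd_imp_le) auto
  then show ?thesis using n(3) assms(2) dvd_trans by auto
qed

lemma card_disjoint_le:
  assumes "A \<subseteq> carrier G - {\<one>}" "B \<subseteq> carrier G - {\<one>}" "A \<inter> B = {}"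
  shows "card A + card B < order G"
proof -
  have f: "finite A" "finite B" using assms(1,2) fin finite_subset by blast+
  have "card A + card B = card (A \<union> B)" using f assms(3) by (simp add: card_Un_disjoint)
  also have "\<dots> \<le> card (carrier G - {\<one>})" using assms by (intro card_mono) auto
  also have "\<dots> < order G" using order_pos by (simp add: order_def)
  finally show ?thesis .
qed

text \<open>A Sylow number \<open>p + 1\<close> makes each Sylow \<open>p\<close>-subgroup its own centralizer.  An element of
order \<open>p\<close> that normalizes the smaller subgroup \<open>H\<close> would centralize it.\<close>

lemma prime_dvd_card_conjugates:
  assumes p: "prime p" "p dvd order G" "\<not> p * p dvd order G" "num_subgroups p = p + 1"
    and H: "subgroup H G" "1 < card H" "card H < p"
  shows "\<not> p dvd card (normalizer_of H)" "p dvd card (conjugates H)"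
proof -
  show n: "\<not> p dvd card (normalizer_of H)"
  proof
    assume "p dvd card (normalizer_of H)"
    then obtain R where R: "subgroup R G" "R \<subseteq> normalizer_of H" "card R = p"
      using Cauchy_in_subgroup[OF subgroup_normalizer[OF H(1)] p(1)] by blast
    have p2: "\<not> p\<^sup>2 dvd order G" using p(3) by (simp add: power2_eq_square)
    have RS: "R \<in> sylows p" using R multiplicity_eq_1[OF p(1,2) p2] by (simp add: sylows_def)
    have "card (sylows p) = 1 + p * 1"
      using card_sylows_eq_num_subgroups[OF p(1), of 1] p by simp
    from card_centralizer_dvd[OF p(1,2) p2 RS this] have "card (centralizer_of R) dvd p" by simp
    moreover have "card H dvd card (centralizer_of R)"
      by (rule card_subgroup_dvd[OF H(1) subgroup_centralizer[OF subgroup.subset[OF R(1)]]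
          small_subgroup_centralized[OF R(1,3) p(1) H(1,3) R(2)]])
    ultimately have "card H dvd p" using dvd_trans by blast
    then show False using H p(1) by (auto simp: prime_nat_iff)
  qed
  have "p dvd card (conjugates H) * card (normalizer_of H)" using card_conjugates[OF H(1)] p(2) by simp
  then show "p dvd card (conjugates H)" using n p(1) prime_dvd_mult_iff by blast
qed

end

section \<open>Independent families of subgroups\<close>

text \<open>The independence bound is stated for families of subgroups instead of the graph, which makes it
easy to transport from a group to its sections.\<close>

locale few_independent = nonabelian_simple +
  assumes independent_bound:
    "\<And>\<S>. \<lbrakk>\<And>H. H \<in> \<S> \<Longrightarrow> subgroup H G \<and> H \<noteq> {\<one>} \<and> H \<noteq> carrier G;
      \<And>H K. H \<in> \<S> \<Longrightarrow> K \<in> \<S> \<Longrightarrow> H \<noteq> K \<Longrightarrow> H <#> K \<noteq> carrier G\<rbrakk> \<Longrightarrow> card \<S> \<le> 51"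
begin

lemma sum_num_subgroups_le:
  assumes "finite S" "1 \<notin> S" "order G \<notin> S"
    and "\<And>H K. subgroup H G \<Longrightarrow> subgroup K G \<Longrightarrow> card H \<in> S \<Longrightarrow> card K \<in> S \<Longrightarrow> H <#> K \<noteq> carrier G"
  shows "(\<Sum>n\<in>S. num_subgroups n) \<le> 51"
proof -
  let ?\<S> = "\<Union>n\<in>S. {H. subgroup H G \<and> card H = n}"
  have "card ?\<S> = (\<Sum>n\<in>S. num_subgroups n)"
    unfolding num_subgroups_def by (rule card_UN_disjoint) (use assms(1) in auto)
  moreover have "card ?\<S> \<le> 51"
    by (rule independent_bound) (use assms(2-4) in \<open>auto simp: order_def\<close>)
  ultimately show ?thesis by simp
qed

lemma sum_list_num_subgroups_le:
  assumes "distinct ns" "1 \<notin> set ns" "d dvd order G" "\<forall>a\<in>set ns. \<forall>b\<in>set ns. \<not> d dvd a * b"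
  shows "sum_list (map num_subgroups ns) \<le> 51"
proof -
  have no: "\<not> order G dvd a * b" if "a \<in> set ns" "b \<in> set ns" for a b
    using assms(3,4) that dvd_trans by blast
  have "(\<Sum>n\<in>set ns. num_subgroups n) \<le> 51"
  proof (rule sum_num_subgroups_le)
    show "order G \<notin> set ns" using no[of "order G" "order G"] by auto
    fix H K assume HK: "subgroup H G" "subgroup K G" "card H \<in> set ns" "card K \<in> set ns"
    show "H <#> K \<noteq> carrier G"
      using comaximal_card[OF HK(1,2)] no[OF HK(3,4)] by (metis dvd_triv_left)
  qed (use assms in auto)
  then show ?thesis using assms(1) by (simp add: sum_list_distinct_conv_sum_set)
qed

text \<open>The Sylow number \<open>n\<close> is divisible by two distinct primes \<open>q\<close>, \<open>r\<close> or by the cube of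
a prime \<open>q\<close>; accordingly \<open>a\<close>, \<open>b\<close> are \<open>q\<close>, \<open>r\<close> or
\<open>q\<close>, \<open>q\<^sup>2\<close>.  In the second case the cube in the order is what prevents products of
two members from being divisible by the order.\<close>

lemma two_further_prime_powers:
  assumes p: "prime p" "5 \<le> p" "p dvd order G" and largest: "\<And>q. prime q \<Longrightarrow> q dvd order G \<Longrightarrow> q \<le> p"
  obtains a b where "distinct [p, p\<^sup>2, a, b]" "1 \<notin> {p, p\<^sup>2, a, b}"
    "\<forall>x\<in>{p, p\<^sup>2, a, b}. \<forall>y\<in>{p, p\<^sup>2, a, b}. \<not> order G dvd x * y"
    "\<And>m. \<not> 2 * order G dvd fact m \<Longrightarrow> m < num_subgroups a \<and> m < num_subgroups b"
proof -
  define e where "e = multiplicity p (order G)"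
  have e: "p ^ e dvd order G" unfolding e_def by (rule multiplicity_dvd)
  have "\<not> p ^ e * p dvd order G"
    unfolding e_def using not_dvd_Suc_multiplicity[OF p(1)] order_pos by simp
  note e = e this
  have e0: "0 < e" unfolding e_def using p order_pos by (simp add: prime_multiplicity_gt_zero_iff)
  define n where "n = num_subgroups (p ^ e)"
  have n: "n mod p = 1" "n * p ^ e dvd order G" "2 < n"
    using num_subgroups_sylow[OF p(1) refl e0 e] by (simp_all add: n_def)
  have pn: "\<not> p dvd n" using n(1) p(2) by (auto simp: dvd_eq_mod_eq_0)
  have ndvd: "n dvd order G" using n(2) dvd_mult_left by blast
  have pnd: "p * n dvd order G"
  proof -
    have "p dvd p ^ e" using e0 by (simp add: dvd_power)
    then show ?thesis using n(2) by (metis dvd_refl dvd_trans mult.commute mult_dvd_mono)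
  qed
  have small: "q < p" if "prime q" "q dvd n" for q
    using largest[of q] that ndvd dvd_trans pn by (metis le_neq_implies_less)
  have p1: "1 < p" using p(2) by simp
  have p2: "1 < p\<^sup>2" using one_less_power[OF p1, of 2] by simp
  have not_prime_square: "\<not> prime (x\<^sup>2)" for x :: nat by (simp add: prime_power_iff)
  have gt: "m < num_subgroups (q ^ i)"
    if "prime q" "0 < i" "q ^ i dvd order G" "\<not> 2 * order G dvd fact m" for q i m
    using num_subgroups_prime_power_gt[OF that(1) refl that(2,3) dvd_refl that(4)] .
  consider q r where "prime q" "prime r" "q \<noteq> r" "q * r dvd n" | q where "prime q" "q ^ 3 dvd n"
    using cong_1_factors[OF p(1,2) n(1) _ small] n(3) by auto
  then show ?thesis
  proof cases
    case 1
    have qn: "q dvd n" "r dvd n" using 1 dvd_mult_left dvd_mult_right by blast+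
    have ne: "p \<noteq> q" "p \<noteq> r" using pn qn by auto
    have "p * q * r dvd p * n" using 1(4) by (simp add: mult.assoc mult_dvd_mono)
    then have dv: "p * q * r dvd order G" using pnd dvd_trans by blast
    show ?thesis
    proof (rule that[of q r])
      have "p\<^sup>2 \<noteq> q" "p\<^sup>2 \<noteq> r" using 1(1,2) not_prime_square by metis+
      then show "distinct [p, p\<^sup>2, q, r]" using ne 1(3) p1 by (auto simp: power2_eq_square)
      show "1 \<notin> {p, p\<^sup>2, q, r}" using p1 p2 prime_gt_1_nat[OF 1(1)] prime_gt_1_nat[OF 1(2)] by auto
      show "\<forall>x\<in>{p, p\<^sup>2, q, r}. \<forall>y\<in>{p, p\<^sup>2, q, r}. \<not> order G dvd x * y"
        using not_dvd_product_three_primes[OF p(1) 1(1,2) ne 1(3) dv] by blast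
      show "m < num_subgroups q \<and> m < num_subgroups r" if "\<not> 2 * order G dvd fact m" for m
        using gt[of q 1 m] gt[of r 1 m] that 1(1,2) qn ndvd dvd_trans by auto
    qed
  next
    case 2
    have "q ^ i dvd n" if "i \<le> 3" for i using le_imp_power_dvd[OF that] 2(2) dvd_trans by blast
    from this[of 1] this[of 2] have qn: "q dvd n" "q\<^sup>2 dvd n" by simp_all
    have ne: "p \<noteq> q" using pn qn by auto
    have "p * q ^ 3 dvd p * n" using 2(2) by (simp add: mult_dvd_mono)
    then have dv: "p * q ^ 3 dvd order G" using pnd dvd_trans by blast
    have q1: "1 < q" using 2(1) prime_gt_1_nat by blast
    show ?thesis
    proof (rule that[of q "q\<^sup>2"])
      have "p\<^sup>2 \<noteq> q" using 2(1) not_prime_square by metis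
      moreover have "p \<noteq> q\<^sup>2" using p(1) not_prime_square by metis
      ultimately show "distinct [p, p\<^sup>2, q, q\<^sup>2]"
        using ne p1 q1 power_eq_iff_eq_base[of 2 p q] by (auto simp: power2_eq_square)
      show "1 \<notin> {p, p\<^sup>2, q, q\<^sup>2}" using p1 p2 q1 one_less_power[OF q1, of 2] by auto
      show "\<forall>x\<in>{p, p\<^sup>2, q, q\<^sup>2}. \<forall>y\<in>{p, p\<^sup>2, q, q\<^sup>2}. \<not> order G dvd x * y"
        using not_dvd_product_prime_cube[OF p(1) 2(1) ne dv] by blast
      show "m < num_subgroups q \<and> m < num_subgroups (q\<^sup>2)" if "\<not> 2 * order G dvd fact m" for m
        using gt[of q 1 m] gt[of q 2 m] that 2(1) qn ndvd dvd_trans by auto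
    qed
  qed
qed

text \<open>So every class of proper nontrivial subgroups has at least \<open>p\<close> members.\<close>

lemma not_dvd_fact_below:
  assumes "prime p" "p dvd order G" "m < p" shows "\<not> 2 * order G dvd fact m"
proof
  assume "2 * order G dvd fact m"
  then have "p dvd fact m" using assms(2) by (meson dvd_trans dvd_triv_right)
  then show False using assms prime_dvd_fact_iff by auto
qed

text \<open>For a Sylow subgroup of order \<open>p\<close> the summand \<^term>\<open>num_subgroups p\<close> is the Sylow
number, and the inequality bounds it.\<close>

lemma largest_prime_sum:
  assumes p: "prime p" "5 \<le> p" "p dvd order G" and largest: "\<And>q. prime q \<Longrightarrow> q dvd order G \<Longrightarrow> q \<le> p"
    and m: "\<not> 2 * order G dvd fact m"
  shows "num_subgroups p + 2 * Suc m \<le> 51"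
    and "p\<^sup>2 dvd order G \<Longrightarrow> num_subgroups p + num_subgroups (p\<^sup>2) + 2 * Suc m \<le> 51 \<and> m < num_subgroups p \<and> m < num_subgroups (p\<^sup>2)"
proof -
  obtain a b where ab: "distinct [p, p\<^sup>2, a, b]" "1 \<notin> {p, p\<^sup>2, a, b}"
    "\<forall>x\<in>{p, p\<^sup>2, a, b}. \<forall>y\<in>{p, p\<^sup>2, a, b}. \<not> order G dvd x * y" "m < num_subgroups a \<and> m < num_subgroups b"
    using two_further_prime_powers[OF p largest] m by metis
  have "sum_list (map num_subgroups [p, p\<^sup>2, a, b]) \<le> 51"
    by (rule sum_list_num_subgroups_le[OF _ _ dvd_refl]) (use ab in auto)
  then have sum: "num_subgroups p + num_subgroups (p\<^sup>2) + num_subgroups a + num_subgroups b \<le> 51" by simp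
  then show "num_subgroups p + 2 * Suc m \<le> 51" using ab(4) by simp
  assume sq: "p\<^sup>2 dvd order G"
  have "m < num_subgroups p" "m < num_subgroups (p\<^sup>2)"
    using num_subgroups_prime_power_gt[OF p(1) _ _ p(3) dvd_refl m, of 1]
      num_subgroups_prime_power_gt[OF p(1) refl _ sq dvd_refl m] by simp_all
  then show "num_subgroups p + num_subgroups (p\<^sup>2) + 2 * Suc m \<le> 51 \<and> m < num_subgroups p \<and> m < num_subgroups (p\<^sup>2)"
    using sum ab(4) by simp
qed

end

section \<open>Excluding a prime divisor greater than 5\<close>

context few_independent
begin

text \<open>The Sylow number is 14, so the order is a multiple of 182 and a divisor of \<open>14 \<cdot> 13 \<cdot> 12\<close>.
A further divisor 3 or 4 would add a fourth class with at least 13 members.  In a group of order 182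
the Sylow 7-subgroup would be normal.\<close>

lemma largest_prime_not_13:
  assumes "13 dvd order G" "\<not> 13 * 13 dvd order G" "num_subgroups 13 \<le> 25"
  shows False
proof -
  have "num_subgroups 13 mod 13 = 1" "num_subgroups 13 * 13 dvd order G" "2 < num_subgroups 13"
    using num_subgroups_sylow[of 13 13 1] assms by auto
  then have n: "num_subgroups 13 = 14" using assms(3) residue_in_list[of "num_subgroups 13" 13 2 26 "[14]"] by simp
  then have d182: "182 dvd order G" using \<open>num_subgroups 13 * 13 dvd order G\<close> by simp
  then obtain k where k: "order G = 182 * k" by blast
  have "order G dvd 182 * 12"
    using order_dvd_num_subgroups_prime[of 13 1] assms n by simp
  then have "k dvd 12" using k by simp
  then have k12: "k \<in> {1, 2, 3, 4, 6, 12}" using divisor_in_list[of k 12 "[2, 3, 4, 6, 12]"] by simp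
  have ge: "13 \<le> num_subgroups q" if "prime p" "q = p ^ i" "0 < i" "q dvd order G" for p q i
    using num_subgroups_prime_power_gt[OF that assms(1), of 12] by (simp add: fact_numeral)
  have g: "13 \<le> num_subgroups 2" "13 \<le> num_subgroups 7"
    using ge[of 2 2 1] ge[of 7 7 1] d182 dvd_trans[of _ 182 "order G"] by auto
  have "\<not> 3 dvd order G"
  proof
    assume "3 dvd order G"
    then have "13 \<le> num_subgroups 3" using ge[of 3 3 1] by simp
    then show False using sum_list_num_subgroups_le[OF _ _ d182, of "[13, 2, 7, 3]"] n g by simp
  qed
  moreover have "\<not> 4 dvd order G"
  proof
    assume "4 dvd order G"
    then have "13 \<le> num_subgroups 4" using ge[of 2 4 2] by simp
    then show False using sum_list_num_subgroups_le[OF _ _ d182, of "[13, 2, 7, 4]"] n g by simp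
  qed
  ultimately have "order G = 182" using k k12 by auto
  then have "num_subgroups 7 mod 7 = 1" "num_subgroups 7 dvd 26"
    using num_subgroups_sylow[of 7 7 1] dvd_cofactor[of "num_subgroups 7" 7 "order G" 26] by auto
  then show False
    using g(2) dvd_imp_le[of "num_subgroups 7" 26] divisor_residue_in_list[of "num_subgroups 7" 7 26 13 27 "[]"] by simp
qed

text \<open>The Sylow number is 12, so the order is a multiple of 132 and a divisor of \<open>12 \<cdot> 11 \<cdot> 10\<close>.
A divisor 5 gives a fifth class with at least 11 members; otherwise the Sylow
3-subgroups are too numerous.\<close>

lemma largest_prime_not_11:
  assumes "11 dvd order G" "\<not> 11 * 11 dvd order G" "num_subgroups 11 \<le> 29" "\<not> 23 dvd order G"
  shows False
proof -
  have s: "num_subgroups 11 mod 11 = 1" "num_subgroups 11 * 11 dvd order G" "2 < num_subgroups 11"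
    using num_subgroups_sylow[of 11 11 1] assms by auto
  then have "num_subgroups 11 = 12 \<or> num_subgroups 11 = 23"
    using assms(3) residue_in_list[of "num_subgroups 11" 11 2 30 "[12, 23]"] by simp
  moreover have "num_subgroups 11 \<noteq> 23" using s(2) assms(4) dvd_mult_left by metis
  ultimately have n: "num_subgroups 11 = 12" by simp
  then have d132: "132 dvd order G" using s(2) by simp
  then obtain k where k: "order G = 132 * k" by blast
  have "order G dvd 132 * 10"
    using order_dvd_num_subgroups_prime[of 11 1] assms n by simp
  then have "k dvd 10" using k by simp
  then have k10: "k \<in> {1, 2, 5, 10}" using divisor_in_list[of k 10 "[2, 5, 10]"] by simp
  have ge: "11 \<le> num_subgroups q" if "prime p" "q = p ^ i" "0 < i" "q dvd order G" for p q i
    using num_subgroups_prime_power_gt[OF that assms(1), of 10] by (simp add: fact_numeral)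
  have g: "11 \<le> num_subgroups 2" "11 \<le> num_subgroups 4" "11 \<le> num_subgroups 3"
    using ge[of 2 2 1] ge[of 2 4 2] ge[of 3 3 1] d132 dvd_trans[of _ 132 "order G"] by auto
  have "\<not> 5 dvd order G"
  proof
    assume "5 dvd order G"
    then have "11 \<le> num_subgroups 5" using ge[of 5 5 1] by simp
    then show False using sum_list_num_subgroups_le[OF _ _ d132, of "[11, 2, 4, 3, 5]"] n g by simp
  qed
  then have k2: "k \<in> {1, 2}" using k k10 by auto
  then have n3: "num_subgroups 3 mod 3 = 1" "num_subgroups 3 * 3 dvd order G"
    using num_subgroups_sylow[of 3 3 1] k by auto
  have "order G dvd 88 * 3" using k k2 by auto
  with n3 have n3: "num_subgroups 3 mod 3 = 1" "num_subgroups 3 dvd 88" using dvd_cofactor by auto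
  have "num_subgroups 3 \<le> 17"
    using sum_list_num_subgroups_le[OF _ _ d132, of "[11, 2, 4, 3]"] n g by simp
  then show False using divisor_residue_in_list[OF n3 g(3), of 18 "[]"] by simp
qed

text \<open>The Sylow number is 8, 15 or 36.  For 36 the orders 7, 2, 4, 3 suffice.  For 15 the order divides 1260 and
there are 21 Sylow 5-subgroups.  If 9 does not divide the order there are 10 Sylow 3-subgroups, so the
order is even, and the orders 7, 5, 3, 2 suffice; otherwise the order is 315, and the normalizers of
the Sylow 5-subgroups provide subgroups of order 15.  For 8 the order is 56, 112, 168 or 336.  If it is
divisible by 3 there are 28 Sylow 3-subgroups, and for 168 their normalizers add 28 subgroups of
order 6.\<close>

lemma largest_prime_not_7:
  assumes g7: "7 dvd order G" "\<not> 7 * 7 dvd order G" and n37: "num_subgroups 7 \<le> 37"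
    and "\<not> 11 dvd order G" "\<not> 29 dvd order G"
  shows False
proof -
  have s: "num_subgroups 7 mod 7 = 1" "num_subgroups 7 * 7 dvd order G" "2 < num_subgroups 7"
    using num_subgroups_sylow[of 7 7 1] g7 by auto
  have ge: "7 \<le> num_subgroups q" if "prime p" "q = p ^ i" "0 < i" "q dvd order G" for p q i
    using num_subgroups_prime_power_gt[OF that g7(1), of 6] by (simp add: fact_numeral)
  have "num_subgroups 7 \<in> {8, 15, 22, 29, 36}"
    using s n37 residue_in_list[of "num_subgroups 7" 7 2 38 "[8, 15, 22, 29, 36]"] by simp
  moreover have "num_subgroups 7 \<noteq> 22" using s(2) assms(4) dvd_trans[of 11 "22 * 7" "order G"] by auto
  moreover have "num_subgroups 7 \<noteq> 29" using s(2) assms(5) dvd_mult_left by metis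
  ultimately consider "num_subgroups 7 = 36" | "num_subgroups 7 = 15" | "num_subgroups 7 = 8" by blast
  then show False
  proof cases
    case 1
    then have d: "252 dvd order G" using s(2) by simp
    have "7 \<le> num_subgroups 2" "7 \<le> num_subgroups 4" "7 \<le> num_subgroups 3"
      using ge[of 2 2 1] ge[of 2 4 2] ge[of 3 3 1] d dvd_trans[of _ 252 "order G"] by auto
    then show False using sum_list_num_subgroups_le[OF _ _ d, of "[7, 2, 4, 3]"] 1 by simp
  next
    case 2
    then have d: "105 dvd order G" using s(2) by simp
    have up: "order G dvd 1260" using order_dvd_num_subgroups_prime[of 7 2] g7 2 by (simp add: fact_numeral)
    have g: "7 \<le> num_subgroups 5" "7 \<le> num_subgroups 3"
      using ge[of 5 5 1] ge[of 3 3 1] d dvd_trans[of _ 105 "order G"] by auto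
    have n53: "num_subgroups 5 + num_subgroups 3 \<le> 36"
      using sum_list_num_subgroups_le[OF _ _ d, of "[7, 5, 3]"] 2 by simp
    have "\<not> 25 dvd order G" using up dvd_trans[of 25 "order G" 1260] by auto
    then have "num_subgroups 5 mod 5 = 1" "num_subgroups 5 * 5 dvd order G"
      using num_subgroups_sylow[of 5 5 1] d dvd_trans[of 5 105 "order G"] by auto
    moreover from this have "num_subgroups 5 dvd 252" using dvd_cofactor[of "num_subgroups 5" 5 "order G" 252] up by simp
    ultimately have "num_subgroups 5 mod 5 = 1" "num_subgroups 5 dvd 252" by simp_all
    then have n5: "num_subgroups 5 = 21"
      using g n53 divisor_residue_in_list[of "num_subgroups 5" 5 252 7 30 "[21]"] by simp
    show False
    proof (cases "9 dvd order G")
      case False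
      then have n3: "num_subgroups 3 mod 3 = 1" "num_subgroups 3 * 3 dvd order G"
        using num_subgroups_sylow[of 3 3 1] d dvd_trans[of 3 105 "order G"] by auto
      then have "num_subgroups 3 dvd 420" using dvd_cofactor[of "num_subgroups 3" 3 "order G" 420] up by simp
      then have "num_subgroups 3 \<in> {7, 10}"
        using g n53 n5 n3(1) divisor_residue_in_list[of "num_subgroups 3" 3 420 7 16 "[7, 10]"] by simp
      moreover have "num_subgroups 3 \<noteq> 7"
      proof
        assume "num_subgroups 3 = 7"
        then have "order G dvd 84"
          using order_dvd_num_subgroups_prime[of 3 2] False d dvd_trans[of 3 105 "order G"] by (auto simp: fact_numeral)
        then show False using d dvd_trans[of 105 "order G" 84] by auto
      qed
      ultimately have n10: "num_subgroups 3 = 10" by simp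
      \<comment> \<open>A Sylow number divides the order.\<close>
      then have "2 dvd order G" using n3(2) dvd_trans[of 2 "10 * 3" "order G"] by auto
      then have "7 \<le> num_subgroups 2" using ge[of 2 2 1] by simp
      then show False using sum_list_num_subgroups_le[OF _ _ d, of "[7, 5, 3, 2]"] 2 n5 n10 by simp
    next
      case True
      then have g9: "7 \<le> num_subgroups 9" using ge[of 3 9 2] by simp
      have odd: "\<not> 2 dvd order G"
      proof
        assume "2 dvd order G"
        then have "7 \<le> num_subgroups 2" using ge[of 2 2 1] by simp
        then show False using sum_list_num_subgroups_le[OF _ _ d, of "[7, 5, 3, 2, 9]"] 2 n5 g g9 by simp
      qed
      obtain k where k: "order G = 105 * k" using d by blast
      then have "105 * k dvd 105 * 12" using up by simp
      then have "k dvd 12" by (subst (asm) dvd_times_left_cancel_iff) auto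
      then have "k \<in> {1, 2, 3, 4, 6, 12}" using divisor_in_list[of k 12 "[2, 3, 4, 6, 12]"] by simp
      then have ord: "order G = 315" using odd True k by auto
      then have "num_subgroups 5 \<le> num_subgroups 15" using num_subgroups_normalizers_ge[of 5 5 1 15] n5 by simp
      then show False using sum_list_num_subgroups_le[of "[7, 5, 3, 9, 15]" 315] 2 n5 g g9 ord by simp
    qed
  next
    case 3
    then have d: "56 dvd order G" using s(2) by simp
    have up: "order G dvd 336" using order_dvd_num_subgroups_prime[of 7 1] g7 3 by (simp add: fact_numeral)
    obtain k where k: "order G = 56 * k" using d by blast
    then have "56 * k dvd 56 * 6" using up by simp
    then have "k dvd 6" by (subst (asm) dvd_times_left_cancel_iff) auto
    then have k6: "k \<in> {1, 2, 3, 6}" using divisor_in_list[of k 6 "[2, 3, 6]"] by simp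
    have g: "7 \<le> num_subgroups 2" "7 \<le> num_subgroups 4"
      using ge[of 2 2 1] ge[of 2 4 2] d dvd_trans[of _ 56 "order G"] by auto
    show False
    proof (cases "3 dvd order G")
      case True
      have "\<not> 9 dvd order G" using up dvd_trans[of 9 "order G" 336] by auto
      then have n3: "num_subgroups 3 mod 3 = 1" "num_subgroups 3 * 3 dvd order G"
        using num_subgroups_sylow[of 3 3 1] True by auto
      then have n112: "num_subgroups 3 dvd 112" using dvd_cofactor[of "num_subgroups 3" 3 "order G" 112] up by simp
      have le: "num_subgroups 3 \<le> 29"
        using sum_list_num_subgroups_le[OF _ _ d, of "[7, 2, 4, 3]"] 3 g by simp
      have "num_subgroups 3 \<in> {7, 16, 28}"
        using divisor_residue_in_list[OF n3(1) n112, of 7 30 "[7, 16, 28]"] ge[of 3 3 1] True le by simp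
      moreover have "num_subgroups 3 \<noteq> 7"
      proof
        assume "num_subgroups 3 = 7"
        then have "order G dvd 84"
          using order_dvd_num_subgroups_prime[of 3 2] \<open>\<not> 9 dvd order G\<close> True by (simp add: fact_numeral)
        then have "56 * k dvd 84" using k by simp
        then show False using True k k6 by auto
      qed
      moreover have "num_subgroups 3 \<noteq> 16"
      proof
        assume "num_subgroups 3 = 16"
        then have "order G dvd 11520"
          using order_dvd_num_subgroups_prime[of 3 5] \<open>\<not> 9 dvd order G\<close> True by (simp add: fact_numeral)
        then show False using g7(1) dvd_trans[of 7 "order G" 11520] by auto
      qed
      ultimately have n28: "num_subgroups 3 = 28" by simp
      consider "order G = 168" | "order G = 336" using True k k6 by auto
      then show False
      proof cases
        case 1
        then have "num_subgroups 3 \<le> num_subgroups 6" using num_subgroups_normalizers_ge[of 3 3 1 6] n28 by simp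
        then show False using sum_list_num_subgroups_le[of "[3, 6]" 168] 1 n28 by simp
      next
        case 2
        then have "7 \<le> num_subgroups 8" using ge[of 2 8 3] by simp
        then show False using sum_list_num_subgroups_le[of "[7, 3, 2, 4, 8]" 336] 2 3 n28 g by simp
      qed
    next
      case False
      consider "order G = 112" | "order G = 56" using False k k6 by auto
      then show False
      proof cases
        case 1
        \<comment> \<open>A Sylow 2-subgroup has index 7, but 224 does not divide \<open>7!\<close>.\<close>
        then show False using order_dvd_fact_cofactor[of 2 4 7] by (simp add: fact_numeral)
      next
        case 2
        \<comment> \<open>Besides the 48 elements of order 7 there is no room for two Sylow 2-subgroups.\<close>
        have n8: "num_subgroups 8 > 2" using num_subgroups_sylow(4)[of 2 8 3] 2 by simp
        then have "\<not> card {H. subgroup H G \<and> card H = 8} \<le> Suc 0" by (simp add: num_subgroups_def)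
        then obtain S T where ST: "subgroup S G" "card S = 8" "subgroup T G" "card T = 8" "S \<noteq> T"
          unfolding card_le_Suc0_iff_eq[OF finite_num_subgroups] by blast
        have fS: "finite S" "finite T" using ST finite_subgroup by auto
        have I: "subgroup (S \<inter> T) G" using ST subgroups_Inter_pair by blast
        have "card (S \<inter> T) dvd 8" using card_subgroup_dvd[OF I ST(1)] ST(2) by auto
        moreover have "card (S \<inter> T) \<noteq> 8"
        proof
          assume "card (S \<inter> T) = 8"
          then have "S \<inter> T = S" "S \<inter> T = T" using ST fS by (simp_all add: card_subset_eq)
          then show False using ST(5) by simp
        qed
        ultimately have "card (S \<inter> T) \<le> 4"
          using divisor_in_list[of "card (S \<inter> T)" 8 "[2, 4, 8]"] by auto
        moreover have "card (S \<union> T) + card (S \<inter> T) = 16" using card_Un_Int[OF fS] ST by simp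
        ultimately have "card (S \<union> T - {\<one>}) \<ge> 11"
          using subgroup.one_closed[OF ST(1)] fS by simp
        moreover have "card (prime_elements 7) = 48" using card_prime_elements[of 7] 3 by simp
        moreover have "card (prime_elements 7) + card (S \<union> T - {\<one>}) < order G"
        proof (rule card_disjoint_le[OF prime_elements_subset])
          show "S \<union> T - {\<one>} \<subseteq> carrier G - {\<one>}" using ST subgroup.subset by blast
          have "coprime 7 (8::nat)" by code_simp
          then show "prime_elements 7 \<inter> (S \<union> T - {\<one>}) = {}"
            using prime_elements_disjoint_subgroup[OF ST(1), of 7] prime_elements_disjoint_subgroup[OF ST(3), of 7]
              ST(2,4) by auto
        qed
        ultimately show False using 2 by simp
      qed
    qed
  qed
qed

text \<open>If \<open>p\<^sup>2\<close> divides the order, four classes with at least \<open>p\<close> members leave only 7 and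
11 for \<open>p\<close>, and then \<open>p\<^sup>2\<close> does not divide \<open>12!\<close>, so that the four classes have at
least 13 members each.  Otherwise \<open>3 p < 51\<close>.\<close>

lemma largest_prime_le_5:
  assumes p: "prime p" "p dvd order G" and largest: "\<And>q. prime q \<Longrightarrow> q dvd order G \<Longrightarrow> q \<le> p"
  shows "p \<le> 5"
proof (rule ccontr)
  assume "\<not> p \<le> 5"
  then have p5: "5 \<le> p" "5 < p" by auto
  note sum = largest_prime_sum[OF p(1) p5(1) p(2)]
  have m: "\<not> 2 * order G dvd fact (p - 1)"
    using not_dvd_fact_below[OF p] prime_gt_0_nat[OF p(1)] by simp
  have big: "\<not> q dvd order G" if "prime q" "p < q" for q using largest[of q] that by auto
  have p17: "num_subgroups p + 2 * p \<le> 51" using sum(1)[OF largest m] p5 by simp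
  have "\<not> p * p dvd order G"
  proof
    assume sq: "p * p dvd order G"
    then have "4 * p \<le> 51" using sum(2)[OF largest m] p5 by (auto simp: power2_eq_square)
    then have p711: "p = 7 \<or> p = 11" using prime_in_list[of p 6 13 "[7, 11]"] p5 p(1) by simp
    have "\<not> 2 * (p * p) dvd fact 12" using p711 by (auto simp: fact_numeral)
    then have "\<not> 2 * order G dvd fact 12" using sq by (meson dvd_refl dvd_trans mult_dvd_mono)
    then show False using sum(2)[OF largest, of 12] sq by (auto simp: power2_eq_square)
  qed
  note np2 = this
  then have "p < num_subgroups p"
  proof -
    have "num_subgroups p mod p = 1" "2 < num_subgroups p" using num_subgroups_sylow[of p p 1] p np2 by auto
    moreover from this have "num_subgroups p \<noteq> p" "\<not> num_subgroups p < p" by auto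
    ultimately show ?thesis by linarith
  qed
  then have "p < 17" using p17 by simp
  then have "p = 7 \<or> p = 11 \<or> p = 13" using prime_in_list[of p 6 17 "[7, 11, 13]"] p5 p(1) by simp
  then consider "p = 7" | "p = 11" | "p = 13" by blast
  then show False
  proof cases
    case 1
    then show False using largest_prime_not_7 p(2) np2 p17 big[of 11] big[of 29] by simp
  next
    case 2
    then show False using largest_prime_not_11 p(2) np2 p17 big[of 23] by simp
  next
    case 3
    then show False using largest_prime_not_13 p(2) np2 p17 by simp
  qed
qed

end

section \<open>Excluding the largest prime divisor 5\<close>

context few_independent
begin

text \<open>No subgroup has exactly 5 conjugates, as 240 does not divide \<open>5!\<close>.  Hence there are 15 Sylow
2-subgroups.  The 10 Sylow 3-subgroups have normalizers of order 12, and the subgroups of order 2 and 4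
come in classes whose sizes are multiples of 5 and greater than 5.  The products of two of the orders 8, 3,
12, 2, 4 are not divisible by 120.\<close>

lemma order_not_120:
  assumes ord: "order G = 120" and n5: "num_subgroups 5 = 6"
  shows False
proof -
  have nf: "\<not> 2 * order G dvd fact 5" using ord by (simp add: fact_numeral)
  have ge: "6 \<le> num_subgroups q" if "prime p" "q = p ^ i" "0 < i" "q dvd order G" for p q i
    using num_subgroups_prime_power_gt[OF that dvd_refl nf] by simp
  have g: "6 \<le> num_subgroups 2" "6 \<le> num_subgroups 4" "6 \<le> num_subgroups 3"
    using ge[of 2 2 1] ge[of 2 4 2] ge[of 3 3 1] ord by auto
  have s3: "num_subgroups 3 mod 3 = 1" "num_subgroups 3 * 3 dvd order G" using num_subgroups_sylow[of 3 3 1] ord by auto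
  then have "num_subgroups 3 dvd 40" using dvd_cofactor[of "num_subgroups 3" 3 "order G" 40] ord by simp
  moreover have "num_subgroups 3 \<le> 33"
    using sum_list_num_subgroups_le[of "[5, 2, 4, 3]" 120] ord n5 g by simp
  ultimately have n3: "num_subgroups 3 = 10"
    using divisor_residue_in_list[of "num_subgroups 3" 3 40 6 34 "[10]"] s3 g by simp
  then have n12: "10 \<le> num_subgroups 12" using num_subgroups_normalizers_ge[of 3 3 1 12] ord by simp
  have s8: "num_subgroups 8 mod 2 = 1" "num_subgroups 8 * 8 dvd order G" using num_subgroups_sylow[of 2 8 3] ord by auto
  then have "num_subgroups 8 dvd 15" using dvd_cofactor[of "num_subgroups 8" 8 "order G" 15] ord by simp
  then have n8: "num_subgroups 8 = 15"
    using divisor_residue_in_list[of "num_subgroups 8" 2 15 6 16 "[15]"] s8 ge[of 2 8 3] ord dvd_imp_le[of "num_subgroups 8" 15] by simp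
  have ten: "10 \<le> num_subgroups q" if q: "q = 2 ^ i" "0 < i" "i \<le> 2" for q i
  proof -
    have "q = 2 \<or> q = 4" using q by (cases "i = 1") (auto simp: le_Suc_eq numeral_2_eq_2)
    then have qd: "q dvd order G" "1 < q" "q < 5" using ord by auto
    obtain H where H: "subgroup H G" "card H = q"
      using exists_subgroup_of_prime_power_order[of 2 i] q qd by auto
    have "5 dvd card (conjugates H)"
      using prime_dvd_card_conjugates(2)[of 5 H] ord n5 H qd by simp
    moreover have "5 < card (conjugates H)"
    proof (rule ccontr)
      assume "\<not> 5 < card (conjugates H)"
      then have "(fact (card (conjugates H)) :: nat) dvd fact 5" by (intro fact_dvd) simp
      moreover have "2 * order G dvd fact (card (conjugates H))"
        by (rule order_dvd_fact_conjugates[OF H(1)]) (use H qd ord in \<open>auto simp: order_def\<close>)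
      ultimately show False using nf dvd_trans by blast
    qed
    ultimately have "10 \<le> card (conjugates H)" by auto
    also have "\<dots> \<le> num_subgroups q"
      unfolding num_subgroups_def using conjugates_props[OF H(1)] H(2) by (intro card_mono) auto
    finally show ?thesis .
  qed
  show False
    using sum_list_num_subgroups_le[of "[8, 3, 12, 2, 4]" 120] ord n8 n3 n12 ten[of 2 1] ten[of 4 2] by simp
qed

text \<open>This is the case of the alternating group of degree 5, where the family is as large as possible.  There
are 6 and 10 Sylow subgroups for 5 and 3, with normalizers of order 10 and 6, and at least 5 subgroups of
order 4.  A subgroup \<open>R\<close> of order 2 has index 2 in a Sylow 2-subgroup, which normalizes it, so
its number of conjugates divides 15; it is also a multiple of 5.  Counting elements leaves room
for 15 involutions only, so as soon as the number is 15 all involutions are conjugate.  Suppose then that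
\<open>H\<close>, \<open>K\<close> of order 6, 10 are comaximal.  They intersect trivially, but contain
involutions that are conjugate under some \<open>h k\<close>, and moving \<open>h\<close> to the other side gives an
involution common to \<open>H\<close> and \<open>K\<close>.\<close>

lemma order_not_60:
  assumes ord: "order G = 60" and n5: "num_subgroups 5 = 6"
  shows False
proof -
  have nf: "\<not> 2 * order G dvd fact 4" using ord by (simp add: fact_numeral)
  have ge: "5 \<le> num_subgroups q" if "prime p" "q = p ^ i" "0 < i" "q dvd order G" for p q i
    using num_subgroups_prime_power_gt[OF that dvd_refl nf] by simp
  have s3: "num_subgroups 3 mod 3 = 1" "num_subgroups 3 * 3 dvd order G" using num_subgroups_sylow[of 3 3 1] ord by auto
  then have "num_subgroups 3 dvd 20" using dvd_cofactor[of "num_subgroups 3" 3 "order G" 20] ord by simp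
  then have n3: "num_subgroups 3 = 10"
    using divisor_residue_in_list[of "num_subgroups 3" 3 20 5 21 "[10]"] s3 ge[of 3 3 1] ord
      dvd_imp_le[of "num_subgroups 3" 20] by simp
  have n6: "10 \<le> num_subgroups 6" using num_subgroups_normalizers_ge[of 3 3 1 6] n3 ord by simp
  have n10: "6 \<le> num_subgroups 10" using num_subgroups_normalizers_ge[of 5 5 1 10] n5 ord by simp
  have n4: "5 \<le> num_subgroups 4" using ge[of 2 4 2] ord by simp
  have n2: "num_subgroups 2 \<le> 15"
  proof -
    let ?E = "prime_elements"
    have f: "finite (?E 3)" "finite (?E 5)" using finite_subset[OF prime_elements_subset] fin by auto
    have "card (?E 3 \<union> ?E 5) = 44"
      using f prime_elements_disjoint[of 3 5] card_prime_elements[of 3] card_prime_elements[of 5] n3 n5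
      by (simp add: card_Un_disjoint)
    moreover have "card (?E 3 \<union> ?E 5) + card (?E 2) < order G"
    proof (rule card_disjoint_le)
      show "(?E 3 \<union> ?E 5) \<inter> ?E 2 = {}"
        using prime_elements_disjoint[of 3 2] prime_elements_disjoint[of 5 2] by auto
    qed (use prime_elements_subset in auto)
    ultimately show ?thesis using card_prime_elements[of 2] ord by simp
  qed
  have four: "4 dvd card (normalizer_of R)" if R: "subgroup R G" "card R = 2" for R
  proof -
    obtain S where S: "subgroup S G" "card S = 2 ^ 2"
      using exists_subgroup_of_prime_power_order[of 2 2] ord by auto
    obtain m where m: "m \<in> carrier G" "R \<subseteq> conjugate m S"
      using subgroup_le_conjugate[OF S(1) R(1) subgroup_self subgroup.subset[OF S(1)]
          subgroup.subset[OF R(1)], of 2 1 15] R(2) S(2) ord by (auto simp: order_def)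
    have c: "subgroup (conjugate m S) G" "card (conjugate m S) = 4"
      using subgroup_conjugate[OF m(1) S(1)] card_conjugate[OF m(1) subgroup.subset[OF S(1)]] S(2) by simp_all
    have "conjugate m S \<subseteq> normalizer_of R" using index_2_subset_normalizer[OF R(1) c(1) m(2)] c(2) R(2) by simp
    then show ?thesis using card_subgroup_dvd[OF c(1) subgroup_normalizer[OF R(1)]] c(2) by simp
  qed
  obtain P where PS: "P \<in> sylows 5" using sylows_nonempty[of 5] by auto
  have m5: "multiplicity 5 (order G) = 1" using ord by (intro multiplicity_eqI) auto
  have P: "subgroup P G" "card P = 5" using PS m5 by (auto simp: sylows_def)
  have "card (sylows 5) = 6" using card_sylows_eq_num_subgroups[of 5 1] ord n5 by simp
  then have cN: "card (normalizer_of P) = 10" using card_sylows[OF _ PS] ord by simp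
  obtain R where R: "subgroup R G" "R \<subseteq> normalizer_of P" "card R = 2"
    using Cauchy_in_subgroup[OF subgroup_normalizer[OF P(1)], of 2] cN by auto
  have pd: "\<not> 5 dvd card (normalizer_of R)" "5 dvd card (conjugates R)"
    using prime_dvd_card_conjugates[of 5 R] ord n5 R by simp_all
  have c15: "card (conjugates R) = 15"
  proof -
    obtain k where "card (normalizer_of R) = 4 * k" using four[OF R(1,3)] by blast
    then have "card (conjugates R) * k = 15" using card_conjugates[OF R(1)] ord by (simp add: mult.commute)
    then have "card (conjugates R) dvd 15" by (metis dvd_triv_left)
    then have "card (conjugates R) \<in> {5, 15}"
      using divisor_in_list[of "card (conjugates R)" 15 "[3, 5, 15]"] pd(2) by auto
    moreover have "card (conjugates R) \<noteq> 5"
    proof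
      assume c5: "card (conjugates R) = 5"
      \<comment> \<open>\<open>P\<close> permutes the five conjugates of \<open>R\<close> transitively, so all of them lie in the
        normalizer of \<open>P\<close>.  By conjugation \<open>R\<close> lies in the normalizer of every Sylow 5-subgroup,
        and an element normalizing all of these is trivial.\<close>
      let ?O = "(\<lambda>g. conjugate g R) ` P"
      let ?S = "{u\<in>P. conjugate u R = R}"
      have act: "acts P Subgroups conjugate" by (rule acts_conjugate[OF P(1)])
      have RS: "R \<in> Subgroups" using R by (simp add: Subgroups_def)
      have S: "subgroup ?S G" using stabilizer_is_subgroup[OF act, of "{R}"] RS by simp
      have "card ?O * card ?S = 5" using orbit_stabilizer[OF act RS] P(2) by simp
      moreover have "card ?S \<noteq> 5"
      proof
        assume "card ?S = 5"
        then have "?S = P" using P by (intro card_subset_eq finite_subgroup) auto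
        then have "P \<subseteq> normalizer_of R" using subgroup.subset[OF P(1)] unfolding normalizer_of_def by blast
        then show False using pd(1) card_subgroup_dvd[OF P(1) subgroup_normalizer[OF R(1)]] P(2) by simp
      qed
      ultimately have "card ?O = 5"
        using divisor_in_list[of "card ?S" 5 "[5]"] dvd_triv_right[of "card ?S" "card ?O"] by auto
      moreover have "?O \<subseteq> conjugates R" unfolding conjugates_def using subgroup.subset[OF P(1)] by blast
      moreover have "finite (conjugates R)" unfolding conjugates_def by simp
      ultimately have O: "?O = conjugates R" using c5 card_subset_eq by metis
      have sN: "subgroup (normalizer_of P) G" by (rule subgroup_normalizer[OF P(1)])
      have inN: "conjugate g R \<subseteq> normalizer_of P" if g: "g \<in> carrier G" for g
      proof -
        have "conjugate g R \<in> ?O" unfolding O conjugates_def using g by blast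
        then obtain u where u: "u \<in> P" "conjugate g R = conjugate u R" by blast
        have "u \<in> normalizer_of P" using u(1) subset_normalizer[OF P(1)] by blast
        then have "conjugate u R \<subseteq> conjugate u (normalizer_of P)" "conjugate u (normalizer_of P) = normalizer_of P"
          using R(2) conjugate_by_member[OF sN] by (auto simp: conjugate_def)
        then show ?thesis using u(2) by simp
      qed
      obtain r where r: "r \<in> R" "r \<noteq> \<one>" using subgroup_nontrivial_element[OF R(1)] R(3) by auto
      have rc: "r \<in> carrier G" using r R subgroup.mem_carrier by metis
      have "conjugate r Q = Q" if Q: "Q \<in> sylows 5" for Q
      proof -
        have "Q \<in> conjugates P" using Q sylows_eq_conjugates[OF _ PS] by simp
        then obtain g where g: "g \<in> carrier G" "Q = conjugate g P" unfolding conjugates_def by blast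
        define r' where "r' = inv g \<otimes> r \<otimes> g"
        have r'c: "r' \<in> carrier G" unfolding r'_def using g rc by simp
        have "r' \<in> conjugate (inv g) R" unfolding conjugate_def r'_def using r g by auto
        then have "r' \<in> normalizer_of P" using inN[of "inv g"] g by blast
        then have r'P: "conjugate r' P = P" by (simp add: normalizer_of_def)
        have rg: "r \<otimes> g = g \<otimes> r'" unfolding r'_def using rc g by (simp add: m_assoc[symmetric])
        have "conjugate r Q = conjugate (r \<otimes> g) P"
          using rc g subgroup.subset[OF P(1)] by (simp add: conjugate_mult)
        also have "\<dots> = Q" unfolding rg using r'P r'c g subgroup.subset[OF P(1)] by (simp add: conjugate_mult)
        finally show ?thesis .
      qed
      then have "r = \<one>" using normalizes_all_sylows_imp_one[of 5 r] ord rc by simp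
      then show False using r by simp
    qed
    ultimately show ?thesis by blast
  qed
  have sub: "conjugates R \<subseteq> {H. subgroup H G \<and> card H = 2}" using conjugates_props[OF R(1)] R(3) by auto
  then have "15 \<le> num_subgroups 2" unfolding num_subgroups_def using c15 card_mono[OF finite_num_subgroups sub] by simp
  then have n15: "num_subgroups 2 = 15" using n2 by simp
  have all_conj: "{H. subgroup H G \<and> card H = 2} = conjugates R"
    using card_subset_eq[OF finite_num_subgroups sub] c15 n15 unfolding num_subgroups_def by simp
  have no610: "H <#> K \<noteq> carrier G"
    if H: "subgroup H G" "even (card H)" and K: "subgroup K G" "even (card K)" and I: "card (H \<inter> K) = 1" for H K
  proof
    assume HK: "H <#> K = carrier G"
    obtain A where A: "subgroup A G" "A \<subseteq> H" "card A = 2" using Cauchy_in_subgroup[OF H(1), of 2] H(2) by auto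
    obtain B where B: "subgroup B G" "B \<subseteq> K" "card B = 2" using Cauchy_in_subgroup[OF K(1), of 2] K(2) by auto
    have "A \<in> conjugates R" "B \<in> conjugates R" using A B all_conj by auto
    then obtain a b where ab: "a \<in> carrier G" "b \<in> carrier G" "A = conjugate a R" "B = conjugate b R"
      unfolding conjugates_def by blast
    have Rc: "R \<subseteq> carrier G" by (rule subgroup.subset[OF R(1)])
    have "a \<otimes> inv b \<in> H <#> K" using HK ab by simp
    then obtain h k where hk: "h \<in> H" "k \<in> K" "a \<otimes> inv b = h \<otimes> k" unfolding set_mult_def by blast
    have hkc: "h \<in> carrier G" "k \<in> carrier G" using hk H K subgroup.mem_carrier by metis+
    have e: "inv h \<otimes> a = k \<otimes> b"
    proof -
      have "a = h \<otimes> k \<otimes> b" using hk(3) ab hkc by (simp flip: hk(3) add: m_assoc)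
      then show ?thesis using hkc ab by (simp add: m_assoc) (simp add: m_assoc[symmetric])
    qed
    have "conjugate (inv h) A = conjugate k B"
      using e ab hkc Rc by (simp flip: conjugate_mult)
    moreover have "conjugate (inv h) A \<subseteq> H"
      using A(2) conjugate_by_member[OF H(1), of "inv h"] hk(1) subgroup.m_inv_closed[OF H(1)]
      unfolding conjugate_def by blast
    moreover have "conjugate k B \<subseteq> K"
      using B(2) conjugate_by_member[OF K(1) hk(2)] unfolding conjugate_def by blast
    ultimately have "conjugate k B \<subseteq> H \<inter> K" by simp
    then have "card (conjugate k B) \<le> card (H \<inter> K)"
      by (rule card_mono[rotated]) (use finite_subgroup[OF H(1)] in simp)
    then show False using I card_conjugate[OF hkc(2) subgroup.subset[OF B(1)]] B(3) by simp
  qed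
  have "(\<Sum>n\<in>{2, 3, 4, 5, 6, 10}. num_subgroups n) \<le> 51"
  proof (rule sum_num_subgroups_le)
    fix H K assume HK: "subgroup H G" "subgroup K G" "card H \<in> {2, 3, 4, 5, 6, 10}" "card K \<in> {2, 3, 4, 5, 6, 10::nat}"
    show "H <#> K \<noteq> carrier G"
    proof
      assume eq: "H <#> K = carrier G"
      have c: "card H * card K = 60 * card (H \<inter> K)" using comaximal_card[OF HK(1,2) eq] ord by simp
      then have "60 dvd card H * card K" by simp
      then have "card H = 6 \<and> card K = 10 \<or> card H = 10 \<and> card K = 6" using HK(3,4) by auto
      then show False using no610[OF HK(1) _ HK(2)] c eq by auto
    qed
  qed (use ord in auto)
  then show False using n15 n3 n4 n5 n6 n10 by simp
qed

text \<open>There would be 24 elements of order 5 and 20 elements of order 3.\<close>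

lemma order_not_30:
  assumes ord: "order G = 30" and n5: "num_subgroups 5 = 6"
  shows False
proof -
  have nf: "\<not> 2 * order G dvd fact 4" using ord by (simp add: fact_numeral)
  have s3: "num_subgroups 3 mod 3 = 1" "num_subgroups 3 * 3 dvd order G" using num_subgroups_sylow[of 3 3 1] ord by auto
  then have "num_subgroups 3 dvd 10" using dvd_cofactor[of "num_subgroups 3" 3 "order G" 10] ord by simp
  moreover have "4 < num_subgroups 3" using num_subgroups_prime_power_gt[of 3 3 1, OF _ _ _ _ dvd_refl nf] ord by simp
  ultimately have n3: "num_subgroups 3 = 10"
    using divisor_residue_in_list[of "num_subgroups 3" 3 10 5 11 "[10]"] s3 dvd_imp_le[of "num_subgroups 3" 10] by simp
  have "card (prime_elements 3) + card (prime_elements 5) < order G"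
    by (rule card_disjoint_le[OF prime_elements_subset prime_elements_subset prime_elements_disjoint]) auto
  then show False using card_prime_elements[of 3] card_prime_elements[of 5] n3 n5 ord by simp
qed

text \<open>If 125 divides the order, four classes have at least 13 members each, as 125 does not divide \<open>12!\<close>.
If 25 is the exact power of 5, there are 16 Sylow subgroups of order 25, and 16 divides the order; the orders 5,
25, 2, 4, 8 suffice.  Otherwise the Sylow number is 6, 16 or 36, as larger primes do not divide it.  For 6
the order is 30, 60 or 120.  For 16 it divides 1920, and if 3 does not divide it, a Sylow
2-subgroup has index 5.  For 36 the orders 5, 2, 4, 3 suffice.\<close>

lemma largest_prime_not_5:
  assumes g5: "5 dvd order G" and largest: "\<And>q. prime q \<Longrightarrow> q dvd order G \<Longrightarrow> q \<le> 5"
  shows False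
proof -
  have big: "\<not> q dvd order G" if "prime q" "5 < q" for q using largest[of q] that by auto
  note sum = largest_prime_sum[of 5, OF _ _ g5 largest]
  have ge: "Suc m \<le> num_subgroups q"
    if "prime p" "q = p ^ i" "0 < i" "q dvd order G" "d dvd order G" "\<not> 2 * d dvd fact m" for p q i d m
    using num_subgroups_prime_power_gt[OF that] by simp
  show False
  proof (cases "25 dvd order G")
    case True
    have m9: "\<not> 2 * order G dvd fact 9"
    proof
      assume "2 * order G dvd fact 9"
      then have "25 dvd (fact 9 :: nat)" using True by (meson dvd_trans dvd_triv_right)
      then show False by (simp add: fact_numeral)
    qed
    have "\<not> 125 dvd order G"
    proof
      assume c: "125 dvd order G"
      have "\<not> 2 * order G dvd fact 12"
      proof
        assume "2 * order G dvd fact 12"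
        then have "125 dvd (fact 12 :: nat)" using c by (meson dvd_trans dvd_triv_right)
        then show False by (simp add: fact_numeral)
      qed
      then show False using sum(2)[of 12] True by auto
    qed
    then have s: "num_subgroups 25 mod 5 = 1" "num_subgroups 25 * 25 dvd order G" using num_subgroups_sylow[of 5 25 2] True by auto
    have s5: "10 \<le> num_subgroups 5" "10 \<le> num_subgroups 25" "num_subgroups 25 \<le> 21" using sum(2)[of 9] m9 True by auto
    then have "num_subgroups 25 \<in> {11, 16, 21}" using residue_in_list[OF s(1), of 10 22 "[11, 16, 21]"] by simp
    moreover have "num_subgroups 25 \<noteq> 11" using s(2) big[of 11] dvd_mult_left by force
    moreover have "num_subgroups 25 \<noteq> 21" using s(2) big[of 7] dvd_trans[of 7 "21 * 25" "order G"] by auto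
    ultimately have n: "num_subgroups 25 = 16" by blast
    then have d: "400 dvd order G" using s(2) by simp
    have "10 \<le> num_subgroups q" if "q = 2 ^ i" "0 < i" "i \<le> 4" for q i
      using ge[of 2 q i "order G" 9] that m9 dvd_trans[OF le_imp_power_dvd[of i 4 2] dvd_trans[OF _ d]] by simp
    from this[of 2 1] this[of 4 2] this[of 8 3]
    show False using sum_list_num_subgroups_le[OF _ _ d, of "[5, 25, 2, 4, 8]"] n s5 by simp
  next
    case False
    then have s: "num_subgroups 5 mod 5 = 1" "num_subgroups 5 * 5 dvd order G" "2 < num_subgroups 5" using num_subgroups_sylow[of 5 5 1] g5 by auto
    have "num_subgroups 5 \<le> 41" using sum(1)[of 4] not_dvd_fact_below[of 5 4] g5 by simp
    then have "num_subgroups 5 \<in> {6, 11, 16, 21, 26, 31, 36, 41}"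
      using residue_in_list[OF s(1), of 2 42 "[6, 11, 16, 21, 26, 31, 36, 41]"] s(3) by simp
    moreover have "\<not> q dvd num_subgroups 5" if "prime q" "5 < q" for q
      using big[OF that] s(2) dvd_trans[of q "num_subgroups 5" "order G"] dvd_mult_left by blast
    from this[of 11] this[of 7] this[of 13] this[of 31] this[of 41]
    have "\<not> 11 dvd num_subgroups 5" "\<not> 7 dvd num_subgroups 5" "\<not> 13 dvd num_subgroups 5" "\<not> 31 dvd num_subgroups 5" "\<not> 41 dvd num_subgroups 5" by simp_all
    ultimately consider "num_subgroups 5 = 6" | "num_subgroups 5 = 16" | "num_subgroups 5 = 36" by auto
    then show False
    proof cases
      case 1
      then have "30 dvd order G" using s(2) by simp
      then obtain k where k: "order G = 30 * k" by blast
      have "order G dvd 30 * 4" using order_dvd_num_subgroups_prime[of 5 1] g5 False 1 by simp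
      then have "k dvd 4" using k by simp
      then have "order G \<in> {30, 60, 120}" using divisor_in_list[of k 4 "[2, 4]"] k by auto
      then show False using order_not_30 order_not_60 order_not_120 1 by blast
    next
      case 2
      then have d: "80 dvd order G" using s(2) by simp
      have up: "order G dvd 1920" using order_dvd_num_subgroups_prime[of 5 3] g5 False 2 by (simp add: fact_numeral)
      show False
      proof (cases "3 dvd order G")
        case True
        have "coprime 80 (3::nat)" by code_simp
        then have d3: "240 dvd order G" using divides_mult[OF d True] by simp
        have ge8: "8 \<le> num_subgroups q" if "prime p" "q = p ^ i" "0 < i" "q dvd order G" for p q i
          using ge[OF that d, of 7] by (simp add: fact_numeral)
        have "8 \<le> num_subgroups 2" "8 \<le> num_subgroups 4" "8 \<le> num_subgroups 8" "8 \<le> num_subgroups 16" "8 \<le> num_subgroups 3"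
          using ge8[of 2 2 1] ge8[of 2 4 2] ge8[of 2 8 3] ge8[of 2 16 4] ge8[of 3 3 1]
            True dvd_trans[OF _ d, of 2] dvd_trans[OF _ d, of 4] dvd_trans[OF _ d, of 8] dvd_trans[OF _ d, of 16]
          by simp_all
        then show False using sum_list_num_subgroups_le[OF _ _ d3, of "[5, 3, 2, 4, 8, 16]"] 2 by simp
      next
        case no3: False
        obtain k where k: "order G = 80 * k" using d by blast
        then have "80 * k dvd 80 * 24" using up by simp
        then have "k dvd 24" by (subst (asm) dvd_times_left_cancel_iff) auto
        then have "k \<in> {1, 2, 3, 4, 6, 8, 12, 24}"
          using divisor_in_list[of k 24 "[2, 3, 4, 6, 8, 12, 24]"] by auto
        then have "k \<in> {1, 2, 4, 8}" using no3 k by auto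
        then have "order G = 2 ^ 4 * 5 \<or> order G = 2 ^ 5 * 5 \<or> order G = 2 ^ 6 * 5 \<or> order G = 2 ^ 7 * 5"
          using k by auto
        then obtain a where a: "order G = 2 ^ a * 5" "0 < a" by (metis zero_less_numeral)
        have "2 * order G dvd fact 5" using order_dvd_fact_cofactor[OF two_is_prime_nat a] by simp
        then have "80 dvd (fact 5 :: nat)" using d by (meson dvd_trans dvd_triv_right)
        then show False by (simp add: fact_numeral)
      qed
    next
      case 3
      then have d: "180 dvd order G" using s(2) by simp
      have ge6: "6 \<le> num_subgroups q" if "prime p" "q = p ^ i" "0 < i" "q dvd order G" for p q i
        using ge[OF that d, of 5] by (simp add: fact_numeral)
      have "6 \<le> num_subgroups 2" "6 \<le> num_subgroups 4" "6 \<le> num_subgroups 3"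
        using ge6[of 2 2 1] ge6[of 2 4 2] ge6[of 3 3 1] d dvd_trans[of _ 180 "order G"] by auto
      then show False using sum_list_num_subgroups_le[OF _ _ d, of "[5, 2, 4, 3]"] 3 by simp
    qed
  qed
qed

end

section \<open>Excluding the largest prime divisor 3\<close>

context few_independent
begin

text \<open>The prime powers 2, 4, 8, 3, 9 account for at least 48 subgroups.  If a subgroup of order 3 is
normalized by an involution, there are subgroups of order 6, with at least 8 of them; otherwise
its number of conjugates is a multiple of 16.\<close>

lemma order_not_144:
  assumes ord: "order G = 144" and n9: "num_subgroups 9 = 16"
  shows False
proof -
  have nf: "\<not> 2 * order G dvd fact 7" using ord by (simp add: fact_numeral)
  have ge: "8 \<le> num_subgroups q" if "prime p" "q = p ^ i" "0 < i" "q dvd order G" for p q i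
    using num_subgroups_prime_power_gt[OF that dvd_refl nf] by simp
  have g: "8 \<le> num_subgroups 2" "8 \<le> num_subgroups 4" "8 \<le> num_subgroups 8" "8 \<le> num_subgroups 3"
    using ge[of 2 2 1] ge[of 2 4 2] ge[of 2 8 3] ge[of 3 3 1] ord by auto
  obtain H where H: "subgroup H G" "card H = 3"
    using exists_subgroup_of_prime_power_order[of 3 1] ord by auto
  have sN: "subgroup (normalizer_of H) G" by (rule subgroup_normalizer[OF H(1)])
  have cc: "card (conjugates H) * card (normalizer_of H) = 144" using card_conjugates[OF H(1)] ord by simp
  show False
  proof (cases "even (card (normalizer_of H))")
    case True
    then obtain R where R: "subgroup R G" "R \<subseteq> normalizer_of H" "card R = 2"
      using Cauchy_in_subgroup[OF sN two_is_prime_nat] by blast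
    have "coprime (3::nat) 2" by simp
    then obtain K where K: "subgroup K G" "card K = 6"
      using card_product_with_normalizer[OF H(1) R(1,2)] H(2) R(3) by auto
    have "8 \<le> num_subgroups 6" using num_subgroups_gt[OF K, of 7] nf ord by simp
    then show False using sum_list_num_subgroups_le[of "[2, 3, 4, 6, 8, 9]" 144] ord g n9 by simp
  next
    case False
    have "coprime 2 (card (normalizer_of H))" using False by simp
    then have "coprime (2 ^ 4) (card (normalizer_of H))" by (subst coprime_power_left_iff) simp
    moreover have "2 ^ 4 dvd card (conjugates H) * card (normalizer_of H)" unfolding cc by simp
    ultimately have "2 ^ 4 dvd card (conjugates H)" by (simp add: coprime_dvd_mult_left_iff)
    moreover have "card (conjugates H) > 0" using cc by (auto intro!: Nat.gr0I)
    ultimately have "16 \<le> card (conjugates H)" by (auto dest!: dvd_imp_le)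
    also have "\<dots> \<le> num_subgroups 3"
      unfolding num_subgroups_def using conjugates_props[OF H(1)] H(2) by (intro card_mono) auto
    finally show False using sum_list_num_subgroups_le[of "[2, 3, 4, 8, 9]" 144] ord g n9 by simp
  qed
qed

text \<open>The order is \<open>2\<^sup>a 3\<^sup>b\<close>.  If \<open>b = 1\<close> a Sylow 2-subgroup has index 3; so \<open>b \<ge> 2\<close>, and the
Sylow number for 3, a power of 2, can only be 4 or 16.  As 9 does not divide \<open>4!\<close>, it is 16.  Then every
class has at least 8 members, and at least 9 if 27 divides the order.  Families of prime powers
exclude everything except \<open>a = 4\<close>, \<open>b = 2\<close>.\<close>

lemma largest_prime_not_3:
  assumes g3: "3 dvd order G" and largest: "\<And>q. prime q \<Longrightarrow> q dvd order G \<Longrightarrow> q \<le> 3"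
  shows False
proof -
  have big: "\<not> q dvd order G" if "prime q" "3 < q" for q using largest[of q] that by auto
  have two_or_three: "q = 2 \<or> q = 3" if "prime q" "q dvd order G" for q
    using largest[OF that] prime_ge_2_nat[OF that(1)] by auto
  have og: "order G \<noteq> 0" using order_pos by simp
  obtain m where m: "order G = 2 ^ multiplicity 2 (order G) * m" "\<not> 2 dvd m"
    using multiplicity_decompose'[OF og, of 2] by auto
  obtain m' where m': "order G = 3 ^ multiplicity 3 (order G) * m'" "\<not> 3 dvd m'"
    using multiplicity_decompose'[OF og, of 3] by auto
  have md: "m dvd order G" "m' dvd order G" using m(1) m'(1) by (metis dvd_triv_right)+
  have even: "2 dvd order G"
  proof (rule ccontr)
    assume odd: "\<not> 2 dvd order G"
    have "m' = 1"
    proof (rule ccontr)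
      assume "m' \<noteq> 1"
      then obtain q where q: "prime q" "q dvd m'" using prime_factor_nat by blast
      then have "q = 2 \<or> q = 3" using two_or_three dvd_trans[OF _ md(2)] by blast
      then show False using q(2) m'(2) odd md(2) dvd_trans by auto
    qed
    then show False using m'(1) order_not_prime_power[of 3 "multiplicity 3 (order G)"] by simp
  qed
  have g9: "9 dvd order G"
  proof (rule ccontr)
    assume n9: "\<not> 9 dvd order G"
    have "m dvd 3"
    proof (rule dvd_prime_if_only_prime_divisor)
      show "m \<noteq> 0" using md(1) og by auto
      show "q = 3" if "prime q" "q dvd m" for q
        using two_or_three[OF that(1) dvd_trans[OF that(2) md(1)]] that(2) m(2) by auto
      show "\<not> 3\<^sup>2 dvd m" using n9 md(1) dvd_trans by auto
    qed
    then have "m \<le> 3" by (auto dest: dvd_imp_le)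
    then have "(fact m :: nat) dvd fact 3" by (intro fact_dvd)
    moreover have "0 < multiplicity 2 (order G)" using even og by (simp add: prime_multiplicity_gt_zero_iff)
    then have "2 * order G dvd fact m" using order_dvd_fact_cofactor[OF two_is_prime_nat m(1)] m(2) by blast
    ultimately have "2 * order G dvd fact 3" using dvd_trans by blast
    then have "order G dvd 3" by (simp add: fact_numeral)
    then show False using even dvd_trans[of 2 "order G" 3] by auto
  qed
  define b where "b = multiplicity 3 (order G)"
  have b0: "0 < b" using g3 og by (simp add: b_def prime_multiplicity_gt_zero_iff)
  have bd: "3 ^ b dvd order G" "\<not> 3 ^ b * 3 dvd order G"
    using multiplicity_dvd[of 3 "order G"] not_dvd_Suc_multiplicity[of 3 "order G"] og unfolding b_def by simp_all
  have s: "num_subgroups (3 ^ b) mod 3 = 1" "num_subgroups (3 ^ b) * 3 ^ b dvd order G" "2 * order G dvd fact (num_subgroups (3 ^ b))"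
    "2 < num_subgroups (3 ^ b)"
    using num_subgroups_sylow[OF _ refl b0 bd] by simp_all
  have "num_subgroups (3 ^ b) \<le> 51"
  proof -
    have "1 < (3::nat) ^ b" using one_less_power[of "3::nat" b] b0 by simp
    moreover have "\<not> order G dvd 3 ^ b * 3 ^ b"
    proof
      assume "order G dvd 3 ^ b * 3 ^ b"
      then have "2 dvd (3::nat) ^ b * 3 ^ b" using even dvd_trans by blast
      then show False by simp
    qed
    ultimately show ?thesis using sum_list_num_subgroups_le[OF _ _ dvd_refl, of "[3 ^ b]"] by simp
  qed
  then have "num_subgroups (3 ^ b) \<in> {4, 7, 10, 13, 16, 19, 22, 25, 28, 31, 34, 37, 40, 43, 46, 49}"
    using residue_in_list[OF s(1), of 2 52 "[4, 7, 10, 13, 16, 19, 22, 25, 28, 31, 34, 37, 40, 43, 46, 49]"] s(4)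
    by simp
  moreover have nd: "\<not> q dvd num_subgroups (3 ^ b)" if "prime q" "3 < q" for q
    using big[OF that] s(2) dvd_trans[of q "num_subgroups (3 ^ b)" "order G"] dvd_mult_left by blast
  have "\<not> 5 dvd num_subgroups (3 ^ b)" "\<not> 7 dvd num_subgroups (3 ^ b)" "\<not> 11 dvd num_subgroups (3 ^ b)" "\<not> 13 dvd num_subgroups (3 ^ b)"
    "\<not> 17 dvd num_subgroups (3 ^ b)" "\<not> 19 dvd num_subgroups (3 ^ b)" "\<not> 23 dvd num_subgroups (3 ^ b)" "\<not> 31 dvd num_subgroups (3 ^ b)"
    "\<not> 37 dvd num_subgroups (3 ^ b)" "\<not> 43 dvd num_subgroups (3 ^ b)"
    by (rule nd; simp)+
  ultimately have "num_subgroups (3 ^ b) = 4 \<or> num_subgroups (3 ^ b) = 16" by auto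
  moreover have "num_subgroups (3 ^ b) \<noteq> 4"
  proof
    assume "num_subgroups (3 ^ b) = 4"
    then have "2 * order G dvd fact 4" using s(3) by simp
    then have "9 dvd (fact 4 :: nat)" using g9 by (meson dvd_trans dvd_triv_right)
    then show False by (simp add: fact_numeral)
  qed
  ultimately have n: "num_subgroups (3 ^ b) = 16" by blast
  have d16: "16 dvd order G" using s(2) n dvd_mult_left by metis
  have "coprime 16 (9::nat)" by code_simp
  then have d144: "144 dvd order G" using divides_mult[OF d16 g9] by simp
  have ge: "Suc k \<le> num_subgroups q"
    if "prime p" "q = p ^ i" "0 < i" "q dvd order G" "d dvd order G" "\<not> 2 * d dvd fact k" for p q i d k
    using num_subgroups_prime_power_gt[OF that] by simp
  have d248: "2 dvd order G" "4 dvd order G" "8 dvd order G"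
    using dvd_trans[OF _ d16, of 2] dvd_trans[OF _ d16, of 4] dvd_trans[OF _ d16, of 8] by simp_all
  show False
  proof (cases "27 dvd order G")
    case True
    have "coprime 16 (27::nat)" by code_simp
    then have d432: "432 dvd order G" using divides_mult[OF d16 True] by simp
    have nf: "\<not> 2 * 432 dvd (fact 8 :: nat)" by (simp add: fact_numeral)
    have g: "9 \<le> num_subgroups 2" "9 \<le> num_subgroups 4" "9 \<le> num_subgroups 8" "9 \<le> num_subgroups 3" "9 \<le> num_subgroups 9" "9 \<le> num_subgroups 27"
      using ge[of 2 2 1, OF _ _ _ _ d432 nf] ge[of 2 4 2, OF _ _ _ _ d432 nf] ge[of 2 8 3, OF _ _ _ _ d432 nf]
        ge[of 3 3 1, OF _ _ _ _ d432 nf] ge[of 3 9 2, OF _ _ _ _ d432 nf] ge[of 3 27 3, OF _ _ _ _ d432 nf]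
        d248 g3 g9 True by simp_all
    show False
    proof (cases "81 dvd order G")
      case True
      have "coprime 16 (81::nat)" by code_simp
      then have "1296 dvd order G" using divides_mult[OF d16 True] by simp
      then show False using sum_list_num_subgroups_le[of "[2, 4, 8, 3, 9, 27]" 1296] g by simp
    next
      case False
      have "multiplicity 3 (order G) = 3" using True False by (intro multiplicity_eqI) auto
      then have "num_subgroups 27 = 16" using n by (simp add: b_def)
      then show False using sum_list_num_subgroups_le[OF _ _ d432, of "[2, 4, 8, 3, 9, 27]"] g by simp
    qed
  next
    case n27: False
    have "multiplicity 3 (order G) = 2" using g9 n27 by (intro multiplicity_eqI) auto
    then have b2: "b = 2" "num_subgroups 9 = 16" using n by (simp_all add: b_def)
    show False
    proof (cases "32 dvd order G")
      case True
      have "coprime 32 (9::nat)" by code_simp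
      then have d288: "288 dvd order G" using divides_mult[OF True g9] by simp
      have nf: "\<not> 2 * 144 dvd (fact 7 :: nat)" by (simp add: fact_numeral)
      have "8 \<le> num_subgroups 2" "8 \<le> num_subgroups 4" "8 \<le> num_subgroups 8" "8 \<le> num_subgroups 16" "8 \<le> num_subgroups 3"
        using ge[of 2 2 1, OF _ _ _ _ d144 nf] ge[of 2 4 2, OF _ _ _ _ d144 nf] ge[of 2 8 3, OF _ _ _ _ d144 nf]
          ge[of 2 16 4, OF _ _ _ _ d144 nf] ge[of 3 3 1, OF _ _ _ _ d144 nf] d248 g3 d16 by simp_all
      then show False using sum_list_num_subgroups_le[OF _ _ d288, of "[2, 4, 8, 16, 3, 9]"] b2(2) by simp
    next
      case False
      obtain k where k: "order G = 144 * k" using d144 by blast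
      have "k = 1"
      proof (rule ccontr)
        assume "k \<noteq> 1"
        then obtain q where q: "prime q" "q dvd k" using prime_factor_nat by blast
        then have "144 * q dvd order G" using k by simp
        moreover have "q = 2 \<or> q = 3" using two_or_three q k by simp
        ultimately show False using False n27 dvd_trans[of 32 288 "order G"] dvd_trans[of 27 432 "order G"] by auto
      qed
      then show False using order_not_144 k b2(2) by simp
    qed
  qed
qed

theorem no_simple_group_with_few_independent: False
proof -
  define A where "A = {q. prime q \<and> q dvd order G}"
  have "finite A" unfolding A_def using order_pos by (intro finite_subset[OF _ finite_divisors_nat]) auto
  moreover have "order G \<noteq> 1" using order_gt_2 by simp
  then have "A \<noteq> {}" using prime_factor_nat[of "order G"] unfolding A_def by blast
  ultimately have M: "Max A \<in> A" "\<And>q. q \<in> A \<Longrightarrow> q \<le> Max A" by auto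
  define p where "p = Max A"
  have p: "prime p" "p dvd order G" using M(1) by (auto simp: p_def A_def)
  have largest: "q \<le> p" if "prime q" "q dvd order G" for q using M(2)[of q] that by (simp add: p_def A_def)
  have "p \<le> 5" using largest_prime_le_5[OF p largest] .
  then have "p = 2 \<or> p = 3 \<or> p = 5"
    using prime_in_list[OF p(1), of 2 6 "[2, 3, 5]"] prime_ge_2_nat[OF p(1)] by simp
  then consider "p = 2" | "p = 3" | "p = 5" by blast
  then show False
  proof cases
    case 1
    have og: "order G \<noteq> 0" using order_pos by simp
    obtain m where m: "order G = 2 ^ multiplicity 2 (order G) * m" "\<not> 2 dvd m"
      using multiplicity_decompose'[OF og, of 2] by auto
    have "m = 1"
    proof (rule ccontr)
      assume "m \<noteq> 1"
      then obtain q where q: "prime q" "q dvd m" using prime_factor_nat by blast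
      have "m dvd order G" using m(1) by (metis dvd_triv_right)
      then have "q \<le> 2" using largest[of q] q 1 dvd_trans by blast
      then have "q = 2" using prime_ge_2_nat[OF q(1)] by simp
      then show False using q m by simp
    qed
    then show False using m(1) order_not_prime_power[of 2 "multiplicity 2 (order G)"] by simp
  next
    case 2
    then show False using largest_prime_not_3 p largest by simp
  next
    case 3
    then show False using largest_prime_not_5 p largest by simp
  qed
qed

end

section \<open>Simple sections of nonsolvable groups\<close>

context finite_group
begin

text \<open>The centre of a nontrivial group of prime power order is nontrivial, so here it is the whole
group.\<close>

lemma prime_power_order_simple_imp_solvable:
  assumes simple: "\<And>N. N \<lhd> G \<Longrightarrow> N = {\<one>} \<or> N = carrier G" and p: "prime (p::nat)" and ord: "order G = p ^ a"
  shows "solvable G"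
proof -
  let ?f = "\<lambda>g x. g \<otimes> x \<otimes> inv g"
  let ?Z = "{g \<in> carrier G. \<forall>x\<in>carrier G. ?f g x = x}"
  have act: "acts (carrier G) (carrier G) ?f" by (rule acts_conjugation[OF subgroup_self])
  have Z: "?Z \<lhd> G" by (rule kernel_of_action_normal[OF act])
  have Zfix: "?Z = {x \<in> carrier G. \<forall>g\<in>carrier G. ?f g x = x}"
    using conjugation_fixes_iff_commute by (intro Collect_cong) (metis (no_types, lifting))
  have cong: "[card (carrier G) = card ?Z] (mod p)"
    unfolding Zfix using p_group_fixed_points[OF act _ p] ord by (simp add: order_def)
  show ?thesis
  proof (cases "?Z = carrier G")
    case True
    have "comm_group G"
    proof (rule group_comm_groupI)
      fix x y assume xy: "x \<in> carrier G" "y \<in> carrier G"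
      then have "?f x y = y" using True by blast
      then show "x \<otimes> y = y \<otimes> x" using conjugation_fixes_iff_commute[OF xy] by blast
    qed
    then have "derived G (carrier G) = {\<one>}" by (rule comm_group.derived_eq_singleton) simp
    then have "(derived G ^^ 1) (carrier G) = {\<one>}" by simp
    then show ?thesis unfolding solvable_iff_trivial_derived_seq by blast
  next
    case False
    then have "?Z = {\<one>}" using simple[OF Z] by blast
    then have "[p ^ a = 1] (mod p)" using cong ord by (simp add: order_def)
    then have "a = 0" using prime_gt_1_nat[OF p] by (cases a) (auto simp: cong_def)
    then have "card (carrier G) = 1" using ord by (simp add: order_def)
    then have "carrier G = {\<one>}" using card_1_singletonE one_closed by (metis singletonD)
    then show ?thesis unfolding solvable_def using solvable_seq.unity[of G] by simp
  qed
qed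

text \<open>\<open>H\<close> is a nonsolvable subgroup of least order and \<open>N\<close> a maximal proper normal
subgroup of it.  Then \<open>N\<close> is solvable, so the quotient is not, and the quotient is simple because
normal subgroups can be pulled back.\<close>

lemma nonsolvable_imp_nonabelian_simple_section:
  assumes "\<not> solvable G"
  obtains H N where "subgroup H G" "N \<lhd> G\<lparr>carrier := H\<rparr>" "nonabelian_simple (G\<lparr>carrier := H\<rparr> Mod N)"
proof -
  define \<H> where "\<H> = {H. subgroup H G \<and> \<not> solvable (G\<lparr>carrier := H\<rparr>)}"
  have "carrier G \<in> \<H>" using assms subgroup_self by (simp add: \<H>_def)
  then obtain H where H: "H \<in> \<H>" "\<And>K. K \<in> \<H> \<Longrightarrow> card H \<le> card K"
    using exists_least_iff[of "\<lambda>n. \<exists>H\<in>\<H>. card H = n"] by (metis linorder_not_less)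
  have sH: "subgroup H G" "\<not> solvable (G\<lparr>carrier := H\<rparr>)" using H(1) by (auto simp: \<H>_def)
  define M where "M = G\<lparr>carrier := H\<rparr>"
  have cM: "carrier M = H" by (simp add: M_def)
  interpret M: finite_group M unfolding M_def by (rule finite_group_restrict[OF sH(1)])
  define \<N> where "\<N> = {N. N \<lhd> M \<and> N \<noteq> carrier M}"
  have "carrier M \<noteq> {\<one>\<^bsub>M\<^esub>}"
  proof
    assume "carrier M = {\<one>\<^bsub>M\<^esub>}"
    then have "solvable M" unfolding solvable_def using solvable_seq.unity[of M] by simp
    then show False using sH(2) by (simp add: M_def)
  qed
  then have N0: "{\<one>\<^bsub>M\<^esub>} \<in> \<N>" using M.one_is_normal by (auto simp: \<N>_def)
  have "\<N> \<subseteq> Pow (carrier M)"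
    unfolding \<N>_def using subgroup.subset[OF normal_imp_subgroup] by blast
  then have fin\<N>: "finite (card ` \<N>)" using M.fin finite_subset by blast
  obtain N where N: "N \<in> \<N>" "\<And>K. K \<in> \<N> \<Longrightarrow> card K \<le> card N"
  proof -
    have "Max (card ` \<N>) \<in> card ` \<N>" using fin\<N> N0 by (intro Max_in) auto
    then obtain N where "N \<in> \<N>" "card N = Max (card ` \<N>)" by auto
    then show ?thesis using that[of N] fin\<N> by auto
  qed
  have nN: "N \<lhd> M" "N \<noteq> carrier M" using N(1) by (auto simp: \<N>_def)
  interpret N: normal N M by (rule nN(1))
  define Q where "Q = M Mod N"
  have sN: "subgroup N M" by (rule N.subgroup_axioms)
  have gQ: "group Q" unfolding Q_def by (rule N.factorgroup_is_group)
  define h where "h = (\<lambda>a. N #>\<^bsub>M\<^esub> a)"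
  interpret h: group_hom M Q h
    using N.r_coset_hom_Mod gQ M.is_group unfolding h_def Q_def
    by (intro group_hom.intro group_hom_axioms.intro)
  have surj: "h ` carrier M = carrier Q"
    unfolding h_def Q_def FactGroup_def RCOSETS_def by auto
  have oneQ: "\<one>\<^bsub>Q\<^esub> = N" by (simp add: Q_def FactGroup_def)
  have ker: "h x = \<one>\<^bsub>Q\<^esub> \<longleftrightarrow> x \<in> N" if "x \<in> carrier M" for x
    unfolding oneQ h_def using M.coset_join1[OF _ that sN] M.coset_join2[OF that sN] by blast
  have finQ: "finite (carrier Q)" unfolding surj[symmetric] by simp
  interpret Q: finite_group Q
    using gQ finQ by (simp add: finite_group_def finite_group_axioms_def)
  have simpleQ: "K = {\<one>\<^bsub>Q\<^esub>} \<or> K = carrier Q" if K: "K \<lhd> Q" for K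
  proof -
    let ?K = "{x \<in> carrier M. h x \<in> K}"
    have sK: "subgroup K Q" by (rule normal_imp_subgroup[OF K])
    have "K \<subseteq> h ` carrier M" using subgroup.subset[OF sK] surj by simp
    then have hK: "h ` ?K = K" by blast
    have nK: "?K \<lhd> M"
      unfolding M.normal_inv_iff
    proof (intro conjI ballI)
      show "subgroup ?K M"
      proof (rule M.subgroupI)
        show "?K \<noteq> {}" using subgroup.one_closed[OF sK] h.hom_one by auto
        show "inv\<^bsub>M\<^esub> a \<in> ?K" if "a \<in> ?K" for a using that subgroup.m_inv_closed[OF sK] by auto
        show "a \<otimes>\<^bsub>M\<^esub> b \<in> ?K" if "a \<in> ?K" "b \<in> ?K" for a b using that subgroup.m_closed[OF sK] by auto
      qed auto
      fix x y assume "x \<in> carrier M" "y \<in> ?K"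
      then show "x \<otimes>\<^bsub>M\<^esub> y \<otimes>\<^bsub>M\<^esub> inv\<^bsub>M\<^esub> x \<in> ?K"
        using K unfolding h.H.normal_inv_iff by auto
    qed
    have NK: "N \<subseteq> ?K"
    proof
      fix x assume x: "x \<in> N"
      then have "x \<in> carrier M" using subgroup.subset[OF sN] by blast
      then show "x \<in> ?K" using ker[of x] x subgroup.one_closed[OF sK] by auto
    qed
    have "N = ?K" if "?K \<noteq> carrier M"
    proof (rule card_seteq[OF _ NK])
      show "card ?K \<le> card N" using N(2) nK that by (simp add: \<N>_def)
    qed simp
    then have "?K = carrier M \<or> ?K = N" by blast
    then show ?thesis
    proof
      assume "?K = carrier M"
      then show ?thesis using hK surj by simp
    next
      assume "?K = N"
      then have "h ` N = K" using hK by simp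
      moreover have "h x = \<one>\<^bsub>Q\<^esub>" if "x \<in> N" for x using ker[of x] that subgroup.subset[OF sN] by blast
      ultimately have "K \<subseteq> {\<one>\<^bsub>Q\<^esub>}" by auto
      then show ?thesis using subgroup.one_closed[OF sK] by blast
    qed
  qed
  have nonsolvQ: "\<not> solvable Q"
  proof
    assume "solvable Q"
    have sNG: "subgroup N G" using incl_subgroup[OF sH(1)] sN unfolding M_def by blast
    have NH: "N \<subset> H" using nN(2) subgroup.subset[OF sN] cM by blast
    then have "card N < card H" using finite_subgroup[OF sH(1)] by (rule psubset_card_mono[rotated])
    then have "N \<notin> \<H>" using H(2)[of N] by auto
    then have "solvable (G\<lparr>carrier := N\<rparr>)" using sNG by (simp add: \<H>_def)
    moreover have "G\<lparr>carrier := N\<rparr> = M\<lparr>carrier := N\<rparr>" by (simp add: M_def)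
    ultimately have solvN: "solvable (M\<lparr>carrier := N\<rparr>)" by simp
    interpret i: group_hom "M\<lparr>carrier := N\<rparr>" M id
      using M.subgroup_imp_group[OF sN] M.is_group subgroup.subset[OF sN]
      by (intro group_hom.intro group_hom_axioms.intro) (auto simp: hom_def)
    have "solvable M"
    proof (rule solvable_condition[OF i.group_hom_axioms h.group_hom_axioms surj _ solvN \<open>solvable Q\<close>])
      show "kernel M Q h \<subseteq> id ` carrier (M\<lparr>carrier := N\<rparr>)" using ker by (auto simp: kernel_def)
    qed
    then show False using sH(2) by (simp add: M_def)
  qed
  have "nonabelian_simple Q"
  proof unfold_locales
    show "K = {\<one>\<^bsub>Q\<^esub>} \<or> K = carrier Q" if "K \<lhd> Q" for K using simpleQ[OF that] .
    show "order Q \<noteq> p ^ a" if "prime p" for p :: nat and a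
      using Q.prime_power_order_simple_imp_solvable[OF simpleQ that] nonsolvQ by blast
  qed
  then show ?thesis using that[OF sH(1)] nN(1) by (simp add: M_def Q_def)
qed

lemma card_independent_set_le:
  assumes "independent_set (with_proj (comaximal_subgroup_graph G)) S"
  shows "card S \<le> independence_number (with_proj (comaximal_subgroup_graph G))"
proof -
  let ?\<Gamma> = "with_proj (comaximal_subgroup_graph G)"
  have "verts ?\<Gamma> \<subseteq> Subgroups" by (auto simp: comaximal_subgroup_graph_def Let_def Subgroups_def)
  then have f: "finite (verts ?\<Gamma>)" by (rule finite_subset[OF _ finite_Subgroups])
  have "{card S |S. independent_set ?\<Gamma> S} \<subseteq> {..card (verts ?\<Gamma>)}"
    unfolding independent_set_def using card_mono[OF f] by blast
  then have "finite {card S |S. independent_set ?\<Gamma> S}" by (rule finite_subset) simp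
  then show ?thesis unfolding independence_number_def using assms by (intro Max_ge) auto
qed

text \<open>The preimages in \<open>H\<close> of the members of the family are vertices of the graph.  If two preimages have
product \<open>G\<close>, then \<open>H = G\<close> and the images have the whole quotient as product.\<close>

lemma section_independent_bound:
  assumes H: "subgroup H G" and N: "N \<lhd> G\<lparr>carrier := H\<rparr>" and Q: "Q = G\<lparr>carrier := H\<rparr> Mod N"
    and sub: "\<And>K. K \<in> \<S> \<Longrightarrow> subgroup K Q \<and> K \<noteq> {\<one>\<^bsub>Q\<^esub>} \<and> K \<noteq> carrier Q"
    and indep: "\<And>K L. K \<in> \<S> \<Longrightarrow> L \<in> \<S> \<Longrightarrow> K \<noteq> L \<Longrightarrow> K <#>\<^bsub>Q\<^esub> L \<noteq> carrier Q"
  shows "card \<S> \<le> independence_number (with_proj (comaximal_subgroup_graph G))"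
proof -
  define M where "M = G\<lparr>carrier := H\<rparr>"
  have cM: "carrier M = H" by (simp add: M_def)
  interpret M: finite_group M unfolding M_def by (rule finite_group_restrict[OF H])
  interpret N: normal N M using N by (simp add: M_def)
  have QM: "Q = M Mod N" using Q by (simp add: M_def)
  define h where "h = (\<lambda>a. N #>\<^bsub>M\<^esub> a)"
  interpret h: group_hom M Q h
    using N.r_coset_hom_Mod N.factorgroup_is_group M.is_group unfolding h_def QM
    by (intro group_hom.intro group_hom_axioms.intro)
  have surj: "h ` carrier M = carrier Q"
    unfolding h_def QM FactGroup_def RCOSETS_def by auto
  define pre where "pre K = {x \<in> carrier M. h x \<in> K}" for K
  have hpre: "h ` pre K = K" if "K \<in> \<S>" for K
  proof -
    have "K \<subseteq> h ` carrier M" using sub[OF that] subgroup.subset[of K Q] surj by simp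
    then show ?thesis unfolding pre_def by blast
  qed
  have spre: "subgroup (pre K) G" if K: "K \<in> \<S>" for K
  proof -
    have sK: "subgroup K Q" using sub[OF K] by blast
    have "subgroup (pre K) M"
    proof (rule M.subgroupI)
      show "pre K \<noteq> {}" unfolding pre_def using subgroup.one_closed[OF sK] h.hom_one by auto
      show "inv\<^bsub>M\<^esub> a \<in> pre K" if "a \<in> pre K" for a
        using that subgroup.m_inv_closed[OF sK] by (auto simp: pre_def)
      show "a \<otimes>\<^bsub>M\<^esub> b \<in> pre K" if "a \<in> pre K" "b \<in> pre K" for a b
        using that subgroup.m_closed[OF sK] by (auto simp: pre_def)
    qed (auto simp: pre_def)
    then show ?thesis using incl_subgroup[OF H] by (simp add: M_def)
  qed
  have "inj_on pre \<S>" using hpre by (metis inj_onI)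
  then have "card (pre ` \<S>) = card \<S>" by (rule card_image)
  moreover have "independent_set (with_proj (comaximal_subgroup_graph G)) (pre ` \<S>)"
    unfolding independent_set_def
  proof (intro conjI ballI impI)
    have "pre K \<noteq> {\<one>}" if K: "K \<in> \<S>" for K
    proof
      assume "pre K = {\<one>}"
      then have "pre K = {\<one>\<^bsub>M\<^esub>}" by (simp add: M_def)
      then have "K = {\<one>\<^bsub>Q\<^esub>}" using hpre[OF K] by simp
      then show False using sub[OF K] by blast
    qed
    moreover have "pre K \<noteq> carrier G" if K: "K \<in> \<S>" for K
    proof
      assume a: "pre K = carrier G"
      then have "carrier G \<subseteq> carrier M" by (auto simp: pre_def)
      then have "carrier G = carrier M" using cM subgroup.subset[OF H] by blast
      then have "pre K = carrier M" using a by simp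
      then show False using hpre[OF K] surj sub[OF K] by simp
    qed
    ultimately show "pre ` \<S> \<subseteq> verts (with_proj (comaximal_subgroup_graph G))"
      using spre by (auto simp: comaximal_subgroup_graph_def Let_def)
    fix A B assume AB: "A \<in> pre ` \<S>" "B \<in> pre ` \<S>" "A \<noteq> B"
    then obtain K L where KL: "K \<in> \<S>" "L \<in> \<S>" "A = pre K" "B = pre L" "K \<noteq> L" by blast
    have "A <#> B \<noteq> carrier G"
    proof
      assume eq: "A <#> B = carrier G"
      have "carrier Q \<subseteq> K <#>\<^bsub>Q\<^esub> L"
      proof
        fix y assume "y \<in> carrier Q"
        then obtain x where x: "x \<in> carrier M" "y = h x" using surj by blast
        then have "x \<in> A <#> B" using eq cM subgroup.subset[OF H] by blast
        then obtain a b where ab: "a \<in> pre K" "b \<in> pre L" "x = a \<otimes> b" unfolding set_mult_def KL(3,4) by blast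
        have "h x = h a \<otimes>\<^bsub>Q\<^esub> h b" using h.hom_mult[of a b] ab by (simp add: pre_def M_def)
        then show "y \<in> K <#>\<^bsub>Q\<^esub> L" unfolding set_mult_def x(2) using ab by (auto simp: pre_def)
      qed
      moreover have "K <#>\<^bsub>Q\<^esub> L \<subseteq> carrier Q"
        using sub[OF KL(1)] sub[OF KL(2)] by (intro h.H.set_mult_closed subgroup.subset) auto
      ultimately show False using indep[OF KL(1,2,5)] by blast
    qed
    then show "\<not> A \<rightarrow>\<^bsub>with_proj (comaximal_subgroup_graph G)\<^esub> B"
      by (simp add: comaximal_subgroup_graph_def Let_def)
  qed
  ultimately show ?thesis using card_independent_set_le by metis
qed

end

theorem theorem2p1:
  fixes G :: "('a, 'b) monoid_scheme"
  assumes "group G"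
    and "finite (carrier G)"
    and "independence_number (with_proj (comaximal_subgroup_graph G)) \<le> 51"
  shows "solvable G"
proof (rule ccontr)
  assume ns: "\<not> solvable G"
  interpret finite_group G using assms(1,2) by (simp add: finite_group_def finite_group_axioms_def)
  obtain H N where HN: "subgroup H G" "N \<lhd> G\<lparr>carrier := H\<rparr>" "nonabelian_simple (G\<lparr>carrier := H\<rparr> Mod N)"
    using nonsolvable_imp_nonabelian_simple_section[OF ns] .
  interpret Q: nonabelian_simple "G\<lparr>carrier := H\<rparr> Mod N" by (rule HN(3))
  interpret Q: few_independent "G\<lparr>carrier := H\<rparr> Mod N"
    by unfold_locales (rule order.trans[OF section_independent_bound[OF HN(1,2) refl] assms(3)])
  show False by (rule Q.no_simple_group_with_few_independent)
qed

end
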